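(* Let $K$ be a field of characteristic $\neq 2$ and let $t\in K$ with $t\neq 0,-1$. Then there exists a dominant rational map from $X_t$ to $K_t=\mathrm{Km}(E_t\times E_t)$ over a finite extension of $K$.
   Context: $X_t$ is the $K3$ surface which is the minimal resolution of the double cover of $\mathbf{P}^2$ with affine equation $y^2=xz(x+1)(z+1)(x+zt)$ (branched over six lines, including the line at infinity). $E_t$ is the elliptic curve $y^2=(x-1)\left(x^2-\frac{1}{t+1}\right)$. For an abelian surface $A$, the Kummer surface $\mathrm{Km}(A)$ is the smooth surface obtained by blowing up the 16 double points of the quotient $A/[-1]$. *)

theory Defs
  imports
    "HOL-Algebra.Algebraic_Closure_Type"
    "HOL-Library.Poly_Mapping"
    "HOL-Library.Function_Algebras"
begin

text \<open>
  Classical (Weil-style) projective varieties. The coordinate field \<open>'a\<close> is algebraically closed,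
  and a subfield \<open>K\<close>, given as a subset of \<open>'a\<close>, serves as field of definition. All varieties in
  question are geometrically integral, so they are determined by their \<open>'a\<close>-points together with
  the forms over \<open>K\<close>.
\<close>

section \<open>Polynomials in several variables\<close>

type_synonym 'a mpol = "(nat \<Rightarrow>\<^sub>0 nat) \<Rightarrow>\<^sub>0 'a"

definition meval :: "'a::comm_ring_1 mpol \<Rightarrow> (nat \<Rightarrow> 'a) \<Rightarrow> 'a" where
  "meval F x = (\<Sum>m\<in>Poly_Mapping.keys F.
     Poly_Mapping.lookup F m * (\<Prod>i\<in>Poly_Mapping.keys m. x i ^ Poly_Mapping.lookup m i))"

definition mconst :: "'a::comm_ring_1 \<Rightarrow> 'a mpol" where
  "mconst c = Poly_Mapping.single 0 c"

definition mpartial :: "nat \<Rightarrow> 'a::comm_ring_1 mpol \<Rightarrow> 'a mpol" where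
  "mpartial i F = (\<Sum>m\<in>Poly_Mapping.keys F.
     Poly_Mapping.single (m - Poly_Mapping.single i 1)
       (of_nat (Poly_Mapping.lookup m i) * Poly_Mapping.lookup F m))"

text \<open>Forms of degree \<open>d\<close> in the variables \<open>0, \<dots>, n\<close> with coefficients in \<open>K\<close>
  (the zero polynomial is a form of every degree).\<close>

definition forms :: "'a::comm_ring_1 set \<Rightarrow> nat \<Rightarrow> nat \<Rightarrow> 'a mpol set" where
  "forms K n d = {F. \<forall>m\<in>Poly_Mapping.keys F.
     Poly_Mapping.lookup F m \<in> K \<and> Poly_Mapping.keys m \<subseteq> {..n} \<and>
     (\<Sum>i\<in>Poly_Mapping.keys m. Poly_Mapping.lookup m i) = d}"


section \<open>Projective space\<close>

text \<open>A point of projective \<open>n\<close>-space is the set of all its homogeneous coordinate vectors, which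
  are indexed by \<open>{..n}\<close> and extended by zero.\<close>

type_synonym 'a ppoint = "(nat \<Rightarrow> 'a) set"

definition proj :: "(nat \<Rightarrow> 'a::field) \<Rightarrow> 'a ppoint" where
  "proj x = {(\<lambda>i. c * x i) | c. c \<noteq> 0}"

definition rep :: "'a ppoint \<Rightarrow> nat \<Rightarrow> 'a" where
  "rep p = (SOME x. x \<in> p)"

definition pspace :: "nat \<Rightarrow> 'a::field ppoint set" where
  "pspace n = {proj x | x. (\<forall>i>n. x i = 0) \<and> (\<exists>i\<le>n. x i \<noteq> 0)}"

definition vanishes_at :: "'a::field mpol \<Rightarrow> 'a ppoint \<Rightarrow> bool" where
  "vanishes_at F p \<longleftrightarrow> meval F (rep p) = 0"

definition vanishes_on :: "'a::field mpol \<Rightarrow> 'a ppoint set \<Rightarrow> bool" where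
  "vanishes_on F S \<longleftrightarrow> (\<forall>p\<in>S. vanishes_at F p)"

definition zclosure :: "nat \<Rightarrow> 'a::field ppoint set \<Rightarrow> 'a ppoint set" where
  "zclosure n S = {p \<in> pspace n. \<forall>d. \<forall>F\<in>forms UNIV n d. vanishes_on F S \<longrightarrow> vanishes_at F p}"

definition zclosed :: "nat \<Rightarrow> 'a::field ppoint set \<Rightarrow> bool" where
  "zclosed n Z \<longleftrightarrow> zclosure n Z = Z"

definition zirreducible :: "nat \<Rightarrow> 'a::field ppoint set \<Rightarrow> bool" where
  "zirreducible n Z \<longleftrightarrow> Z \<noteq> {} \<and>
     (\<forall>Z1 Z2. zclosed n Z1 \<longrightarrow> zclosed n Z2 \<longrightarrow> Z \<subseteq> Z1 \<union> Z2 \<longrightarrow> Z \<subseteq> Z1 \<or> Z \<subseteq> Z2)"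


section \<open>Projective varieties over a subfield\<close>

record 'a pset =
  amb :: nat
  pts :: "'a ppoint set"

text \<open>The last clause says that the homogeneous ideal is generated by polynomials over \<open>K\<close>; over an
  imperfect field this is stronger than being the zero set of forms over \<open>K\<close>.\<close>

definition variety :: "'a::field set \<Rightarrow> 'a pset \<Rightarrow> bool" where
  "variety K V \<longleftrightarrow> zclosed (amb V) (pts V) \<and> zirreducible (amb V) (pts V) \<and>
     (\<forall>d. \<forall>F\<in>forms UNIV (amb V) d. vanishes_on F (pts V) \<longrightarrow>
        (\<exists>(r::nat) c G. (\<forall>i<r. G i \<in> forms K (amb V) d \<and> vanishes_on (G i) (pts V)) \<and>
           F = (\<Sum>i<r. mconst (c i) * G i)))"

definition zopen_in :: "'a::field pset \<Rightarrow> 'a ppoint set \<Rightarrow> bool" where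
  "zopen_in V U \<longleftrightarrow> U \<subseteq> pts V \<and> zclosed (amb V) (pts V - U)"

definition krull_dim :: "'a::field pset \<Rightarrow> nat" where
  "krull_dim V = (GREATEST d. \<exists>Z :: nat \<Rightarrow> 'a ppoint set.
     (\<forall>i\<le>d. zclosed (amb V) (Z i) \<and> zirreducible (amb V) (Z i) \<and> Z i \<subseteq> pts V) \<and>
     (\<forall>i<d. Z i \<subset> Z (Suc i)))"

text \<open>The tangent space of the affine cone over \<open>V\<close>, at a vector representing \<open>p\<close>.\<close>

definition cone_tangent :: "'a::field pset \<Rightarrow> 'a ppoint \<Rightarrow> (nat \<Rightarrow> 'a) set" where
  "cone_tangent V p = {v. (\<forall>i>amb V. v i = 0) \<and>
     (\<forall>d. \<forall>F\<in>forms UNIV (amb V) d. vanishes_on F (pts V) \<longrightarrow>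
        (\<Sum>i\<le>amb V. meval (mpartial i F) (rep p) * v i) = 0)}"

definition nonsingular_at :: "'a::field pset \<Rightarrow> 'a ppoint \<Rightarrow> bool" where
  "nonsingular_at V p \<longleftrightarrow>
     vector_space.dim (\<lambda>(c::'a) (v::nat \<Rightarrow> 'a) i. c * v i) (cone_tangent V p) = krull_dim V + 1"

definition sing_points :: "'a::field pset \<Rightarrow> 'a ppoint set" where
  "sing_points V = {p \<in> pts V. \<not> nonsingular_at V p}"

definition smooth :: "'a::field pset \<Rightarrow> bool" where
  "smooth V \<longleftrightarrow> sing_points V = {}"


section \<open>Rational maps and morphisms\<close>

text \<open>A tuple \<open>F 0, \<dots>, F m\<close> of forms of equal degree gives the map \<open>p \<mapsto> [F 0(p) : \<dots> : F m(p)]\<close> on the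
  set of points where not all \<open>F j\<close> vanish.\<close>

definition tuple_defined :: "nat \<Rightarrow> (nat \<Rightarrow> 'a::field mpol) \<Rightarrow> 'a ppoint \<Rightarrow> bool" where
  "tuple_defined m F p \<longleftrightarrow> (\<exists>j\<le>m. \<not> vanishes_at (F j) p)"

definition tuple_map :: "nat \<Rightarrow> (nat \<Rightarrow> 'a::field mpol) \<Rightarrow> 'a ppoint \<Rightarrow> 'a ppoint" where
  "tuple_map m F p = proj (\<lambda>j. if j \<le> m then meval (F j) (rep p) else 0)"

definition form_tuple :: "'a::field set \<Rightarrow> nat \<Rightarrow> nat \<Rightarrow> (nat \<Rightarrow> 'a mpol) \<Rightarrow> bool" where
  "form_tuple K n m F \<longleftrightarrow> (\<exists>d. \<forall>j\<le>m. F j \<in> forms K n d)"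

text \<open>\<open>F\<close> represents a rational map over \<open>K\<close> from \<open>V\<close> to \<open>W\<close>.\<close>

definition rational_map :: "'a::field set \<Rightarrow> 'a pset \<Rightarrow> 'a pset \<Rightarrow> (nat \<Rightarrow> 'a mpol) \<Rightarrow> bool" where
  "rational_map K V W F \<longleftrightarrow> form_tuple K (amb V) (amb W) F \<and>
     (\<exists>p\<in>pts V. tuple_defined (amb W) F p) \<and>
     (\<forall>p\<in>pts V. tuple_defined (amb W) F p \<longrightarrow> tuple_map (amb W) F p \<in> pts W)"

text \<open>As \<open>V\<close> is irreducible, density of the image does not depend on the representing tuple.\<close>

definition dominant_rational_map ::
    "'a::field set \<Rightarrow> 'a pset \<Rightarrow> 'a pset \<Rightarrow> (nat \<Rightarrow> 'a mpol) \<Rightarrow> bool" where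
  "dominant_rational_map K V W F \<longleftrightarrow> rational_map K V W F \<and>
     zclosure (amb W) (tuple_map (amb W) F ` {p \<in> pts V. tuple_defined (amb W) F p}) = pts W"

text \<open>Morphisms are functions on points; their values outside \<open>pts V\<close> are irrelevant.\<close>

definition morphism ::
    "'a::field set \<Rightarrow> 'a pset \<Rightarrow> 'a pset \<Rightarrow> ('a ppoint \<Rightarrow> 'a ppoint) \<Rightarrow> bool" where
  "morphism K V W \<phi> \<longleftrightarrow> \<phi> ` pts V \<subseteq> pts W \<and>
     (\<forall>p\<in>pts V. \<exists>F. form_tuple K (amb V) (amb W) F \<and> tuple_defined (amb W) F p \<and>
        (\<forall>p'\<in>pts V. tuple_defined (amb W) F p' \<longrightarrow> \<phi> p' = tuple_map (amb W) F p'))"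

definition birational_morphism ::
    "'a::field set \<Rightarrow> 'a pset \<Rightarrow> 'a pset \<Rightarrow> ('a ppoint \<Rightarrow> 'a ppoint) \<Rightarrow> bool" where
  "birational_morphism K V W \<phi> \<longleftrightarrow> morphism K V W \<phi> \<and>
     (\<exists>G. rational_map K W V G \<and>
        (\<forall>q\<in>pts W. tuple_defined (amb V) G q \<longrightarrow> \<phi> (tuple_map (amb V) G q) = q) \<and>
        (\<forall>p\<in>pts V. tuple_defined (amb V) G (\<phi> p) \<longrightarrow> tuple_map (amb V) G (\<phi> p) = p))"

text \<open>Regular functions (over the algebraically closed field \<open>'a\<close>) on an open set \<open>U\<close> of \<open>V\<close>.\<close>

definition regular_on :: "'a::field pset \<Rightarrow> 'a ppoint set \<Rightarrow> ('a ppoint \<Rightarrow> 'a) \<Rightarrow> bool" where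
  "regular_on V U f \<longleftrightarrow> (\<forall>p\<in>U. \<exists>d. \<exists>G\<in>forms UNIV (amb V) d. \<exists>H\<in>forms UNIV (amb V) d.
     \<not> vanishes_at H p \<and>
     (\<forall>p'\<in>U. \<not> vanishes_at H p' \<longrightarrow> f p' = meval G (rep p') / meval H (rep p')))"


section \<open>Products\<close>

text \<open>Segre embedding: the coordinate \<open>x i * y j\<close> gets the index \<open>i * (m + 1) + j\<close>.\<close>

definition segre :: "nat \<Rightarrow> nat \<Rightarrow> 'a::field ppoint \<Rightarrow> 'a ppoint \<Rightarrow> 'a ppoint" where
  "segre n m p q = proj (\<lambda>k. if k < (n + 1) * (m + 1)
     then rep p (k div (m + 1)) * rep q (k mod (m + 1)) else 0)"

definition pprod :: "'a::field pset \<Rightarrow> 'a pset \<Rightarrow> 'a pset" where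
  "pprod V W = \<lparr>amb = (amb V + 1) * (amb W + 1) - 1,
     pts = {segre (amb V) (amb W) p q | p q. p \<in> pts V \<and> q \<in> pts W}\<rparr>"

text \<open>The map \<open>(p, q) \<mapsto> (\<phi> p, \<psi> q)\<close> for self-maps \<open>\<phi>\<close> of \<open>V\<close> and \<open>\<psi>\<close> of \<open>W\<close>.\<close>

definition pprod_map :: "'a::field pset \<Rightarrow> 'a pset \<Rightarrow> ('a ppoint \<Rightarrow> 'a ppoint) \<Rightarrow>
    ('a ppoint \<Rightarrow> 'a ppoint) \<Rightarrow> 'a ppoint \<Rightarrow> 'a ppoint" where
  "pprod_map V W \<phi> \<psi> r = (THE s. \<exists>p\<in>pts V. \<exists>q\<in>pts W.
     r = segre (amb V) (amb W) p q \<and> s = segre (amb V) (amb W) (\<phi> p) (\<psi> q))"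


section \<open>Minimal resolutions, quotients, blow-ups, Kummer surfaces\<close>

text \<open>Properness of a resolution is automatic here, all varieties being projective.\<close>

definition resolution ::
    "'a::field set \<Rightarrow> 'a pset \<Rightarrow> 'a pset \<Rightarrow> ('a ppoint \<Rightarrow> 'a ppoint) \<Rightarrow> bool" where
  "resolution K W V \<pi> \<longleftrightarrow> variety K V \<and> smooth V \<and> birational_morphism K V W \<pi>"

definition minimal_resolution ::
    "'a::field set \<Rightarrow> 'a pset \<Rightarrow> 'a pset \<Rightarrow> ('a ppoint \<Rightarrow> 'a ppoint) \<Rightarrow> bool" where
  "minimal_resolution K W V \<pi> \<longleftrightarrow> resolution K W V \<pi> \<and>
     (\<forall>V' \<pi>'. resolution K W V' \<pi>' \<longrightarrow>
        (\<exists>g. morphism K V' V g \<and> (\<forall>p\<in>pts V'. \<pi> (g p) = \<pi>' p)))"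

text \<open>\<open>Q\<close> with \<open>q\<close> is the (geometric) quotient of \<open>A\<close> by the group \<open>{id, \<iota>}\<close>, for an involution \<open>\<iota>\<close>
  of \<open>A\<close>: as a topological space it is the orbit space, and its regular functions are the functions
  with regular pullback.\<close>

definition involution_quotient :: "'a::field set \<Rightarrow> 'a pset \<Rightarrow> ('a ppoint \<Rightarrow> 'a ppoint) \<Rightarrow>
    'a pset \<Rightarrow> ('a ppoint \<Rightarrow> 'a ppoint) \<Rightarrow> bool" where
  "involution_quotient K A \<iota> Q q \<longleftrightarrow> variety K Q \<and> morphism K A Q q \<and> q ` pts A = pts Q \<and>
     (\<forall>a\<in>pts A. \<forall>b\<in>pts A. q a = q b \<longleftrightarrow> b = a \<or> b = \<iota> a) \<and>
     (\<forall>U\<subseteq>pts Q. zopen_in Q U \<longleftrightarrow> zopen_in A (pts A \<inter> q -` U)) \<and>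
     (\<forall>U f. zopen_in Q U \<longrightarrow> regular_on Q U f = regular_on A (pts A \<inter> q -` U) (\<lambda>a. f (q a)))"

text \<open>The forms \<open>f 0, \<dots>, f m\<close> of degree \<open>d\<close> over \<open>K\<close> generate the ideal sheaf on \<open>Q\<close> of the closed
  subset \<open>S\<close> with its reduced structure: every form \<open>G\<close> vanishing on \<open>S\<close> lies in the saturation of the
  ideal generated by the \<open>f j\<close> and the ideal of \<open>Q\<close>.\<close>

definition generates_ideal_sheaf :: "'a::field set \<Rightarrow> 'a pset \<Rightarrow> 'a ppoint set \<Rightarrow>
    nat \<Rightarrow> nat \<Rightarrow> (nat \<Rightarrow> 'a mpol) \<Rightarrow> bool" where
  "generates_ideal_sheaf K Q S d m f \<longleftrightarrow>
     (\<forall>j\<le>m. f j \<in> forms K (amb Q) d \<and> vanishes_on (f j) S) \<and>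
     (\<forall>e. \<forall>G\<in>forms UNIV (amb Q) e. vanishes_on G S \<longrightarrow>
        (\<exists>N. \<forall>M\<in>forms UNIV (amb Q) N. \<exists>c a.
           c + d = N + e \<and> (\<forall>j\<le>m. a j \<in> forms UNIV (amb Q) c) \<and>
           vanishes_on (M * G - (\<Sum>j\<le>m. a j * f j)) (pts Q)))"

text \<open>The closure of the graph of \<open>q \<mapsto> [f 0(q) : \<dots> : f m(q)]\<close>, with its projection to \<open>Q\<close>, is a model
  of the blow-up of \<open>Q\<close> along the ideal sheaf generated by the \<open>f j\<close>; a blow-up is anything
  isomorphic to it over \<open>Q\<close>.\<close>

definition graph_closure :: "'a::field pset \<Rightarrow> nat \<Rightarrow> (nat \<Rightarrow> 'a mpol) \<Rightarrow> 'a pset" where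
  "graph_closure Q m f = \<lparr>amb = (amb Q + 1) * (m + 1) - 1,
     pts = zclosure ((amb Q + 1) * (m + 1) - 1)
       {segre (amb Q) m q (tuple_map m f q) | q. q \<in> pts Q \<and> tuple_defined m f q}\<rparr>"

definition blowup :: "'a::field set \<Rightarrow> 'a pset \<Rightarrow> 'a ppoint set \<Rightarrow>
    'a pset \<Rightarrow> ('a ppoint \<Rightarrow> 'a ppoint) \<Rightarrow> bool" where
  "blowup K Q S B \<beta> \<longleftrightarrow> variety K B \<and> morphism K B Q \<beta> \<and>
     (\<exists>d m f h h'. generates_ideal_sheaf K Q S d m f \<and>
        morphism K B (graph_closure Q m f) h \<and> morphism K (graph_closure Q m f) B h' \<and>
        (\<forall>b\<in>pts B. h' (h b) = b) \<and> (\<forall>g\<in>pts (graph_closure Q m f). h (h' g) = g) \<and>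
        (\<forall>b\<in>pts B. \<exists>r\<in>pspace m. h b = segre (amb Q) m (\<beta> b) r))"

text \<open>\<open>\<iota>\<close> stands for multiplication by \<open>-1\<close> on the abelian surface \<open>A\<close>. The double points of the
  quotient are its singular points.\<close>

definition kummer_surface ::
    "'a::field set \<Rightarrow> 'a pset \<Rightarrow> ('a ppoint \<Rightarrow> 'a ppoint) \<Rightarrow> 'a pset \<Rightarrow> bool" where
  "kummer_surface K A \<iota> Km \<longleftrightarrow>
     (\<exists>Q q \<beta>. involution_quotient K A \<iota> Q q \<and> blowup K Q (sing_points Q) Km \<beta>)"


section \<open>The double plane and the elliptic curve\<close>

text \<open>
  The double cover of the plane with coordinates \<open>[x : z : u]\<close>, branched over the six lines
  \<open>u * x * z * (x + u) * (z + u) * (x + z * t) = 0\<close>, is the surface \<open>y^2 = u * x * z * \<dots>\<close> in the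
  weighted projective space with weights \<open>(1, 1, 1, 3)\<close>; \<open>u = 1\<close> gives the affine equation. It is
  embedded in projective 10-space by the monomials of weighted degree 3.
\<close>

definition wproj_point :: "'a::field \<Rightarrow> 'a \<Rightarrow> 'a \<Rightarrow> 'a \<Rightarrow> 'a ppoint" where
  "wproj_point x z u y = proj (\<lambda>i. if i \<le> 10 then
     [x^3, x^2 * z, x^2 * u, x * z^2, x * z * u, x * u^2, z^3, z^2 * u, z * u^2, u^3, y] ! i else 0)"

definition double_plane :: "'a::field \<Rightarrow> 'a pset" where
  "double_plane t = \<lparr>amb = 10, pts = {wproj_point x z u y | x z u y.
     (x, z, u) \<noteq> (0, 0, 0) \<and> y^2 = u * x * z * (x + u) * (z + u) * (x + z * t)}\<rparr>"

text \<open>The projective closure, with coordinates \<open>[x : y : w]\<close>, of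
  \<open>y^2 = (x - 1) * (x^2 - 1 / (t + 1))\<close>.\<close>

definition E_curve :: "'a::field \<Rightarrow> 'a pset" where
  "E_curve t = \<lparr>amb = 2, pts = {proj (\<lambda>i. if i \<le> 2 then [x, y, w] ! i else 0) | x y w.
     (x, y, w) \<noteq> (0, 0, 0) \<and> y^2 * w = (x - w) * (x^2 - 1 / (t + 1) * w^2)}\<rparr>"

text \<open>Negation \<open>(x, y) \<mapsto> (x, -y)\<close> for the group law with the point at infinity as origin.\<close>

definition E_neg :: "'a::field ppoint \<Rightarrow> 'a ppoint" where
  "E_neg p = proj ((rep p)(1 := - rep p 1))"

definition EE :: "'a::field \<Rightarrow> 'a pset" where
  "EE t = pprod (E_curve t) (E_curve t)"

definition EE_neg :: "'a::field \<Rightarrow> 'a ppoint \<Rightarrow> 'a ppoint" where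
  "EE_neg t = pprod_map (E_curve t) (E_curve t) E_neg E_neg"


section \<open>Finite extensions\<close>

text \<open>Finite extensions of the field \<open>'k\<close>, inside its algebraic closure.\<close>

abbreviation base_field :: "'k::field alg_closure set" where
  "base_field \<equiv> range to_ac"

definition finite_extension_of_base :: "'k::field alg_closure set \<Rightarrow> bool" where
  "finite_extension_of_base L \<longleftrightarrow> subfield L ring_of_type_algebra \<and> base_field \<subseteq> L \<and>
     ring.finite_dimension ring_of_type_algebra base_field L"

end

theory Submission
  imports Defs
begin

text \<open>
  Write \<open>c = 1 / (t + 1)\<close> and \<open>f x = (x - 1) * (x^2 - c)\<close>. The quotient of \<open>E \<times> E\<close> by negation is
  birational to the surface \<open>w^2 = f x1 * f x2\<close> with \<open>w = y1 * y2\<close>, and the Kummer surface is birational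
  to that quotient. The surface \<open>w^2 = f x1 * f x2\<close> is fibred by \<open>k = (x1 * x2 + c) / (x1 + x2)\<close>: on a fibre \<open>x2\<close> is a Moebius
  transform of \<open>x1\<close>, and with \<open>U = (k - 1) * (x1 - 1)\<close> the fibre becomes the elliptic curve
  \<open>v^2 = (k^2 - c) * U * (U - (k - 1)^2) * (U + 2 * k - 1 - c)\<close>, whose points of order two are all
  rational. Making \<open>U / (k^2 - c)\<close> a square \<open>p^2\<close> gives a double cover by a fibration in 2-isogenous curves.
  In terms of \<open>e\<close>, a square root of \<open>(U + 2 * k - 1 - c) / (U - (k - 1)^2)\<close>, the covering surface is
  \<open>p^2 = (k - 1)^2 / (k^2 - c) + 1 / (e^2 - 1)\<close>.

  This surface is birational to the double plane. Indeed put \<open>m = x * (z + 1) / (x + 1)\<close>, \<open>n = z * (x + 1) / (z + 1)\<close>;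
  then \<open>y^2 = x * z * (x + 1) * (z + 1) * (x + z * t)\<close> turns into
  \<open>(2 * p)^2 = (n - 1)^2 / n + t * (m - 1)^2 / m\<close>, where \<open>p\<close> is \<open>y\<close> times a rational function of \<open>x\<close> and
  \<open>z\<close>. Here \<open>(n - 1)^2 / (4 * n) = 1 / (e^2 - 1)\<close> for \<open>e = (n + 1) / (n - 1)\<close>, and
  \<open>t * (m - 1)^2 / (4 * m) = (k - 1)^2 / (k^2 - c)\<close> for a Moebius transform \<open>k\<close> of \<open>m\<close> that sends
  \<open>0\<close>, \<open>\<infinity>\<close>, \<open>1\<close> to \<open>-r\<close>, \<open>r\<close>, \<open>1\<close> with \<open>r^2 = c\<close>. Adjoining \<open>r\<close> is the extension of the base field.

  The rational map of the theorem is the composition of the resolution, this explicit map of degree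
  two, the birational map from \<open>w^2 = f x1 * f x2\<close> to the quotient and the inverse of the
  blow-up. Dominance is handled in the form \<open>dominates\<close>: every form that vanishes on the image vanishes on the target. This property composes
  (\<open>dominates_trans\<close>) as soon as a product of two forms vanishes on the source only if one of the factors
  does. It is proved for the resolution in \<open>birational_morphism_dominates\<close>, which needs that the double
  plane is irreducible (\<open>double_plane_irreducible\<close>, because its sextic is not a square); for the explicit
  map in \<open>double_plane_dominates_quotient\<close>, where a nonempty open set of points of \<open>E \<times> E\<close> is shown to be
  in the image and the quotient topology carries this over to the quotient (\<open>quotient_density\<close>); and for the
  blow-up in \<open>blowup_dominates\<close>. That the map to the quotient is given by polynomials in \<open>x1\<close>, \<open>x2\<close>, \<open>w\<close> is
  \<open>quotient_chart\<close>: a form on \<open>E \<times> E\<close> is symmetrised under \<open>(y1, y2) \<mapsto> (- y1, - y2)\<close>.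
\<close>

section \<open>Polynomial functions\<close>

definition mono_value :: "(nat \<Rightarrow>\<^sub>0 nat) \<Rightarrow> (nat \<Rightarrow> 'a::comm_ring_1) \<Rightarrow> 'a" where
  "mono_value m x = (\<Prod>i\<in>Poly_Mapping.keys m. x i ^ Poly_Mapping.lookup m i)"

lemma mono_value_superset:
  assumes "finite A" "Poly_Mapping.keys m \<subseteq> A"
  shows "mono_value m x = (\<Prod>i\<in>A. x i ^ Poly_Mapping.lookup m i)"
  unfolding mono_value_def
  by (rule prod.mono_neutral_left[OF assms]) (auto simp: in_keys_iff)

lemma mono_value_add: "mono_value (m + m') x = mono_value m x * mono_value m' x"
proof -
  let ?A = "Poly_Mapping.keys m \<union> Poly_Mapping.keys m'"
  have "Poly_Mapping.keys (m + m') \<subseteq> ?A"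
    by (rule Poly_Mapping.keys_add)
  then show ?thesis
    by (simp add: mono_value_superset[of ?A] lookup_add power_add prod.distrib)
qed

lemma meval_mono: "meval F x = (\<Sum>m\<in>Poly_Mapping.keys F. Poly_Mapping.lookup F m * mono_value m x)"
  by (simp add: meval_def mono_value_def)

lemma meval_superset:
  assumes "finite A" "Poly_Mapping.keys F \<subseteq> A"
  shows "meval F x = (\<Sum>m\<in>A. Poly_Mapping.lookup F m * mono_value m x)"
  unfolding meval_mono
  by (rule sum.mono_neutral_left[OF assms]) (auto simp: in_keys_iff)

lemma meval_zero [simp]: "meval 0 x = 0"
  by (simp add: meval_def)

lemma meval_single: "meval (Poly_Mapping.single m c) x = c * mono_value m x"
  by (cases "c = 0") (simp_all add: meval_mono)

lemma meval_add: "meval (F + G) x = meval F x + meval G x"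
proof -
  let ?A = "Poly_Mapping.keys F \<union> Poly_Mapping.keys G"
  have "Poly_Mapping.keys (F + G) \<subseteq> ?A"
    by (rule Poly_Mapping.keys_add)
  then show ?thesis
    by (simp add: meval_superset[of ?A] lookup_add algebra_simps sum.distrib)
qed

lemma meval_sum: "meval (\<Sum>i\<in>A. F i) x = (\<Sum>i\<in>A. meval (F i) x)"
  by (induction A rule: infinite_finite_induct) (auto simp: meval_add)

lemma sum_of_terms:
  "(\<Sum>m\<in>Poly_Mapping.keys F. Poly_Mapping.single m (Poly_Mapping.lookup F m)) = F"
  by (rule poly_mapping_eqI) (auto simp: lookup_sum lookup_single when_def in_keys_iff sum.delta)

lemma product_of_terms:
  "F * G = (\<Sum>m\<in>Poly_Mapping.keys F. \<Sum>m'\<in>Poly_Mapping.keys G.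
     Poly_Mapping.single (m + m') (Poly_Mapping.lookup F m * Poly_Mapping.lookup G m'))"
proof -
  have "F * G = (\<Sum>m\<in>Poly_Mapping.keys F. Poly_Mapping.single m (Poly_Mapping.lookup F m)) *
      (\<Sum>m\<in>Poly_Mapping.keys G. Poly_Mapping.single m (Poly_Mapping.lookup G m))"
    by (simp add: sum_of_terms)
  then show ?thesis
    by (simp add: sum_product mult_single)
qed

lemma meval_mult: "meval (F * G) x = meval F x * meval G x"
proof -
  have "meval (F * G) x = (\<Sum>m\<in>Poly_Mapping.keys F. \<Sum>m'\<in>Poly_Mapping.keys G.
      Poly_Mapping.lookup F m * Poly_Mapping.lookup G m' * (mono_value m x * mono_value m' x))"
    unfolding product_of_terms[of F G] by (simp add: meval_sum meval_single mono_value_add)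
  then show ?thesis
    by (simp add: meval_mono sum_product algebra_simps)
qed

definition coeff_ring :: "'a::comm_ring_1 set \<Rightarrow> bool" where
  "coeff_ring K \<longleftrightarrow> 0 \<in> K \<and> 1 \<in> K \<and> (\<forall>a\<in>K. \<forall>b\<in>K. a + b \<in> K \<and> a * b \<in> K) \<and> (\<forall>a\<in>K. - a \<in> K)"

lemma coeff_ring_UNIV [simp]: "coeff_ring UNIV"
  by (simp add: coeff_ring_def)

lemma forms_zero [simp]: "0 \<in> forms K n d"
  by (simp add: forms_def)

lemma forms_mono: "K \<subseteq> L \<Longrightarrow> forms K n d \<subseteq> forms L n d"
  by (auto simp: forms_def)

lemma forms_add:
  assumes "coeff_ring K" "F \<in> forms K n d" "G \<in> forms K n d"
  shows "F + G \<in> forms K n d"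
  unfolding forms_def
proof (clarify)
  fix m assume m: "m \<in> Poly_Mapping.keys (F + G)"
  have *: "Poly_Mapping.lookup H m' \<in> K" if "H \<in> forms K n d" for H m'
    using that assms(1)
    by (cases "m' \<in> Poly_Mapping.keys H") (auto simp: forms_def coeff_ring_def in_keys_iff)
  have "m \<in> Poly_Mapping.keys F \<or> m \<in> Poly_Mapping.keys G"
    using m Poly_Mapping.keys_add[of F G] by auto
  then show "Poly_Mapping.lookup (F + G) m \<in> K \<and> Poly_Mapping.keys m \<subseteq> {..n} \<and>
      (\<Sum>i\<in>Poly_Mapping.keys m. Poly_Mapping.lookup m i) = d"
    using assms *[OF assms(2)] *[OF assms(3)] by (auto simp: forms_def lookup_add coeff_ring_def)
qed

lemma forms_sum:
  assumes "coeff_ring K" "\<And>i. i \<in> A \<Longrightarrow> F i \<in> forms K n d"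
  shows "(\<Sum>i\<in>A. F i) \<in> forms K n d"
  using assms(2) by (induction A rule: infinite_finite_induct) (auto intro: forms_add[OF assms(1)])

lemma degree_monomial_add:
  fixes m m' :: "nat \<Rightarrow>\<^sub>0 nat"
  shows "(\<Sum>i\<in>Poly_Mapping.keys (m + m'). Poly_Mapping.lookup (m + m') i) =
    (\<Sum>i\<in>Poly_Mapping.keys m. Poly_Mapping.lookup m i) + (\<Sum>i\<in>Poly_Mapping.keys m'. Poly_Mapping.lookup m' i)"
proof -
  let ?A = "Poly_Mapping.keys m \<union> Poly_Mapping.keys m'"
  have *: "(\<Sum>i\<in>Poly_Mapping.keys k. Poly_Mapping.lookup k i) = (\<Sum>i\<in>?A. Poly_Mapping.lookup k i)"
    if "Poly_Mapping.keys k \<subseteq> ?A" for k :: "nat \<Rightarrow>\<^sub>0 nat"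
    by (rule sum.mono_neutral_left) (use that in \<open>auto simp: in_keys_iff\<close>)
  show ?thesis
    using *[OF Poly_Mapping.keys_add[of m m']] *[of m] *[of m'] by (simp add: lookup_add sum.distrib)
qed

lemma forms_mult:
  assumes K: "coeff_ring K" and F: "F \<in> forms K n d" and G: "G \<in> forms K n e"
  shows "F * G \<in> forms K n (d + e)"
  unfolding product_of_terms[of F G]
proof (intro forms_sum[OF K])
  fix m m' assume m: "m \<in> Poly_Mapping.keys F" and m': "m' \<in> Poly_Mapping.keys G"
  have "Poly_Mapping.keys (m + m') \<subseteq> {..n}"
    using Poly_Mapping.keys_add[of m m'] m m' F G by (fastforce simp: forms_def)
  then show "Poly_Mapping.single (m + m') (Poly_Mapping.lookup F m * Poly_Mapping.lookup G m')
      \<in> forms K n (d + e)"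
    using m m' F G K by (auto simp: forms_def degree_monomial_add coeff_ring_def)
qed

text \<open>Two polynomials are interchangeable here when they have the same values, so the geometry works with
  the functions that forms define; these can be multiplied and composed as \<open>\<lambda>\<close>-terms.\<close>

definition form_fun :: "'a::comm_ring_1 set \<Rightarrow> nat \<Rightarrow> nat \<Rightarrow> ((nat \<Rightarrow> 'a) \<Rightarrow> 'a) \<Rightarrow> bool" where
  "form_fun K n d \<phi> \<longleftrightarrow> (\<exists>F\<in>forms K n d. \<phi> = meval F)"

lemma form_fun_meval: "F \<in> forms K n d \<Longrightarrow> form_fun K n d (meval F)"
  by (auto simp: form_fun_def)

lemma form_fun_mono: "form_fun K n d \<phi> \<Longrightarrow> K \<subseteq> L \<Longrightarrow> form_fun L n d \<phi>"
  using forms_mono[of K L n d] by (auto simp: form_fun_def)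

lemma form_fun_zero: "form_fun K n d (\<lambda>x. 0)"
  unfolding form_fun_def by (rule bexI[of _ 0]) auto

lemma form_fun_const: "c \<in> K \<Longrightarrow> form_fun K n 0 (\<lambda>x. c)"
  unfolding form_fun_def
  by (rule bexI[of _ "Poly_Mapping.single 0 c"])
     (auto simp: meval_single fun_eq_iff mono_value_def forms_def)

lemma form_fun_coord: "coeff_ring K \<Longrightarrow> i \<le> n \<Longrightarrow> form_fun K n 1 (\<lambda>x. x i)"
  unfolding form_fun_def
  by (rule bexI[of _ "Poly_Mapping.single (Poly_Mapping.single i 1) 1"])
     (auto simp: meval_single fun_eq_iff mono_value_def forms_def coeff_ring_def)

lemma form_fun_add:
  "coeff_ring K \<Longrightarrow> form_fun K n d \<phi> \<Longrightarrow> form_fun K n d \<psi> \<Longrightarrow> form_fun K n d (\<lambda>x. \<phi> x + \<psi> x)"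
  unfolding form_fun_def by (auto simp: fun_eq_iff meval_add intro!: forms_add bexI[of _ "_ + _"])

lemma form_fun_mult:
  "coeff_ring K \<Longrightarrow> form_fun K n d \<phi> \<Longrightarrow> form_fun K n e \<psi> \<Longrightarrow> form_fun K n (d + e) (\<lambda>x. \<phi> x * \<psi> x)"
  unfolding form_fun_def by (auto simp: fun_eq_iff meval_mult intro!: forms_mult bexI[of _ "_ * _"])

lemma form_fun_cmult:
  "coeff_ring K \<Longrightarrow> c \<in> K \<Longrightarrow> form_fun K n e \<psi> \<Longrightarrow> form_fun K n e (\<lambda>x. c * \<psi> x)"
  using form_fun_mult[OF _ form_fun_const, of K c n e \<psi>] by simp

lemma form_fun_diff:
  assumes "coeff_ring K" "form_fun K n d \<phi>" "form_fun K n d \<psi>"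
  shows "form_fun K n d (\<lambda>x. \<phi> x - \<psi> x)"
proof -
  have "-1 \<in> K" using assms(1) by (auto simp: coeff_ring_def)
  from form_fun_add[OF assms(1,2) form_fun_cmult[OF assms(1) this assms(3)]] show ?thesis by simp
qed

lemma form_fun_sum:
  assumes "coeff_ring K" "\<And>i. i \<in> A \<Longrightarrow> form_fun K n d (\<phi> i)"
  shows "form_fun K n d (\<lambda>x. \<Sum>i\<in>A. \<phi> i x)"
  using assms(2)
  by (induction A rule: infinite_finite_induct) (auto intro: form_fun_add[OF assms(1)] form_fun_zero)

lemma form_fun_power:
  assumes "coeff_ring K" "form_fun K n d \<phi>"
  shows "form_fun K n (e * d) (\<lambda>x. \<phi> x ^ e)"
proof (induction e)
  case 0
  show ?case using form_fun_const[of 1 K n] assms(1) by (simp add: coeff_ring_def)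
next
  case (Suc e)
  from form_fun_mult[OF assms this] show ?case by (simp add: algebra_simps)
qed

lemma form_fun_prod:
  assumes "coeff_ring K" "finite A" "\<And>i. i \<in> A \<Longrightarrow> form_fun K n (d i) (\<phi> i)"
  shows "form_fun K n (\<Sum>i\<in>A. d i) (\<lambda>x. \<Prod>i\<in>A. \<phi> i x)"
  using assms(2,3)
proof (induction A)
  case empty
  show ?case using form_fun_const[of 1 K n] assms(1) by (simp add: coeff_ring_def)
next
  case (insert a A)
  then show ?case by (auto intro: form_fun_mult[OF assms(1)])
qed

text \<open>Substituting forms of degree \<open>d\<close> multiplies degrees by \<open>d\<close>: this makes compositions of rational maps
  rational maps again.\<close>

lemma form_fun_compose:
  assumes K: "coeff_ring K" and \<phi>: "form_fun K m e \<phi>"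
    and \<gamma>: "\<And>i. i \<le> m \<Longrightarrow> form_fun K n d (\<gamma> i)"
  shows "form_fun K n (d * e) (\<lambda>x. \<phi> (\<lambda>i. \<gamma> i x))"
proof -
  from \<phi> obtain F where F: "F \<in> forms K m e" "\<phi> = meval F" by (auto simp: form_fun_def)
  have "form_fun K n (d * e) (\<lambda>x. Poly_Mapping.lookup F k * mono_value k (\<lambda>i. \<gamma> i x))"
    if k: "k \<in> Poly_Mapping.keys F" for k
  proof (intro form_fun_cmult[OF K])
    show "Poly_Mapping.lookup F k \<in> K" using F k by (auto simp: forms_def)
    have "form_fun K n (\<Sum>i\<in>Poly_Mapping.keys k. Poly_Mapping.lookup k i * d)
        (\<lambda>x. \<Prod>i\<in>Poly_Mapping.keys k. \<gamma> i x ^ Poly_Mapping.lookup k i)"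
      by (intro form_fun_prod form_fun_power K \<gamma>) (use F k in \<open>auto simp: forms_def\<close>)
    moreover have "(\<Sum>i\<in>Poly_Mapping.keys k. Poly_Mapping.lookup k i) = e"
      using F k by (auto simp: forms_def)
    ultimately show "form_fun K n (d * e) (\<lambda>x. mono_value k (\<lambda>i. \<gamma> i x))"
      by (simp add: mono_value_def flip: sum_distrib_right) (simp add: mult.commute)
  qed
  from form_fun_sum[OF K this] show ?thesis by (simp add: F meval_mono)
qed

lemma form_fun_cong:
  assumes "form_fun K n d \<phi>" "\<And>i. i \<le> n \<Longrightarrow> x i = y i"
  shows "\<phi> x = \<phi> y"
proof -
  from assms(1) obtain F where F: "F \<in> forms K n d" "\<phi> = meval F" by (auto simp: form_fun_def)
  have "mono_value m x = mono_value m y" if "m \<in> Poly_Mapping.keys F" for m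
    unfolding mono_value_def using F that by (intro prod.cong) (auto simp: forms_def intro!: arg_cong[OF assms(2)] assms(2))
  then show ?thesis by (simp add: F meval_mono)
qed

lemma form_fun_scale:
  assumes "form_fun K n d \<phi>"
  shows "\<phi> (\<lambda>i. c * x i) = c ^ d * \<phi> x"
proof -
  from assms(1) obtain F where F: "F \<in> forms K n d" "\<phi> = meval F" by (auto simp: form_fun_def)
  have "mono_value m (\<lambda>i. c * x i) = c ^ d * mono_value m x" if "m \<in> Poly_Mapping.keys F" for m
    using F that by (auto simp: mono_value_def power_mult_distrib prod.distrib forms_def simp flip: power_sum)
  then show ?thesis by (simp add: F meval_mono sum_distrib_left algebra_simps)
qed

definition function_algebra :: "'a::comm_ring_1 set \<Rightarrow> ('v \<Rightarrow> 'a) set \<Rightarrow> bool" where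
  "function_algebra K S \<longleftrightarrow> (\<forall>c\<in>K. (\<lambda>_. c) \<in> S) \<and>
     (\<forall>f\<in>S. \<forall>g\<in>S. (\<lambda>v. f v + g v) \<in> S \<and> (\<lambda>v. f v * g v) \<in> S)"

lemma function_algebraD:
  assumes "function_algebra K S"
  shows "c \<in> K \<Longrightarrow> (\<lambda>_. c) \<in> S"
    and "f \<in> S \<Longrightarrow> g \<in> S \<Longrightarrow> (\<lambda>v. f v + g v) \<in> S"
    and "f \<in> S \<Longrightarrow> g \<in> S \<Longrightarrow> (\<lambda>v. f v * g v) \<in> S"
  using assms by (auto simp: function_algebra_def)

lemma function_algebra_power:
  assumes "function_algebra K S" "1 \<in> K" "f \<in> S"
  shows "(\<lambda>v. f v ^ e) \<in> S"
  by (induction e) (use assms in \<open>auto intro: function_algebraD[OF assms(1)]\<close>)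

lemma function_algebra_sum:
  assumes "function_algebra K S" "0 \<in> K" "\<And>i. i \<in> A \<Longrightarrow> f i \<in> S"
  shows "(\<lambda>v. \<Sum>i\<in>A. f i v) \<in> S"
  using assms(3) by (induction A rule: infinite_finite_induct)
    (use assms(2) in \<open>auto intro: function_algebraD[OF assms(1)]\<close>)

lemma function_algebra_prod:
  assumes "function_algebra K S" "1 \<in> K" "\<And>i. i \<in> A \<Longrightarrow> f i \<in> S"
  shows "(\<lambda>v. \<Prod>i\<in>A. f i v) \<in> S"
  using assms(3) by (induction A rule: infinite_finite_induct)
    (use assms(2) in \<open>auto intro: function_algebraD[OF assms(1)]\<close>)

text \<open>A polynomial in elements of a ring of functions stays in that ring. Choosing the ring suitably turns this
  into statements about normal forms, e.g. that every form on a double cover is \<open>A + B * y\<close>.\<close>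

lemma function_algebra_meval:
  assumes K: "coeff_ring K" and S: "function_algebra K S" and F: "F \<in> forms K n d"
    and g: "\<And>i. i \<le> n \<Longrightarrow> g i \<in> S"
  shows "(\<lambda>v. meval F (\<lambda>i. g i v)) \<in> S"
proof -
  have 01: "0 \<in> K" "1 \<in> K" using K by (auto simp: coeff_ring_def)
  show ?thesis
    unfolding meval_mono mono_value_def
    by (intro function_algebra_sum[OF S 01(1)] function_algebraD(3)[OF S] function_algebraD(1)[OF S]
        function_algebra_prod[OF S 01(2)] function_algebra_power[OF S 01(2)] g)
       (use F in \<open>auto simp: forms_def\<close>)
qed

text \<open>The ring generated by the functions \<open>B\<close>. In contrast to forms, these polynomials carry no degree, which
  suits affine coordinates.\<close>

inductive_set polyfuns :: "'a::comm_ring_1 set \<Rightarrow> ('v \<Rightarrow> 'a) set \<Rightarrow> ('v \<Rightarrow> 'a) set" for K B where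
  const: "c \<in> K \<Longrightarrow> (\<lambda>_. c) \<in> polyfuns K B"
| base: "b \<in> B \<Longrightarrow> b \<in> polyfuns K B"
| add: "f \<in> polyfuns K B \<Longrightarrow> g \<in> polyfuns K B \<Longrightarrow> (\<lambda>v. f v + g v) \<in> polyfuns K B"
| mult: "f \<in> polyfuns K B \<Longrightarrow> g \<in> polyfuns K B \<Longrightarrow> (\<lambda>v. f v * g v) \<in> polyfuns K B"

lemma function_algebra_polyfuns: "function_algebra K (polyfuns K B)"
  by (auto simp: function_algebra_def intro: polyfuns.intros)

lemma polyfuns_mono: "f \<in> polyfuns K B \<Longrightarrow> K \<subseteq> L \<Longrightarrow> f \<in> polyfuns L B"
  by (induction rule: polyfuns.induct) (auto intro: polyfuns.intros)

lemma polyfuns_diff: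
  assumes "coeff_ring K" "f \<in> polyfuns K B" "g \<in> polyfuns K B"
  shows "(\<lambda>v. f v - g v) \<in> polyfuns K B"
proof -
  have "-1 \<in> K" using assms(1) by (auto simp: coeff_ring_def)
  then have "(\<lambda>v. f v + (-1) * g v) \<in> polyfuns K B"
    by (intro polyfuns.add polyfuns.mult polyfuns.const assms)
  then show ?thesis by simp
qed

lemma polyfuns_subst:
  assumes "f \<in> polyfuns K B" "function_algebra K S" "\<And>b. b \<in> B \<Longrightarrow> (\<lambda>u. b (h u)) \<in> S"
  shows "(\<lambda>u. f (h u)) \<in> S"
  using assms(1) by (induction rule: polyfuns.induct)
    (auto intro: function_algebraD[OF assms(2)] assms(3))

section \<open>Projective space in coordinates\<close>

definition cut :: "nat \<Rightarrow> (nat \<Rightarrow> 'a::zero) \<Rightarrow> nat \<Rightarrow> 'a" where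
  "cut n x = (\<lambda>i. if i \<le> n then x i else 0)"

lemma proj_scale: "c \<noteq> 0 \<Longrightarrow> proj (\<lambda>i. c * x i) = proj x"
proof -
  assume c: "c \<noteq> 0"
  have "(\<lambda>i. a * x i) \<in> proj (\<lambda>i. c * x i)" if "a \<noteq> 0" for a
    unfolding proj_def using c that by (intro CollectI exI[of _ "a / c"]) (auto simp: fun_eq_iff)
  moreover have "(\<lambda>i. a * (c * x i)) \<in> proj x" if "a \<noteq> 0" for a
    unfolding proj_def using c that by (intro CollectI exI[of _ "a * c"]) (auto simp: fun_eq_iff)
  ultimately show ?thesis
    by (auto simp: proj_def)
qed

lemma proj_self: "x \<in> proj x"
  unfolding proj_def by (intro CollectI exI[of _ 1]) auto

lemma proj_eq_iff: "proj x = proj y \<longleftrightarrow> (\<exists>c. c \<noteq> 0 \<and> y = (\<lambda>i. c * x i))"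
proof
  assume "proj x = proj y"
  then have "y \<in> proj x" using proj_self[of y] by simp
  then show "\<exists>c. c \<noteq> 0 \<and> y = (\<lambda>i. c * x i)" by (auto simp: proj_def)
qed (auto simp: proj_scale)

lemma rep_proj: obtains c where "c \<noteq> 0" "rep (proj x) = (\<lambda>i. c * x i)"
proof -
  have "rep (proj x) \<in> proj x"
    unfolding rep_def by (rule someI[of _ x]) (rule proj_self)
  then show ?thesis using that by (auto simp: proj_def)
qed

lemma proj_in_pspace: "proj x \<in> pspace n \<longleftrightarrow> (\<forall>i>n. x i = 0) \<and> (\<exists>i\<le>n. x i \<noteq> 0)"
proof
  assume "proj x \<in> pspace n"
  then obtain y where y: "proj x = proj y" "\<forall>i>n. y i = 0" "\<exists>i\<le>n. y i \<noteq> 0"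
    by (auto simp: pspace_def)
  from y(1) obtain c where "c \<noteq> 0" "y = (\<lambda>i. c * x i)" by (auto simp: proj_eq_iff)
  with y show "(\<forall>i>n. x i = 0) \<and> (\<exists>i\<le>n. x i \<noteq> 0)" by simp
qed (auto simp: pspace_def)

lemma pspaceE:
  assumes "p \<in> pspace n" obtains x where "p = proj x" "\<forall>i>n. x i = 0" "\<exists>i\<le>n. x i \<noteq> 0"
  using assms by (auto simp: pspace_def)

lemma vanishes_at_proj:
  assumes "F \<in> forms K n d" shows "vanishes_at F (proj x) \<longleftrightarrow> meval F x = 0"
proof -
  obtain c where "c \<noteq> 0" "rep (proj x) = (\<lambda>i. c * x i)" by (rule rep_proj)
  then show ?thesis
    using form_fun_scale[OF form_fun_meval[OF assms], of c x] by (simp add: vanishes_at_def)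
qed

lemma tuple_defined_proj:
  assumes "form_tuple K n m F"
  shows "tuple_defined m F (proj x) \<longleftrightarrow> (\<exists>j\<le>m. meval (F j) x \<noteq> 0)"
proof -
  have "vanishes_at (F j) (proj x) \<longleftrightarrow> meval (F j) x = 0" if "j \<le> m" for j
    using assms that vanishes_at_proj[of "F j" K n] unfolding form_tuple_def by blast
  then show ?thesis by (auto simp: tuple_defined_def)
qed

lemma tuple_map_proj:
  assumes "form_tuple K n m F"
  shows "tuple_map m F (proj x) = proj (cut m (\<lambda>j. meval (F j) x))"
proof -
  obtain c where c: "c \<noteq> 0" "rep (proj x) = (\<lambda>i. c * x i)" by (rule rep_proj)
  obtain d where d: "\<forall>j\<le>m. F j \<in> forms K n d" using assms by (auto simp: form_tuple_def)
  have "(\<lambda>j. if j \<le> m then meval (F j) (rep (proj x)) else 0) =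
      (\<lambda>i. c ^ d * cut m (\<lambda>j. meval (F j) x) i)"
    unfolding c(2) using d by (auto simp: cut_def fun_eq_iff intro!: form_fun_scale[OF form_fun_meval])
  then show ?thesis using c by (simp add: tuple_map_def proj_scale)
qed

lemma form_fun_cut: "form_fun K n d \<phi> \<Longrightarrow> \<phi> (cut n x) = \<phi> x"
  by (rule form_fun_cong) (auto simp: cut_def)

lemma zclosed_subset: "zclosed n Z \<Longrightarrow> Z \<subseteq> pspace n"
  by (auto simp: zclosed_def zclosure_def)

lemma zclosedI:
  assumes "Z \<subseteq> pspace n"
    and "\<And>x. proj x \<in> pspace n \<Longrightarrow>
      (\<And>d \<phi>. form_fun UNIV n d \<phi> \<Longrightarrow> (\<And>y. proj y \<in> Z \<Longrightarrow> \<phi> y = 0) \<Longrightarrow> \<phi> x = 0) \<Longrightarrow> proj x \<in> Z"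
  shows "zclosed n Z"
proof -
  have "p \<in> Z" if p: "p \<in> zclosure n Z" for p
  proof -
    from p have "p \<in> pspace n" by (auto simp: zclosure_def)
    then obtain x where x: "p = proj x" by (rule pspaceE)
    show ?thesis unfolding x
    proof (rule assms(2))
      show "proj x \<in> pspace n" using \<open>p \<in> pspace n\<close> x by simp
      fix d \<phi> assume "form_fun UNIV n d \<phi>" and v: "\<And>y. proj y \<in> Z \<Longrightarrow> \<phi> y = 0"
      then obtain F where F: "F \<in> forms UNIV n d" "\<phi> = meval F" by (auto simp: form_fun_def)
      have "vanishes_on F Z"
        unfolding vanishes_on_def
      proof
        fix q assume "q \<in> Z"
        moreover then obtain y where "q = proj y" using assms(1) pspaceE by blast
        ultimately show "vanishes_at F q" using v F by (simp add: vanishes_at_proj)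
      qed
      then have "vanishes_at F (proj x)" using p F x by (auto simp: zclosure_def)
      then show "\<phi> x = 0" using F by (simp add: vanishes_at_proj)
    qed
  qed
  moreover have "Z \<subseteq> zclosure n Z"
    using assms(1) by (auto simp: zclosure_def vanishes_on_def)
  ultimately show ?thesis by (auto simp: zclosed_def)
qed

lemma zclosureD:
  assumes "proj x \<in> zclosure n Z" "Z \<subseteq> pspace n" "form_fun UNIV n d \<phi>" "\<And>y. proj y \<in> Z \<Longrightarrow> \<phi> y = 0"
  shows "\<phi> x = 0"
proof -
  from assms(3) obtain F where F: "F \<in> forms UNIV n d" "\<phi> = meval F" by (auto simp: form_fun_def)
  have "vanishes_on F Z"
    unfolding vanishes_on_def
  proof
    fix q assume "q \<in> Z"
    moreover then obtain y where "q = proj y" using assms(2) pspaceE by blast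
    ultimately show "vanishes_at F q" using assms(4) F by (simp add: vanishes_at_proj)
  qed
  then have "vanishes_at F (proj x)" using assms(1) F by (auto simp: zclosure_def)
  then show ?thesis using F by (simp add: vanishes_at_proj)
qed

lemma zclosure_self: "S \<subseteq> pspace n \<Longrightarrow> S \<subseteq> zclosure n S"
  by (auto simp: zclosure_def vanishes_on_def)

text \<open>The value of a form depends on the representative of a point only up to a nonzero factor, so the condition
  may be asked of all representatives.\<close>

lemma zclosed_zeros:
  assumes "form_fun UNIV n d \<phi>" "zclosed n Z"
  shows "zclosed n {p \<in> Z. \<forall>x. p = proj x \<longrightarrow> \<phi> x = 0}"
proof (rule zclosedI)
  show sub: "{p \<in> Z. \<forall>x. p = proj x \<longrightarrow> \<phi> x = 0} \<subseteq> pspace n"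
    using zclosed_subset[OF assms(2)] by auto
  fix x assume x: "proj x \<in> pspace n"
    and v: "\<And>e \<psi>. form_fun UNIV n e \<psi> \<Longrightarrow>
      (\<And>y. proj y \<in> {p \<in> Z. \<forall>x. p = proj x \<longrightarrow> \<phi> x = 0} \<Longrightarrow> \<psi> y = 0) \<Longrightarrow> \<psi> x = 0"
  have "proj x \<in> zclosure n Z"
    unfolding zclosure_def
  proof (intro CollectI conjI x allI ballI impI)
    fix e F assume F: "F \<in> forms UNIV n e" "vanishes_on F Z"
    have "meval F x = 0"
      by (rule v[OF form_fun_meval[OF F(1)]])
         (use F in \<open>auto simp: vanishes_on_def vanishes_at_proj[OF F(1)] dest!: bspec\<close>)
    then show "vanishes_at F (proj x)" by (simp add: vanishes_at_proj[OF F(1)])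
  qed
  moreover have "\<phi> x = 0" by (rule v[OF assms(1)]) auto
  moreover have "\<phi> y = 0" if "proj x = proj y" for y
    using that \<open>\<phi> x = 0\<close> form_fun_scale[OF assms(1)] by (auto simp: proj_eq_iff)
  ultimately show "proj x \<in> {p \<in> Z. \<forall>x. p = proj x \<longrightarrow> \<phi> x = 0}"
    using assms(2) by (auto simp: zclosed_def)
qed

lemma zclosed_pspace: "zclosed n (pspace n)"
  by (auto simp: zclosed_def zclosure_def vanishes_on_def)

lemma zclosed_empty: "zclosed n ({} :: 'a::field ppoint set)"
proof (rule zclosedI)
  fix x :: "nat \<Rightarrow> 'a"
  assume "\<And>d \<phi>. form_fun UNIV n d \<phi> \<Longrightarrow> (\<And>y. proj y \<in> {} \<Longrightarrow> \<phi> y = 0) \<Longrightarrow> \<phi> x = 0"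
  from this[OF form_fun_const[of 1]] show "proj x \<in> {}" by simp
qed auto

text \<open>The consequence of irreducibility that is needed to compose dominant tuples. For the double plane it can be
  checked directly on forms.\<close>

definition form_irreducible :: "nat \<Rightarrow> 'a::field ppoint set \<Rightarrow> bool" where
  "form_irreducible n Z \<longleftrightarrow> (\<forall>d e \<phi> \<psi>. form_fun UNIV n d \<phi> \<longrightarrow> form_fun UNIV n e \<psi> \<longrightarrow>
     (\<forall>v. proj v \<in> Z \<longrightarrow> \<phi> v = 0 \<or> \<psi> v = 0) \<longrightarrow>
     (\<forall>v. proj v \<in> Z \<longrightarrow> \<phi> v = 0) \<or> (\<forall>v. proj v \<in> Z \<longrightarrow> \<psi> v = 0))"

lemma form_irreducibleD:
  assumes "form_irreducible n Z" "form_fun UNIV n d \<phi>" "form_fun UNIV n e \<psi>"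
    "\<And>v. proj v \<in> Z \<Longrightarrow> \<phi> v = 0 \<or> \<psi> v = 0" "proj v0 \<in> Z" "\<phi> v0 \<noteq> 0" "proj v \<in> Z"
  shows "\<psi> v = 0"
  using assms unfolding form_irreducible_def by blast

lemma zirreducible_forms:
  assumes "zirreducible n Z" "Z \<subseteq> pspace n"
  shows "form_irreducible n Z"
  unfolding form_irreducible_def
proof (intro allI impI)
  fix d e and \<phi> \<psi> :: "(nat \<Rightarrow> 'a) \<Rightarrow> 'a"
  assume f: "form_fun UNIV n d \<phi>" "form_fun UNIV n e \<psi>"
    and prod: "\<forall>v. proj v \<in> Z \<longrightarrow> \<phi> v = 0 \<or> \<psi> v = 0"
  define A where "A \<chi> = {p \<in> pspace n. \<forall>x. p = proj x \<longrightarrow> \<chi> x = 0}" for \<chi> :: "(nat \<Rightarrow> 'a) \<Rightarrow> 'a"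
  have ns: "\<chi> y = 0" if "form_fun UNIV n d' \<chi>" "proj x = proj y" "\<chi> x = 0" for \<chi> d' x y
    using that form_fun_scale[OF that(1)] by (auto simp: proj_eq_iff)
  have "Z \<subseteq> A \<phi> \<union> A \<psi>"
  proof
    fix p assume p: "p \<in> Z"
    then obtain x where x: "p = proj x" using assms(2) pspaceE by blast
    then show "p \<in> A \<phi> \<union> A \<psi>"
      using prod p assms(2) ns[OF f(1), of x] ns[OF f(2), of x] by (auto simp: A_def)
  qed
  then have "Z \<subseteq> A \<phi> \<or> Z \<subseteq> A \<psi>"
    using assms(1) zclosed_zeros[OF f(1) zclosed_pspace] zclosed_zeros[OF f(2) zclosed_pspace]
    unfolding zirreducible_def A_def by blast
  then show "(\<forall>v. proj v \<in> Z \<longrightarrow> \<phi> v = 0) \<or> (\<forall>v. proj v \<in> Z \<longrightarrow> \<psi> v = 0)"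
    by (auto simp: A_def)
qed

lemma morphismE:
  assumes "morphism K V W f" "proj v \<in> pts V" "pts V \<subseteq> pspace (amb V)"
  obtains d \<phi> where "\<And>j. j \<le> amb W \<Longrightarrow> form_fun K (amb V) d (\<phi> j)" "\<exists>j\<le>amb W. \<phi> j v \<noteq> 0"
    "\<And>u. proj u \<in> pts V \<Longrightarrow> \<exists>j\<le>amb W. \<phi> j u \<noteq> 0 \<Longrightarrow> f (proj u) = proj (cut (amb W) (\<lambda>j. \<phi> j u))"
proof -
  from assms obtain F where F: "form_tuple K (amb V) (amb W) F" "tuple_defined (amb W) F (proj v)"
    "\<forall>p'\<in>pts V. tuple_defined (amb W) F p' \<longrightarrow> f p' = tuple_map (amb W) F p'"
    unfolding morphism_def by blast
  from F(1) obtain d where "\<forall>j\<le>amb W. F j \<in> forms K (amb V) d" by (auto simp: form_tuple_def)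
  then show ?thesis
    by (intro that[of d "\<lambda>j. meval (F j)"])
       (use F in \<open>auto simp: tuple_defined_proj[OF F(1)] tuple_map_proj[OF F(1)] intro: form_fun_meval\<close>)
qed

lemma morphism_in: "morphism K V W f \<Longrightarrow> p \<in> pts V \<Longrightarrow> f p \<in> pts W"
  by (auto simp: morphism_def)

section \<open>Dominant tuples of forms and their composition\<close>

text \<open>Dominance of \<open>p \<mapsto> [\<phi> 0 p : \<dots> : \<phi> m p]\<close> in terms of representatives \<open>v\<close>. Density of the image is expressed
  by forms: what vanishes on the image vanishes on \<open>W\<close>. As \<open>\<psi>\<close> reads only the coordinates up to \<open>m\<close>, its
  argument need not be truncated.\<close>

definition dominates :: "'a::field set \<Rightarrow> nat \<Rightarrow> 'a ppoint set \<Rightarrow> nat \<Rightarrow> 'a ppoint set \<Rightarrow>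
    (nat \<Rightarrow> (nat \<Rightarrow> 'a) \<Rightarrow> 'a) \<Rightarrow> bool" where
  "dominates K n Z m W \<phi> \<longleftrightarrow>
     (\<exists>d. \<forall>j\<le>m. form_fun K n d (\<phi> j)) \<and>
     (\<exists>v. proj v \<in> Z \<and> (\<exists>j\<le>m. \<phi> j v \<noteq> 0)) \<and>
     (\<forall>v. proj v \<in> Z \<longrightarrow> (\<exists>j\<le>m. \<phi> j v \<noteq> 0) \<longrightarrow> proj (cut m (\<lambda>j. \<phi> j v)) \<in> W) \<and>
     (\<forall>e \<psi>. form_fun UNIV m e \<psi> \<longrightarrow>
        (\<forall>v. proj v \<in> Z \<longrightarrow> (\<exists>j\<le>m. \<phi> j v \<noteq> 0) \<longrightarrow> \<psi> (\<lambda>j. \<phi> j v) = 0) \<longrightarrow>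
        (\<forall>w. proj w \<in> W \<longrightarrow> \<psi> w = 0))"

lemma dominates_mono: "dominates K n Z m W \<phi> \<Longrightarrow> K \<subseteq> L \<Longrightarrow> dominates L n Z m W \<phi>"
  unfolding dominates_def by (meson form_fun_mono)

text \<open>A form that vanishes on the image of the composition pulls back to a form on \<open>Y\<close> that vanishes at the images
  of \<open>Z\<close>, hence on all of \<open>Y\<close>, hence the form itself vanishes on \<open>W\<close>. Irreducibility of \<open>Z\<close> makes it
  possible to ignore the points of \<open>Z\<close> where a chosen component of \<open>\<phi>\<close> vanishes.\<close>

lemma dominates_trans:
  assumes K: "coeff_ring K" and irr: "form_irreducible n Z"
    and 1: "dominates K n Z m Y \<phi>" and 2: "dominates K m Y l W \<chi>"
  shows "\<exists>\<xi>. dominates K n Z l W \<xi>"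
proof -
  from 1 obtain d where d: "\<forall>j\<le>m. form_fun K n d (\<phi> j)" by (auto simp: dominates_def)
  from 2 obtain e where e: "\<forall>j\<le>l. form_fun K m e (\<chi> j)" by (auto simp: dominates_def)
  have vanish1: "\<psi> w = 0" if "form_fun UNIV m b \<psi>" "proj w \<in> Y"
    "\<And>v. proj v \<in> Z \<Longrightarrow> \<psi> (\<lambda>j. \<phi> j v) = 0" for b \<psi> w
    using 1 that unfolding dominates_def by blast
  from 1 obtain v1 k where k: "proj v1 \<in> Z" "k \<le> m" "\<phi> k v1 \<noteq> 0" by (auto simp: dominates_def)
  \<comment> \<open>The factor \<open>\<phi> k\<close> guarantees that \<open>\<phi>\<close> is defined wherever \<open>\<xi>\<close> is, even if the \<open>\<chi> j\<close> are constants.\<close>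
  define \<xi> where "\<xi> j v = \<phi> k v * \<chi> j (\<lambda>i. \<phi> i v)" for j v
  have form: "form_fun K n (d + d * e) (\<xi> j)" if "j \<le> l" for j
    unfolding \<xi>_def using d e k that by (intro form_fun_mult form_fun_compose[where m = m] K) auto
  have U: "form_fun UNIV n a f" if "form_fun K n a f" for n a f
    using that by (rule form_fun_mono) simp
  have comp: "form_fun UNIV n (d * b) (\<lambda>v. \<psi> (\<lambda>j. \<phi> j v))" if "form_fun UNIV m b \<psi>" for b \<psi>
    by (rule form_fun_compose[OF coeff_ring_UNIV that]) (use d U in auto)
  have key: "\<psi> w = 0" if \<psi>: "form_fun UNIV m b \<psi>" and w: "proj w \<in> Y"
    and *: "\<And>v. proj v \<in> Z \<Longrightarrow> \<phi> k v \<noteq> 0 \<Longrightarrow> \<psi> (\<lambda>j. \<phi> j v) = 0" for b \<psi> w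
  proof (rule vanish1[OF \<psi> w])
    fix v assume v: "proj v \<in> Z"
    show "\<psi> (\<lambda>j. \<phi> j v) = 0"
    proof (rule form_irreducibleD[where \<phi> = "\<phi> k", OF irr _ comp[OF \<psi>] _ k(1) k(3) v])
      show "form_fun UNIV n d (\<phi> k)" using d k U by auto
      show "\<phi> k u = 0 \<or> \<psi> (\<lambda>j. \<phi> j u) = 0" if "proj u \<in> Z" for u using *[OF that] by blast
    qed
  qed
  have "dominates K n Z l W \<xi>"
    unfolding dominates_def
  proof (intro conjI allI impI)
    show "\<exists>d. \<forall>j\<le>l. form_fun K n d (\<xi> j)" using form by blast
    show "\<exists>v. proj v \<in> Z \<and> (\<exists>j\<le>l. \<xi> j v \<noteq> 0)"
    proof (rule ccontr)
      assume "\<not> ?thesis"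
      then have "\<And>v j. proj v \<in> Z \<Longrightarrow> \<phi> k v \<noteq> 0 \<Longrightarrow> j \<le> l \<Longrightarrow> \<chi> j (\<lambda>i. \<phi> i v) = 0"
        by (auto simp: \<xi>_def)
      then have "\<chi> j w = 0" if "j \<le> l" "proj w \<in> Y" for j w
        using key[of e "\<chi> j" w] e U that by auto
      then show False using 2 by (auto simp: dominates_def)
    qed
    show "proj (cut l (\<lambda>j. \<xi> j v)) \<in> W" if v: "proj v \<in> Z" and j: "\<exists>j\<le>l. \<xi> j v \<noteq> 0" for v
    proof -
      from j have k0: "\<phi> k v \<noteq> 0" and \<chi>0: "\<exists>j\<le>l. \<chi> j (\<lambda>i. \<phi> i v) \<noteq> 0" by (auto simp: \<xi>_def)
      have c: "\<chi> j (cut m (\<lambda>i. \<phi> i v)) = \<chi> j (\<lambda>i. \<phi> i v)" if "j \<le> l" for j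
        using e that form_fun_cut by blast
      have "proj (cut m (\<lambda>i. \<phi> i v)) \<in> Y" using 1 v k0 k by (auto simp: dominates_def)
      then have "proj (cut l (\<lambda>j. \<chi> j (cut m (\<lambda>i. \<phi> i v)))) \<in> W"
        using 2 \<chi>0 c unfolding dominates_def by metis
      also have "proj (cut l (\<lambda>j. \<chi> j (cut m (\<lambda>i. \<phi> i v)))) = proj (cut l (\<lambda>j. \<xi> j v))"
        unfolding proj_eq_iff using k0 c
        by (intro exI[of _ "\<phi> k v"]) (auto simp: \<xi>_def cut_def fun_eq_iff)
      finally show ?thesis .
    qed
    fix b \<psi> w assume \<psi>: "form_fun UNIV l b \<psi>" and w: "proj w \<in> W"
      and van: "\<forall>v. proj v \<in> Z \<longrightarrow> (\<exists>j\<le>l. \<xi> j v \<noteq> 0) \<longrightarrow> \<psi> (\<lambda>j. \<xi> j v) = 0"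
    have "\<psi> (\<lambda>j. \<chi> j y) = 0" if y: "proj y \<in> Y" "i \<le> l" "\<chi> i y \<noteq> 0" for y i
    proof -
      have form': "form_fun UNIV m (e + e * b) (\<lambda>y. \<chi> i y * \<psi> (\<lambda>j. \<chi> j y))"
        using e y U by (intro form_fun_mult form_fun_compose[where m = l] \<psi> coeff_ring_UNIV) auto
      have "\<chi> i y * \<psi> (\<lambda>j. \<chi> j y) = 0"
      proof (rule key[OF form' y(1)])
        fix v assume v: "proj v \<in> Z" "\<phi> k v \<noteq> 0"
        show "\<chi> i (\<lambda>j. \<phi> j v) * \<psi> (\<lambda>j. \<chi> j (\<lambda>j. \<phi> j v)) = 0"
        proof (cases "\<chi> i (\<lambda>j. \<phi> j v) = 0")
          case False
          then have "\<psi> (\<lambda>j. \<xi> j v) = 0" using van v y by (auto simp: \<xi>_def)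
          then show ?thesis
            using form_fun_scale[OF \<psi>, of "\<phi> k v"] v by (simp add: \<xi>_def)
        qed simp
      qed
      then show ?thesis using y by simp
    qed
    then show "\<psi> w = 0" using 2 \<psi> w unfolding dominates_def by blast
  qed
  then show ?thesis by blast
qed

lemma dominates_imp_dominant_rational_map:
  assumes dom: "dominates K (amb V) (pts V) (amb W) (pts W) \<phi>"
    and V: "pts V \<subseteq> pspace (amb V)" and W: "zclosed (amb W) (pts W)"
  shows "\<exists>F. dominant_rational_map K V W F"
proof -
  from dom obtain d where "\<forall>j\<le>amb W. \<exists>F\<in>forms K (amb V) d. \<phi> j = meval F"
    by (auto simp: dominates_def form_fun_def)
  then obtain F where F: "\<And>j. j \<le> amb W \<Longrightarrow> F j \<in> forms K (amb V) d \<and> \<phi> j = meval (F j)" by metis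
  have ft: "form_tuple K (amb V) (amb W) F" using F by (auto simp: form_tuple_def)
  have def: "tuple_defined (amb W) F (proj v) \<longleftrightarrow> (\<exists>j\<le>amb W. \<phi> j v \<noteq> 0)" for v
    using F by (auto simp: tuple_defined_proj[OF ft])
  have map: "tuple_map (amb W) F (proj v) = proj (cut (amb W) (\<lambda>j. \<phi> j v))" for v
    using F by (auto simp: tuple_map_proj[OF ft] cut_def intro!: arg_cong[of _ _ proj])
  have im: "tuple_map (amb W) F p \<in> pts W" if "p \<in> pts V" "tuple_defined (amb W) F p" for p
  proof -
    obtain v where "p = proj v" using V \<open>p \<in> pts V\<close> pspaceE by blast
    then show ?thesis using that dom by (auto simp: dominates_def def map)
  qed
  let ?I = "tuple_map (amb W) F ` {p \<in> pts V. tuple_defined (amb W) F p}"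
  have "rational_map K V W F"
    unfolding rational_map_def using ft im dom def by (auto simp: dominates_def)
  moreover have "zclosure (amb W) ?I = pts W"
  proof
    have "zclosure (amb W) ?I \<subseteq> zclosure (amb W) (pts W)"
      using im by (force simp: zclosure_def vanishes_on_def)
    then show "zclosure (amb W) ?I \<subseteq> pts W" using W by (simp add: zclosed_def)
    show "pts W \<subseteq> zclosure (amb W) ?I"
    proof
      fix q assume q: "q \<in> pts W"
      then have qp: "q \<in> pspace (amb W)" using zclosed_subset[OF W] by auto
      then obtain w where w: "q = proj w" by (rule pspaceE)
      have "vanishes_at G q" if G: "G \<in> forms UNIV (amb W) e" "vanishes_on G ?I" for e G
      proof -
        have "meval G (\<lambda>j. \<phi> j v) = 0" if v: "proj v \<in> pts V" "\<exists>j\<le>amb W. \<phi> j v \<noteq> 0" for v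
        proof -
          have "vanishes_at G (proj (cut (amb W) (\<lambda>j. \<phi> j v)))"
            using G(2) v unfolding vanishes_on_def by (metis (mono_tags, lifting) def map image_eqI mem_Collect_eq)
          then show ?thesis
            by (simp add: vanishes_at_proj[OF G(1)] form_fun_cut[OF form_fun_meval[OF G(1)]])
        qed
        then have "meval G w = 0"
          using dom form_fun_meval[OF G(1)] q w unfolding dominates_def by blast
        then show ?thesis by (simp add: w vanishes_at_proj[OF G(1)])
      qed
      then show "q \<in> zclosure (amb W) ?I" using qp by (auto simp: zclosure_def)
    qed
  qed
  ultimately show ?thesis by (auto simp: dominant_rational_map_def)
qed

text \<open>A point \<open>q\<close> of \<open>W\<close> at which the rational inverse \<open>G\<close> is defined is the image of \<open>G q\<close>. So a form that vanishes
  on the image vanishes on a nonempty open part of \<open>W\<close>, and \<open>W\<close> is irreducible.\<close>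

lemma birational_morphism_dominates:
  assumes K: "coeff_ring K" and bir: "birational_morphism K V W f"
    and V: "pts V \<subseteq> pspace (amb V)" and W: "pts W \<subseteq> pspace (amb W)"
    and irr: "form_irreducible (amb W) (pts W)"
  shows "\<exists>\<phi>. dominates K (amb V) (pts V) (amb W) (pts W) \<phi>"
proof -
  from bir obtain G where mor: "morphism K V W f" and rat: "rational_map K W V G"
    and fG: "\<forall>q\<in>pts W. tuple_defined (amb V) G q \<longrightarrow> f (tuple_map (amb V) G q) = q"
    by (auto simp: birational_morphism_def)
  from rat have ft: "form_tuple K (amb W) (amb V) G" by (simp add: rational_map_def)
  then obtain a where a: "\<And>j. j \<le> amb V \<Longrightarrow> G j \<in> forms K (amb W) a" by (auto simp: form_tuple_def)
  define \<gamma> where "\<gamma> j = meval (G j)" for j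
  have \<gamma>: "form_fun UNIV (amb W) a (\<gamma> j)" if "j \<le> amb V" for j
    unfolding \<gamma>_def using form_fun_meval[OF a[OF that]] by (rule form_fun_mono) simp
  have inv: "proj (cut (amb V) (\<lambda>j. \<gamma> j w)) \<in> pts V"
    "f (proj (cut (amb V) (\<lambda>j. \<gamma> j w))) = proj w"
    if "proj w \<in> pts W" "\<exists>j\<le>amb V. \<gamma> j w \<noteq> 0" for w
    using that rat fG
    by (auto simp: \<gamma>_def rational_map_def tuple_defined_proj[OF ft] tuple_map_proj[OF ft])
  obtain q0 where "q0 \<in> pts W" "tuple_defined (amb V) G q0" using rat by (auto simp: rational_map_def)
  moreover obtain w0 where "q0 = proj w0" using W \<open>q0 \<in> pts W\<close> pspaceE by blast
  ultimately obtain b where w0: "proj w0 \<in> pts W" "b \<le> amb V" "\<gamma> b w0 \<noteq> 0"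
    by (auto simp: tuple_defined_proj[OF ft] \<gamma>_def)
  define g where "g w = cut (amb V) (\<lambda>j. \<gamma> j w)" for w
  have "proj (g w0) \<in> pts V" using inv(1)[of w0] w0 by (auto simp: g_def)
  from morphismE[OF mor this V] obtain d \<phi> where
    \<phi>: "\<And>j. j \<le> amb W \<Longrightarrow> form_fun K (amb V) d (\<phi> j)" "\<exists>j\<le>amb W. \<phi> j (g w0) \<noteq> 0"
    and f: "\<And>u. proj u \<in> pts V \<Longrightarrow> \<exists>j\<le>amb W. \<phi> j u \<noteq> 0 \<Longrightarrow>
      f (proj u) = proj (cut (amb W) (\<lambda>j. \<phi> j u))" by blast
  from \<phi>(2) obtain c where c: "c \<le> amb W" "\<phi> c (g w0) \<noteq> 0" by blast
  have \<phi>g: "\<phi> j (g w) = \<phi> j (\<lambda>j. \<gamma> j w)" if "j \<le> amb W" for j w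
    unfolding g_def by (rule form_fun_cut[OF \<phi>(1)[OF that]])
  have "dominates K (amb V) (pts V) (amb W) (pts W) \<phi>"
    unfolding dominates_def
  proof (intro conjI allI impI)
    show "\<exists>d. \<forall>j\<le>amb W. form_fun K (amb V) d (\<phi> j)" using \<phi> by blast
    show "\<exists>v. proj v \<in> pts V \<and> (\<exists>j\<le>amb W. \<phi> j v \<noteq> 0)"
      using \<open>proj (g w0) \<in> pts V\<close> \<phi>(2) by blast
    show "proj (cut (amb W) (\<lambda>j. \<phi> j v)) \<in> pts W"
      if "proj v \<in> pts V" "\<exists>j\<le>amb W. \<phi> j v \<noteq> 0" for v
      using morphism_in[OF mor that(1)] f[OF that] by simp
    fix e \<psi> w
    assume \<psi>: "form_fun UNIV (amb W) e \<psi>" and w: "proj w \<in> pts W"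
      and van: "\<forall>v. proj v \<in> pts V \<longrightarrow> (\<exists>j\<le>amb W. \<phi> j v \<noteq> 0) \<longrightarrow> \<psi> (\<lambda>j. \<phi> j v) = 0"
    \<comment> \<open>Where \<open>\<theta>\<close> does not vanish, \<open>G\<close> is defined and the chosen chart \<open>\<phi>\<close> of \<open>f\<close> is defined at the image.\<close>
    define \<theta> where "\<theta> w = \<gamma> b w * \<phi> c (\<lambda>j. \<gamma> j w)" for w
    have \<theta>: "form_fun UNIV (amb W) (a + a * d) \<theta>"
      unfolding \<theta>_def
      by (intro form_fun_mult form_fun_compose[where m = "amb V"] coeff_ring_UNIV \<gamma> w0 form_fun_mono[OF \<phi>(1)] c) auto
    show "\<psi> w = 0"
    proof (rule form_irreducibleD[OF irr \<theta> \<psi> _ w0(1) _ w])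
      show "\<theta> w0 \<noteq> 0" using w0 c \<phi>g by (simp add: \<theta>_def)
      fix u assume u: "proj u \<in> pts W"
      show "\<theta> u = 0 \<or> \<psi> u = 0"
      proof (cases "\<theta> u = 0")
        case False
        then have b: "\<gamma> b u \<noteq> 0" and cu: "\<phi> c (g u) \<noteq> 0" using c \<phi>g by (auto simp: \<theta>_def)
        then have gu: "proj (g u) \<in> pts V" "f (proj (g u)) = proj u"
          using inv[OF u] w0(2) by (auto simp: g_def)
        then have "proj (cut (amb W) (\<lambda>j. \<phi> j (g u))) = proj u" using f[OF gu(1)] c cu by auto
        then obtain s where s: "s \<noteq> 0" "u = (\<lambda>i. s * cut (amb W) (\<lambda>j. \<phi> j (g u)) i)"
          by (auto simp: proj_eq_iff)
        have "\<psi> u = s ^ e * \<psi> (\<lambda>j. \<phi> j (g u))"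
          by (subst s(2)) (simp add: form_fun_scale[OF \<psi>] form_fun_cut[OF \<psi>])
        also have "\<psi> (\<lambda>j. \<phi> j (g u)) = 0" using van gu c cu by blast
        finally show ?thesis by simp
      qed simp
    qed
  qed
  then show ?thesis by blast
qed

section \<open>Segre coordinates\<close>

text \<open>The Segre map on representatives.\<close>

definition tensor :: "nat \<Rightarrow> nat \<Rightarrow> (nat \<Rightarrow> 'a::field) \<Rightarrow> (nat \<Rightarrow> 'a) \<Rightarrow> nat \<Rightarrow> 'a" where
  "tensor n m x y = (\<lambda>k. if k < (n + 1) * (m + 1) then x (k div (m + 1)) * y (k mod (m + 1)) else 0)"

lemma tensor_index:
  assumes "i \<le> n" "j \<le> m" shows "tensor n m x y (i * (m + 1) + j) = x i * y j"
proof -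
  have "i * (m + 1) + j < (n + 1) * (m + 1)"
  proof -
    have "i * (m + 1) + j < (i + 1) * (m + 1)" using assms by simp
    also have "\<dots> \<le> (n + 1) * (m + 1)" using assms by (intro mult_right_mono) auto
    finally show ?thesis .
  qed
  moreover have "(i * (m + 1) + j) div (m + 1) = i"
    by (subst div_mult_self3) (use assms in auto)
  moreover have "(i * (m + 1) + j) mod (m + 1) = j"
    by (subst mod_mult_self3) (use assms in auto)
  ultimately show ?thesis by (simp add: tensor_def)
qed

lemma index_le: "i \<le> n \<Longrightarrow> j \<le> m \<Longrightarrow> i * (m + 1) + j \<le> (n + 1) * (m + 1) - (1::nat)"
proof -
  assume a: "i \<le> n" "j \<le> m"
  have "i * (m + 1) + j < (i + 1) * (m + 1)" using a by simp
  also have "\<dots> \<le> (n + 1) * (m + 1)" using a by (intro mult_right_mono) auto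
  finally show ?thesis by linarith
qed

lemma tensor_scale: "tensor n m (\<lambda>i. a * x i) (\<lambda>j. b * y j) = (\<lambda>k. (a * b) * tensor n m x y k)"
  by (auto simp: tensor_def fun_eq_iff)

lemma tensor_cong:
  assumes "\<And>i. i \<le> n \<Longrightarrow> x i = x' i" "\<And>j. j \<le> m \<Longrightarrow> y j = y' j"
  shows "tensor n m x y = tensor n m x' y'"
proof
  fix k
  show "tensor n m x y k = tensor n m x' y' k"
  proof (cases "k < (n + 1) * (m + 1)")
    case True
    then have "k div (m + 1) < n + 1" by (intro less_mult_imp_div_less) simp
    moreover have "k mod (m + 1) < m + 1" by simp
    ultimately show ?thesis using assms by (simp add: tensor_def)
  qed (auto simp: tensor_def)
qed

lemma segre_proj: "segre n m (proj x) (proj y) = proj (tensor n m x y)"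
proof -
  obtain a where a: "a \<noteq> 0" "rep (proj x) = (\<lambda>i. a * x i)" by (rule rep_proj)
  obtain b where b: "b \<noteq> 0" "rep (proj y) = (\<lambda>i. b * y i)" by (rule rep_proj)
  have "segre n m (proj x) (proj y) = proj (tensor n m (rep (proj x)) (rep (proj y)))"
    by (simp add: segre_def tensor_def)
  then show ?thesis using a b by (simp add: tensor_scale proj_scale)
qed

lemma tensor_in_pspace:
  assumes "\<exists>i\<le>n. x i \<noteq> 0" "\<exists>j\<le>m. y j \<noteq> 0"
  shows "proj (tensor n m x y) \<in> pspace ((n + 1) * (m + 1) - 1)"
proof -
  from assms obtain i j where ij: "i \<le> n" "x i \<noteq> 0" "j \<le> m" "y j \<noteq> 0" by auto
  have "tensor n m x y (i * (m + 1) + j) \<noteq> 0" using ij by (subst tensor_index) auto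
  moreover have "tensor n m x y k = 0" if "k > (n + 1) * (m + 1) - 1" for k
    using that by (auto simp: tensor_def)
  ultimately show ?thesis
    using index_le[OF ij(1,3)] by (auto simp: proj_in_pspace)
qed

lemma form_fun_tensor:
  assumes K: "coeff_ring K" and f: "\<And>j. j \<le> m \<Longrightarrow> form_fun K n d (f j)"
  shows "form_fun K n (1 + d) (\<lambda>v. tensor n m v (\<lambda>j. f j v) k)"
proof (cases "k < (n + 1) * (m + 1)")
  case True
  then have "k div (m + 1) < n + 1" by (intro less_mult_imp_div_less) simp
  moreover have "k mod (m + 1) < m + 1" by simp
  ultimately have "form_fun K n (1 + d) (\<lambda>v. v (k div (m + 1)) * f (k mod (m + 1)) v)"
    by (intro form_fun_mult K form_fun_coord f) auto
  then show ?thesis using True by (simp add: tensor_def)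
qed (simp add: tensor_def form_fun_zero)

section \<open>From a variety to its blow-up\<close>

lemma varietyD:
  assumes "variety K V"
  shows "zclosed (amb V) (pts V)" "pts V \<subseteq> pspace (amb V)" "zirreducible (amb V) (pts V)"
    "form_irreducible (amb V) (pts V)"
proof -
  show 1: "zclosed (amb V) (pts V)" and 2: "zirreducible (amb V) (pts V)"
    using assms by (simp_all add: variety_def)
  show 3: "pts V \<subseteq> pspace (amb V)" by (rule zclosed_subset[OF 1])
  show "form_irreducible (amb V) (pts V)" by (rule zirreducible_forms[OF 2 3])
qed

text \<open>The map is \<open>v \<mapsto> h' (v, f v)\<close>, with \<open>f\<close> the generators of the ideal sheaf. It is dominant because a general point
  \<open>b\<close> of the blow-up is the image of \<open>\<beta> b\<close>: the isomorphism \<open>h\<close> sends \<open>b\<close> to a pair \<open>(\<beta> b, r)\<close> in the closure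
  of the graph, and over a point where \<open>f\<close> is defined the closure contains only \<open>(\<beta> b, f (\<beta> b))\<close>.\<close>

lemma blowup_dominates:
  assumes K: "coeff_ring K" and Q: "pts Q \<subseteq> pspace (amb Q)" and blow: "blowup K Q S B \<beta>"
  shows "\<exists>\<phi>. dominates K (amb Q) (pts Q) (amb B) (pts B) \<phi>"
proof -
  have vB: "variety K B" and mor\<beta>: "morphism K B Q \<beta>" using blow by (simp_all add: blowup_def)
  have "\<exists>d m F h h'. generates_ideal_sheaf K Q S d m F \<and>
      morphism K B (graph_closure Q m F) h \<and> morphism K (graph_closure Q m F) B h' \<and>
      (\<forall>b\<in>pts B. h' (h b) = b) \<and> (\<forall>g\<in>pts (graph_closure Q m F). h (h' g) = g) \<and>
      (\<forall>b\<in>pts B. \<exists>r\<in>pspace m. h b = segre (amb Q) m (\<beta> b) r)"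
    using blow by (simp add: blowup_def)
  then obtain d m F h h' where gen: "generates_ideal_sheaf K Q S d m F"
    and morh: "morphism K B (graph_closure Q m F) h" and morh': "morphism K (graph_closure Q m F) B h'"
    and h'h_all: "\<forall>b\<in>pts B. h' (h b) = b"
    and hh'_all: "\<forall>g\<in>pts (graph_closure Q m F). h (h' g) = g"
    and over_all: "\<forall>b\<in>pts B. \<exists>r\<in>pspace m. h b = segre (amb Q) m (\<beta> b) r"
    by (elim exE conjE) (rule that)
  note h'h = bspec[OF h'h_all] and hh' = bspec[OF hh'_all] and over = bspec[OF over_all]
  note B = varietyD[OF vB]
  define n N where "n = amb Q" and "N = (n + 1) * (m + 1) - 1"
  define f where "f j = meval (F j)" for j
  have F: "\<And>j. j \<le> m \<Longrightarrow> F j \<in> forms K n d" using gen by (auto simp: generates_ideal_sheaf_def n_def)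
  then have ft: "form_tuple K n m F" by (auto simp: form_tuple_def)
  have f: "form_fun K n d (f j)" if "j \<le> m" for j using F[OF that] by (auto simp: f_def form_fun_meval)
  have U: "form_fun UNIV a b \<phi>" if "form_fun K a b \<phi>" for a b \<phi> using that by (rule form_fun_mono) simp
  define G where "G = graph_closure Q m F"
  define \<Gamma> where "\<Gamma> = {proj (tensor n m v (\<lambda>j. f j v)) | v. proj v \<in> pts Q \<and> (\<exists>j\<le>m. f j v \<noteq> 0)}"
  have \<Gamma>_sub: "\<Gamma> \<subseteq> pspace N"
  proof
    fix p assume "p \<in> \<Gamma>"
    then obtain v where v: "p = proj (tensor n m v (\<lambda>j. f j v))" "proj v \<in> pts Q" "\<exists>j\<le>m. f j v \<noteq> 0"
      by (auto simp: \<Gamma>_def)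
    have "proj v \<in> pspace n" using v Q by (auto simp: n_def)
    then show "p \<in> pspace N"
      unfolding v(1) N_def by (intro tensor_in_pspace v(3)) (simp add: proj_in_pspace)
  qed
  have ampG: "amb G = N" by (simp add: G_def graph_closure_def N_def n_def)
  have "{segre (amb Q) m q (tuple_map m F q) | q. q \<in> pts Q \<and> tuple_defined m F q} = \<Gamma>"
  proof -
    have "segre n m (proj v) (tuple_map m F (proj v)) = proj (tensor n m v (\<lambda>j. f j v))" for v
      unfolding tuple_map_proj[OF ft] segre_proj
      by (intro arg_cong[of _ _ proj] tensor_cong) (auto simp: cut_def f_def)
    note seg = this[folded n_def]
    show ?thesis
    proof (intro equalityI subsetI)
      fix p assume "p \<in> {segre (amb Q) m q (tuple_map m F q) | q. q \<in> pts Q \<and> tuple_defined m F q}"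
      then obtain q where q: "q \<in> pts Q" "tuple_defined m F q" "p = segre n m q (tuple_map m F q)"
        by (auto simp: n_def)
      moreover obtain v where "q = proj v" using Q q(1) pspaceE by blast
      ultimately show "p \<in> \<Gamma>"
        using seg[of v] tuple_defined_proj[OF ft, of v] by (auto simp: \<Gamma>_def f_def)
    next
      fix p assume "p \<in> \<Gamma>"
      then obtain v where v: "proj v \<in> pts Q" "\<exists>j\<le>m. f j v \<noteq> 0" "p = proj (tensor n m v (\<lambda>j. f j v))"
        by (auto simp: \<Gamma>_def)
      have "tuple_defined m F (proj v)" using v(2) tuple_defined_proj[OF ft, of v] by (simp add: f_def)
      then show "p \<in> {segre (amb Q) m q (tuple_map m F q) | q. q \<in> pts Q \<and> tuple_defined m F q}"
        using v(1,3) seg[of v] unfolding n_def by (intro CollectI exI[of _ "proj v"]) simp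
    qed
  qed
  then have ptsG: "pts G = zclosure N \<Gamma>" by (simp add: G_def graph_closure_def N_def n_def)
  have G_sub: "pts G \<subseteq> pspace (amb G)" by (auto simp: ptsG ampG zclosure_def)
  obtain b1 where "b1 \<in> pts B" using B(3) by (auto simp: zirreducible_def)
  then have "h b1 \<in> pts G" using morphism_in[OF morh] by (simp add: G_def)
  have "\<Gamma> \<noteq> {}"
    using zclosed_empty[of N] \<open>h b1 \<in> pts G\<close> by (auto simp: ptsG zclosed_def)
  then obtain v0 i0 where v0: "proj v0 \<in> pts Q" "i0 \<le> m" "f i0 v0 \<noteq> 0" by (auto simp: \<Gamma>_def)
  define g where "g v = tensor n m v (\<lambda>j. f j v)" for v
  have gG: "proj (g v) \<in> pts G" if "proj v \<in> pts Q" "j \<le> m" "f j v \<noteq> 0" for v j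
    using zclosure_self[OF \<Gamma>_sub] that by (auto simp: ptsG \<Gamma>_def g_def)
  have g0: "proj (g v0) \<in> pts G" using gG v0 by blast
  from morphismE[OF morh'[folded G_def] g0 G_sub] obtain e \<chi> where
    \<chi>: "\<And>j. j \<le> amb B \<Longrightarrow> form_fun K N e (\<chi> j)" "\<exists>j\<le>amb B. \<chi> j (g v0) \<noteq> 0"
    and h': "\<And>u. proj u \<in> pts G \<Longrightarrow> \<exists>j\<le>amb B. \<chi> j u \<noteq> 0 \<Longrightarrow> h' (proj u) = proj (cut (amb B) (\<lambda>j. \<chi> j u))"
    unfolding ampG by blast
  from \<chi>(2) obtain j0 where j0: "j0 \<le> amb B" "\<chi> j0 (g v0) \<noteq> 0" by blast
  define \<phi> where "\<phi> j v = f i0 v * \<chi> j (g v)" for j v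
  have \<phi>: "form_fun K n (d + (1 + d) * e) (\<phi> j)" if "j \<le> amb B" for j
    unfolding \<phi>_def g_def
    by (intro form_fun_mult K f v0 form_fun_compose[OF K \<chi>(1)] form_fun_tensor that)
  have \<phi>_h': "h' (proj (g v)) = proj (cut (amb B) (\<lambda>j. \<phi> j v))"
    if v: "proj v \<in> pts Q" and j: "f i0 v \<noteq> 0" "\<exists>j\<le>amb B. \<chi> j (g v) \<noteq> 0" for v
  proof -
    have "h' (proj (g v)) = proj (cut (amb B) (\<lambda>j. \<chi> j (g v)))"
      using h'[OF gG[OF v v0(2)]] j by auto
    also have "\<dots> = proj (cut (amb B) (\<lambda>j. \<phi> j v))"
      unfolding proj_eq_iff by (intro exI[of _ "f i0 v"]) (use j in \<open>auto simp: cut_def fun_eq_iff \<phi>_def\<close>)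
    finally show ?thesis .
  qed
  \<comment> \<open>The graph of \<open>f\<close> is closed over the points where \<open>f\<close> is defined: a point \<open>(v, y)\<close> of its closure
    satisfies \<open>y i * f j v = y j * f i v\<close>.\<close>
  have graph_eq: "y i * f j v = y j * f i v"
    if gv: "proj (\<lambda>k. s * tensor n m v y k) \<in> pts G" and s: "s \<noteq> 0"
      and nz: "\<exists>k\<le>n. v k \<noteq> 0" "\<exists>l\<le>m. y l \<noteq> 0" and ij: "i \<le> m" "j \<le> m" for v y i j s
  proof -
    from nz obtain k l where kl: "k \<le> n" "v k \<noteq> 0" "l \<le> m" "y l \<noteq> 0" by blast
    \<comment> \<open>In terms of the factors, \<open>E\<close> is \<open>v k * y l ^ d * (y i * f j v - y j * f i v)\<close>.\<close>
    define E where "E c = c (k * (m + 1) + i) * f j (\<lambda>a. c (a * (m + 1) + l)) -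
      c (k * (m + 1) + j) * f i (\<lambda>a. c (a * (m + 1) + l))" for c
    have coord: "form_fun UNIV N 1 (\<lambda>c :: nat \<Rightarrow> 'a. c (a * (m + 1) + b))" if "a \<le> n" "b \<le> m" for a b
      unfolding N_def by (intro form_fun_coord coeff_ring_UNIV index_le that)
    have E: "form_fun UNIV N (1 + 1 * d) E"
      unfolding E_def
      by (intro form_fun_diff form_fun_mult coeff_ring_UNIV coord form_fun_compose[OF _ U[OF f]] kl ij)
    have E_tensor: "E (\<lambda>p. c * tensor n m u z p) = c * u k * (c * z l) ^ d * (z i * f j u - z j * f i u)"
      for c u z
    proof -
      have *: "f b (\<lambda>a. c * tensor n m u z (a * (m + 1) + l)) = (c * z l) ^ d * f b u" if "b \<le> m" for b
      proof -
        have "f b (\<lambda>a. c * tensor n m u z (a * (m + 1) + l)) = f b (\<lambda>a. (c * z l) * u a)"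
          by (rule form_fun_cong[OF f[OF that]]) (subst tensor_index, use kl in auto)
        then show ?thesis by (simp add: form_fun_scale[OF f[OF that]])
      qed
      show ?thesis
        unfolding E_def tensor_index[OF kl(1) ij(1)] tensor_index[OF kl(1) ij(2)] *[OF ij(1)] *[OF ij(2)]
        by (simp add: algebra_simps)
    qed
    have "E (\<lambda>k. s * tensor n m v y k) = 0"
    proof (rule zclosureD[OF _ \<Gamma>_sub E])
      show "proj (\<lambda>k. s * tensor n m v y k) \<in> zclosure N \<Gamma>" using gv by (simp add: ptsG)
      fix c assume "proj c \<in> \<Gamma>"
      then obtain u where "proj (tensor n m u (\<lambda>j. f j u)) = proj c" by (auto simp: \<Gamma>_def)
      then obtain a where "c = (\<lambda>k. a * tensor n m u (\<lambda>j. f j u) k)" by (auto simp: proj_eq_iff)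
      then show "E c = 0" by (simp add: E_tensor)
    qed
    then show ?thesis using kl s by (simp add: E_tensor)
  qed
  have "dominates K n (pts Q) (amb B) (pts B) \<phi>"
    unfolding dominates_def
  proof (intro conjI allI impI)
    show "\<exists>d. \<forall>j\<le>amb B. form_fun K n d (\<phi> j)" using \<phi> by blast
    show "\<exists>v. proj v \<in> pts Q \<and> (\<exists>j\<le>amb B. \<phi> j v \<noteq> 0)" using v0 j0 by (auto simp: \<phi>_def)
    show "proj (cut (amb B) (\<lambda>j. \<phi> j v)) \<in> pts B"
      if v: "proj v \<in> pts Q" and nz: "\<exists>j\<le>amb B. \<phi> j v \<noteq> 0" for v
    proof -
      from nz have *: "f i0 v \<noteq> 0" "\<exists>j\<le>amb B. \<chi> j (g v) \<noteq> 0" by (auto simp: \<phi>_def)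
      then have "h' (proj (g v)) \<in> pts B"
        using morphism_in[OF morh'[folded G_def] gG[OF v v0(2)]] by simp
      then show ?thesis using \<phi>_h'[OF v *] by simp
    qed
    fix b \<psi> w
    assume \<psi>: "form_fun UNIV (amb B) b \<psi>" and w: "proj w \<in> pts B"
      and van: "\<forall>v. proj v \<in> pts Q \<longrightarrow> (\<exists>j\<le>amb B. \<phi> j v \<noteq> 0) \<longrightarrow> \<psi> (\<lambda>j. \<phi> j v) = 0"
    have "h' (proj (g v0)) \<in> pts B" using morphism_in[OF morh'[folded G_def] g0] .
    moreover then obtain w0 where w0: "h' (proj (g v0)) = proj w0" using B(2) pspaceE by blast
    ultimately have w0B: "proj w0 \<in> pts B" by simp
    from morphismE[OF morh[folded G_def] w0B B(2)] obtain a \<eta> where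
      \<eta>: "\<And>k. k \<le> N \<Longrightarrow> form_fun K (amb B) a (\<eta> k)" "\<exists>k\<le>N. \<eta> k w0 \<noteq> 0"
      and h: "\<And>u. proj u \<in> pts B \<Longrightarrow> \<exists>k\<le>N. \<eta> k u \<noteq> 0 \<Longrightarrow> h (proj u) = proj (cut N (\<lambda>k. \<eta> k u))"
      unfolding ampG by blast
    from \<eta>(2) obtain k0 where k0: "k0 \<le> N" "\<eta> k0 w0 \<noteq> 0" by blast
    \<comment> \<open>Where \<open>\<theta>\<close> does not vanish, the chart \<open>\<eta>\<close> of \<open>h\<close>, the tuple \<open>f\<close> at \<open>\<beta>\<close> and the chart \<open>\<chi>\<close> of \<open>h'\<close> are all
      defined: a column of the Segre coordinates \<open>\<eta>\<close> is a representative of \<open>\<beta>\<close>.\<close>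
    define \<theta> where "\<theta> w = \<eta> k0 w * (f i0 (\<lambda>i. \<eta> (i * (m + 1) + i0) w) * \<chi> j0 (\<lambda>k. \<eta> k w))" for w
    have \<theta>: "form_fun UNIV (amb B) (a + (a * d + a * e)) \<theta>"
      unfolding \<theta>_def
      by (intro form_fun_mult coeff_ring_UNIV form_fun_compose[OF _ U[OF f]]
          form_fun_compose[OF _ U[OF \<chi>(1)]] U[OF \<eta>(1)] k0 j0 v0) (auto simp: N_def intro: index_le[OF _ v0(2), simplified])
    have \<theta>_tensor: "\<theta> u = \<eta> k0 u * ((s * y i0) ^ d * f i0 v * (s ^ e * \<chi> j0 (tensor n m v y)))"
      if eq: "cut N (\<lambda>k. \<eta> k u) = (\<lambda>k. s * tensor n m v y k)" for u s v y
    proof -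
      have \<eta>_eq: "\<eta> k u = s * tensor n m v y k" if "k \<le> N" for k
        using fun_cong[OF eq, of k] that by (simp add: cut_def)
      have "f i0 (\<lambda>i. \<eta> (i * (m + 1) + i0) u) = f i0 (\<lambda>i. (s * y i0) * v i)"
      proof (rule form_fun_cong[OF f[OF v0(2)]])
        fix i assume i: "i \<le> n"
        show "\<eta> (i * (m + 1) + i0) u = s * y i0 * v i"
          using \<eta>_eq[of "i * (m + 1) + i0"] index_le[OF i v0(2)] tensor_index[OF i v0(2), of v y]
          by (simp add: N_def)
      qed
      moreover have "\<chi> j0 (\<lambda>k. \<eta> k u) = \<chi> j0 (\<lambda>k. s * tensor n m v y k)"
        by (rule form_fun_cong[OF \<chi>(1)[OF j0(1)]]) (simp add: \<eta>_eq)
      ultimately show ?thesis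
        by (simp add: \<theta>_def form_fun_scale[OF f[OF v0(2)]] form_fun_scale[OF \<chi>(1)[OF j0(1)]])
    qed
    show "\<psi> w = 0"
    proof (rule form_irreducibleD[OF B(4) \<theta> \<psi> _ w0B _ w])
      have "h (proj w0) = proj (g v0)" using hh' g0 w0 by (metis G_def)
      then have "proj (cut N (\<lambda>k. \<eta> k w0)) = proj (g v0)" using h[OF w0B \<eta>(2)] by simp
      then obtain s where s: "s \<noteq> 0" "cut N (\<lambda>k. \<eta> k w0) = (\<lambda>k. s * g v0 k)"
        unfolding proj_eq_iff[of "g v0"] by (metis proj_eq_iff)
      show "\<theta> w0 \<noteq> 0"
        using \<theta>_tensor[OF s(2)[unfolded g_def]] k0 j0 v0 s by (simp add: g_def)
      fix u assume u: "proj u \<in> pts B"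
      show "\<theta> u = 0 \<or> \<psi> u = 0"
      proof (cases "\<theta> u = 0")
        case False
        then have hu: "h (proj u) = proj (cut N (\<lambda>k. \<eta> k u))" using h[OF u] k0 by (auto simp: \<theta>_def)
        obtain r where r: "r \<in> pspace m" "h (proj u) = segre n m (\<beta> (proj u)) r"
          using over[OF u] by (auto simp: n_def)
        obtain y where y: "r = proj y" "\<exists>j\<le>m. y j \<noteq> 0" using r(1) by (rule pspaceE) blast
        have \<beta>u: "\<beta> (proj u) \<in> pts Q" using morphism_in[OF mor\<beta> u] .
        then obtain v where v: "\<beta> (proj u) = proj v" "\<exists>i\<le>n. v i \<noteq> 0"
          using Q pspaceE[of "\<beta> (proj u)" n] by (metis n_def subsetD)
        have vQ: "proj v \<in> pts Q" using \<beta>u v by simp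
        have "proj (tensor n m v y) = proj (cut N (\<lambda>k. \<eta> k u))"
          using r(2) hu by (simp add: y v segre_proj)
        then obtain s where s: "s \<noteq> 0" "cut N (\<lambda>k. \<eta> k u) = (\<lambda>k. s * tensor n m v y k)"
          by (auto simp: proj_eq_iff)
        have nz: "f i0 v \<noteq> 0" "\<chi> j0 (tensor n m v y) \<noteq> 0"
          using False \<theta>_tensor[OF s(2)] by auto
        have "proj (\<lambda>k. s * tensor n m v y k) \<in> pts G"
          using morphism_in[OF morh[folded G_def] u] hu s by simp
        from graph_eq[OF this s(1) v(2) y(2)] have ge: "y j * f i0 v = y i0 * f j v" if "j \<le> m" for j
          using v0(2) that by blast
        have yi0: "y i0 \<noteq> 0"
        proof
          assume "y i0 = 0"
          then have "\<forall>j\<le>m. y j = 0" using ge nz by auto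
          then show False using y by auto
        qed
        define t where "t = y i0 / f i0 v"
        have "t \<noteq> 0" using yi0 nz by (simp add: t_def)
        have "tensor n m v y = tensor n m (\<lambda>i. 1 * v i) (\<lambda>j. t * f j v)"
          by (rule tensor_cong) (use ge nz in \<open>auto simp: t_def field_simps\<close>)
        also have "\<dots> = (\<lambda>k. t * g v k)" by (simp only: tensor_scale g_def) simp
        finally have ty: "tensor n m v y = (\<lambda>k. t * g v k)" .
        then have \<chi>g: "\<chi> j0 (g v) \<noteq> 0"
          using nz form_fun_scale[OF \<chi>(1)[OF j0(1)], of t "g v"] by auto
        have "h (proj u) = proj (g v)"
          using hu s \<open>t \<noteq> 0\<close> by (simp add: ty proj_scale)
        then have "proj (cut (amb B) (\<lambda>j. \<phi> j v)) = proj u"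
          using h'h[OF u] \<phi>_h'[OF vQ nz(1)] \<chi>g j0 by auto
        then obtain c where c: "u = (\<lambda>i. c * cut (amb B) (\<lambda>j. \<phi> j v) i)" by (auto simp: proj_eq_iff)
        have "\<psi> u = c ^ b * \<psi> (\<lambda>j. \<phi> j v)"
          by (subst c) (simp add: form_fun_scale[OF \<psi>] form_fun_cut[OF \<psi>])
        moreover have "\<psi> (\<lambda>j. \<phi> j v) = 0" using van vQ nz j0 \<chi>g by (auto simp: \<phi>_def)
        ultimately show ?thesis by simp
      qed simp
    qed
  qed
  then show ?thesis by (auto simp: n_def)
qed

section \<open>Rational functions on projective space\<close>

text \<open>Quotients of forms of equal degree whose denominators do not vanish on \<open>ok\<close>. With a fixed domain \<open>ok\<close>, sums
  and products are again of this kind, so that explicit formulas are rational functions term by term.\<close>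

definition ratfuns :: "'a::field set \<Rightarrow> nat \<Rightarrow> ((nat \<Rightarrow> 'a) \<Rightarrow> bool) \<Rightarrow> ((nat \<Rightarrow> 'a) \<Rightarrow> 'a) set" where
  "ratfuns K n ok = {g. \<exists>d N D. form_fun K n d N \<and> form_fun K n d D \<and>
     (\<forall>v. ok v \<longrightarrow> D v \<noteq> 0 \<and> g v = N v / D v)}"

lemma ratfunsE:
  assumes "g \<in> ratfuns K n ok"
  obtains d N D where "form_fun K n d N" "form_fun K n d D" "\<And>v. ok v \<Longrightarrow> D v \<noteq> 0"
    "\<And>v. ok v \<Longrightarrow> g v = N v / D v"
  using assms unfolding ratfuns_def by blast

lemma function_algebra_ratfuns:
  assumes K: "coeff_ring K"
  shows "function_algebra K (ratfuns K n ok)"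
  unfolding function_algebra_def
proof (intro conjI ballI)
  fix c assume "c \<in> K"
  moreover have "1 \<in> K" using K by (simp add: coeff_ring_def)
  ultimately show "(\<lambda>_. c) \<in> ratfuns K n ok"
    unfolding ratfuns_def
    by (intro CollectI exI[of _ 0] exI[of _ "\<lambda>_. c"] exI[of _ "\<lambda>_. 1"]) (auto intro: form_fun_const)
next
  fix f g assume f: "f \<in> ratfuns K n ok" and g: "g \<in> ratfuns K n ok"
  from f obtain d N D where 1: "form_fun K n d N" "form_fun K n d D" "\<And>v. ok v \<Longrightarrow> D v \<noteq> 0"
    "\<And>v. ok v \<Longrightarrow> f v = N v / D v" by (rule ratfunsE) (rule that)
  from g obtain e M E where 2: "form_fun K n e M" "form_fun K n e E" "\<And>v. ok v \<Longrightarrow> E v \<noteq> 0"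
    "\<And>v. ok v \<Longrightarrow> g v = M v / E v" by (rule ratfunsE) (rule that)
  have "form_fun K n (d + e) (\<lambda>v. N v * E v + D v * M v)" "form_fun K n (d + e) (\<lambda>v. D v * E v)"
    "form_fun K n (d + e) (\<lambda>v. N v * M v)"
    using 1 2 by (auto intro!: form_fun_add form_fun_mult K)
  moreover have "f v + g v = (N v * E v + D v * M v) / (D v * E v)" "D v * E v \<noteq> 0"
    "f v * g v = (N v * M v) / (D v * E v)" if "ok v" for v
    using 1(3,4)[OF that] 2(3,4)[OF that] by (auto simp: field_simps)
  ultimately show "(\<lambda>v. f v + g v) \<in> ratfuns K n ok" "(\<lambda>v. f v * g v) \<in> ratfuns K n ok"
    unfolding ratfuns_def by blast+
qed

lemma ratfuns_inverse:
  assumes "g \<in> ratfuns K n ok" "\<And>v. ok v \<Longrightarrow> g v \<noteq> 0"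
  shows "(\<lambda>v. inverse (g v)) \<in> ratfuns K n ok"
proof -
  from assms(1) obtain d N D where 1: "form_fun K n d N" "form_fun K n d D" "\<And>v. ok v \<Longrightarrow> D v \<noteq> 0"
    "\<And>v. ok v \<Longrightarrow> g v = N v / D v" by (rule ratfunsE) (rule that)
  have "N v \<noteq> 0 \<and> inverse (g v) = D v / N v" if "ok v" for v
    using 1(3,4)[OF that] assms(2)[OF that] by auto
  then show ?thesis unfolding ratfuns_def using 1(1,2) by blast
qed

lemma ratfuns_coord:
  assumes "coeff_ring K" "i \<le> n" "j \<le> n" "\<And>v. ok v \<Longrightarrow> v j \<noteq> 0"
  shows "(\<lambda>v. v i / v j) \<in> ratfuns K n ok"
  unfolding ratfuns_def using assms form_fun_coord by blast

text \<open>Finitely many rational functions, seen as homogeneous coordinates, become a tuple of forms.\<close>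

lemma ratfuns_common_denominator:
  fixes m :: nat
  assumes K: "coeff_ring K" and g: "\<And>i. i \<le> m \<Longrightarrow> g i \<in> ratfuns K n ok"
  obtains d N D where "\<And>i. i \<le> m \<Longrightarrow> form_fun K n d (N i)" "form_fun K n d D"
    "\<And>v. ok v \<Longrightarrow> D v \<noteq> 0" "\<And>i v. i \<le> m \<Longrightarrow> ok v \<Longrightarrow> g i v = N i v / D v"
proof -
  have "\<forall>i\<in>{..m}. \<exists>d N D. form_fun K n d N \<and> form_fun K n d D \<and>
     (\<forall>v. ok v \<longrightarrow> D v \<noteq> 0 \<and> g i v = N v / D v)"
    using g by (auto simp: ratfuns_def)
  then obtain d N D where "\<forall>i\<in>{..m}. form_fun K n (d i) (N i) \<and> form_fun K n (d i) (D i) \<and>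
     (\<forall>v. ok v \<longrightarrow> D i v \<noteq> 0 \<and> g i v = N i v / D i v)"
    unfolding bchoice_iff by blast
  then have *: "form_fun K n (d i) (N i) \<and> form_fun K n (d i) (D i) \<and>
     (\<forall>v. ok v \<longrightarrow> D i v \<noteq> 0 \<and> g i v = N i v / D i v)" if "i \<le> m" for i
    using that by blast
  show ?thesis
  proof (rule that[of "\<Sum>i\<le>m. d i" "\<lambda>i v. N i v * (\<Prod>k\<in>{..m} - {i}. D k v)" "\<lambda>v. \<Prod>k\<le>m. D k v"])
    show "form_fun K n (\<Sum>i\<le>m. d i) (\<lambda>v. N i v * (\<Prod>k\<in>{..m} - {i}. D k v))" if "i \<le> m" for i
    proof -
      have "form_fun K n (d i + (\<Sum>k\<in>{..m} - {i}. d k)) (\<lambda>v. N i v * (\<Prod>k\<in>{..m} - {i}. D k v))"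
        using * that by (intro form_fun_mult form_fun_prod K) auto
      then show ?thesis using that by (simp add: sum.remove[of "{..m}" i])
    qed
    show "form_fun K n (\<Sum>i\<le>m. d i) (\<lambda>v. \<Prod>k\<le>m. D k v)"
      using * by (intro form_fun_prod K) auto
    show "(\<Prod>k\<le>m. D k v) \<noteq> 0" if "ok v" for v using * that by auto
    show "g i v = N i v * (\<Prod>k\<in>{..m} - {i}. D k v) / (\<Prod>k\<le>m. D k v)" if "i \<le> m" "ok v" for i v
    proof -
      have "(\<Prod>k\<le>m. D k v) = D i v * (\<Prod>k\<in>{..m} - {i}. D k v)"
        using that by (simp add: prod.remove[of "{..m}" i])
      moreover have "(\<Prod>k\<in>{..m} - {i}. D k v) \<noteq> 0" using * that by auto
      ultimately show ?thesis using * that by auto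
    qed
  qed
qed

section \<open>The surface \<open>E \<times> E\<close> and its quotient by negation\<close>

definition cubic :: "'a::field \<Rightarrow> 'a \<Rightarrow> 'a" where
  "cubic t x = (x - 1) * (x^2 - 1 / (t + 1))"

definition vec3 :: "'a::zero \<Rightarrow> 'a \<Rightarrow> 'a \<Rightarrow> nat \<Rightarrow> 'a" where
  "vec3 x y w = (\<lambda>i. if i \<le> 2 then [x, y, w] ! i else 0)"

definition EE_vec :: "'a::field \<Rightarrow> 'a \<Rightarrow> 'a \<Rightarrow> 'a \<Rightarrow> nat \<Rightarrow> 'a" where
  "EE_vec x1 y1 x2 y2 = tensor 2 2 (vec3 x1 y1 1) (vec3 x2 y2 1)"

lemma vec3_simps [simp]:
  "vec3 x y w 0 = x" "vec3 x y w 1 = y" "vec3 x y w (Suc 0) = y" "vec3 x y w 2 = w" "i > 2 \<Longrightarrow> vec3 x y w i = 0"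
  by (auto simp: vec3_def)

lemma EE_vec_simps [simp]:
  "EE_vec x1 y1 x2 y2 2 = x1" "EE_vec x1 y1 x2 y2 5 = y1" "EE_vec x1 y1 x2 y2 6 = x2"
  "EE_vec x1 y1 x2 y2 7 = y2" "EE_vec x1 y1 x2 y2 8 = 1"
  by (simp_all add: EE_vec_def tensor_def)

lemma pts_E_curve: "pts (E_curve t) = {proj (vec3 x y w) | x y w.
    (x, y, w) \<noteq> (0, 0, 0) \<and> y^2 * w = (x - w) * (x^2 - 1 / (t + 1) * w^2)}"
  by (simp add: E_curve_def vec3_def)

lemma amb_EE [simp]: "amb (EE t) = 8"
  by (simp add: EE_def pprod_def E_curve_def)

lemma pts_EE: "pts (EE t) = {segre 2 2 p q | p q. p \<in> pts (E_curve t) \<and> q \<in> pts (E_curve t)}"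
  by (simp add: EE_def pprod_def E_curve_def)

lemma affine_in_E: "y^2 = cubic t x \<Longrightarrow> proj (vec3 x y 1) \<in> pts (E_curve t)"
  unfolding pts_E_curve by (intro CollectI exI[of _ x] exI[of _ y] exI[of _ 1]) (simp add: cubic_def)

lemma affine_in_EE:
  assumes "y1^2 = cubic t x1" "y2^2 = cubic t x2"
  shows "proj (EE_vec x1 y1 x2 y2) \<in> pts (EE t)"
  unfolding pts_EE EE_vec_def using assms by (auto simp: segre_proj[symmetric] intro: affine_in_E)

lemma E_curve_vec:
  assumes "p \<in> pts (E_curve t)"
  obtains x y w where "p = proj (vec3 x y w)" "(x, y, w) \<noteq> (0, 0, 0)"
    "w \<noteq> 0 \<Longrightarrow> (y / w)^2 = cubic t (x / w)"
proof -
  from assms obtain x y w where p: "p = proj (vec3 x y w)" "(x, y, w) \<noteq> (0, 0, 0)"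
    and e: "y^2 * w = (x - w) * (x^2 - 1 / (t + 1) * w^2)" by (auto simp: pts_E_curve)
  have "(y / w)^2 = cubic t (x / w)" if w: "w \<noteq> 0"
  proof -
    have "(y / w)^2 = y^2 * w / w^3" using w by (simp add: power2_eq_square power3_eq_cube field_simps)
    also have "\<dots> = ((x - w) / w) * ((x^2 - 1 / (t + 1) * w^2) / w^2)"
      unfolding e using w by (simp add: power2_eq_square power3_eq_cube)
    also have "\<dots> = cubic t (x / w)" using w by (simp add: cubic_def diff_divide_distrib power_divide)
    finally show ?thesis .
  qed
  then show ?thesis using p that by blast
qed

text \<open>The Segre coordinate with index 8 is the product of the last coordinates of the two factors, so it is nonzero
  exactly when both points are affine.\<close>

lemma EE_affine_part:
  assumes "proj v \<in> pts (EE t)" "v 8 \<noteq> 0"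
  obtains s x1 y1 x2 y2 where "s \<noteq> 0" "v = (\<lambda>k. s * EE_vec x1 y1 x2 y2 k)"
    "y1^2 = cubic t x1" "y2^2 = cubic t x2"
proof -
  from assms(1) obtain p q where pq: "proj v = segre 2 2 p q" "p \<in> pts (E_curve t)" "q \<in> pts (E_curve t)"
    by (auto simp: pts_EE)
  obtain x y w where p: "p = proj (vec3 x y w)" "w \<noteq> 0 \<Longrightarrow> (y / w)^2 = cubic t (x / w)"
    using pq(2) by (rule E_curve_vec) blast
  obtain x' y' w' where q: "q = proj (vec3 x' y' w')" "w' \<noteq> 0 \<Longrightarrow> (y' / w')^2 = cubic t (x' / w')"
    using pq(3) by (rule E_curve_vec) blast
  have "proj (tensor 2 2 (vec3 x y w) (vec3 x' y' w')) = proj v"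
    using pq(1) by (simp add: p q segre_proj)
  then obtain c where c: "c \<noteq> 0" "v = (\<lambda>k. c * tensor 2 2 (vec3 x y w) (vec3 x' y' w') k)"
    by (auto simp: proj_eq_iff)
  have w: "w \<noteq> 0" "w' \<noteq> 0" using assms(2) by (auto simp: c(2) tensor_def)
  have "vec3 x y w = (\<lambda>i. w * vec3 (x / w) (y / w) 1 i)"
    and "vec3 x' y' w' = (\<lambda>i. w' * vec3 (x' / w') (y' / w') 1 i)"
    using w by (auto simp: vec3_def fun_eq_iff nth_Cons split: nat.splits)
  then have "v = (\<lambda>k. c * (w * w') * EE_vec (x / w) (y / w) (x' / w') (y' / w') k)"
    unfolding c(2) EE_vec_def by (simp only: tensor_scale mult.assoc)
  moreover have "c * (w * w') \<noteq> 0" using c w by simp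
  ultimately show ?thesis using that p(2)[OF w(1)] q(2)[OF w(2)] by blast
qed

text \<open>Comparing Segre coordinates with those in which one factor is taken at index 2, where the affine
  representatives are 1, recovers both factors.\<close>

lemma affine_tensor_unique:
  assumes "proj (EE_vec x1 y1 x2 y2) = segre 2 2 p q" "p \<in> pts (E_curve t)" "q \<in> pts (E_curve t)"
  shows "p = proj (vec3 x1 y1 1)" "q = proj (vec3 x2 y2 1)"
proof -
  obtain x y w where p: "p = proj (vec3 x y w)" using assms(2) by (rule E_curve_vec) blast
  obtain x' y' w' where q: "q = proj (vec3 x' y' w')" using assms(3) by (rule E_curve_vec) blast
  have "proj (EE_vec x1 y1 x2 y2) = proj (tensor 2 2 (vec3 x y w) (vec3 x' y' w'))"
    using assms(1) by (simp add: p q segre_proj)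
  then obtain c where c: "c \<noteq> 0"
    "tensor 2 2 (vec3 x y w) (vec3 x' y' w') = (\<lambda>k. c * tensor 2 2 (vec3 x1 y1 1) (vec3 x2 y2 1) k)"
    by (auto simp: proj_eq_iff EE_vec_def)
  have e: "vec3 x y w i * vec3 x' y' w' j = c * (vec3 x1 y1 1 i * vec3 x2 y2 1 j)"
    if "i \<le> 2" "j \<le> 2" for i j
    using fun_cong[OF c(2), of "i * (2 + 1) + j"] unfolding tensor_index[OF that] .
  have ww: "w * w' = c" using e[of 2 2] by simp
  then have w: "w \<noteq> 0" "w' \<noteq> 0" using c by auto
  have "x * w' = w * w' * x1" "y * w' = w * w' * y1" "w * x' = w * w' * x2" "w * y' = w * w' * y2"
    using e[of 0 2] e[of 1 2] e[of 2 0] e[of 2 1] by (simp_all add: ww)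
  then have "x = w * x1" "y = w * y1" "x' = w' * x2" "y' = w' * y2" using w by auto
  then have "vec3 x y w = (\<lambda>i. w * vec3 x1 y1 1 i)" "vec3 x' y' w' = (\<lambda>i. w' * vec3 x2 y2 1 i)"
    by (auto simp: vec3_def fun_eq_iff nth_Cons split: nat.splits)
  then show "p = proj (vec3 x1 y1 1)" "q = proj (vec3 x2 y2 1)"
    using w by (simp_all add: p q proj_scale)
qed

lemma E_neg_affine: "E_neg (proj (vec3 x y 1)) = proj (vec3 x (- y) 1)"
proof -
  obtain c where c: "c \<noteq> 0" "rep (proj (vec3 x y 1)) = (\<lambda>i. c * vec3 x y 1 i)" by (rule rep_proj)
  have "(rep (proj (vec3 x y 1)))(1 := - rep (proj (vec3 x y 1)) 1) = (\<lambda>i. c * vec3 x (- y) 1 i)"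
    unfolding c(2) by (auto simp: fun_eq_iff vec3_def nth_Cons split: nat.splits)
  then show ?thesis using c by (simp add: E_neg_def proj_scale)
qed

lemma EE_neg_affine:
  assumes "y1^2 = cubic t x1" "y2^2 = cubic t x2"
  shows "EE_neg t (proj (EE_vec x1 y1 x2 y2)) = proj (EE_vec x1 (- y1) x2 (- y2))"
proof -
  have amb: "amb (E_curve t) = 2" by (simp add: E_curve_def)
  show ?thesis
    unfolding EE_neg_def pprod_map_def amb
  proof (rule the_equality)
    show "\<exists>p\<in>pts (E_curve t). \<exists>q\<in>pts (E_curve t).
       proj (EE_vec x1 y1 x2 y2) = segre 2 2 p q \<and>
       proj (EE_vec x1 (- y1) x2 (- y2)) = segre 2 2 (E_neg p) (E_neg q)"
      by (intro bexI[OF _ affine_in_E[OF assms(1)]] bexI[OF _ affine_in_E[OF assms(2)]])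
         (simp add: E_neg_affine segre_proj EE_vec_def)
  next
    fix s assume "\<exists>p\<in>pts (E_curve t). \<exists>q\<in>pts (E_curve t).
       proj (EE_vec x1 y1 x2 y2) = segre 2 2 p q \<and> s = segre 2 2 (E_neg p) (E_neg q)"
    then obtain p q where pq: "p \<in> pts (E_curve t)" "q \<in> pts (E_curve t)"
      "proj (EE_vec x1 y1 x2 y2) = segre 2 2 p q" and s: "s = segre 2 2 (E_neg p) (E_neg q)" by blast
    show "s = proj (EE_vec x1 (- y1) x2 (- y2))"
      unfolding s affine_tensor_unique[OF pq(3,1,2)] E_neg_affine segre_proj EE_vec_def ..
  qed
qed

text \<open>Coordinates of the surface \<open>w^2 = cubic x1 * cubic x2\<close>, a birational model of the quotient by negation
  with \<open>w = y1 * y2\<close>.\<close>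

abbreviation triple_coords :: "('a \<times> 'a \<times> 'a \<Rightarrow> 'a) set" where
  "triple_coords \<equiv> {\<lambda>(x1, x2, w). x1, \<lambda>(x1, x2, w). x2, \<lambda>(x1, x2, w). w}"

text \<open>The empty set is open in the quotient, hence its preimage is open in \<open>A\<close>, which says that \<open>A\<close> is closed.\<close>

lemma involution_quotient_closed:
  assumes "involution_quotient K A \<iota> Q q" shows "zclosed (amb A) (pts A)"
proof -
  have "zopen_in Q {}" using assms by (auto simp: involution_quotient_def variety_def zopen_in_def)
  then have "zopen_in A {}" using assms unfolding involution_quotient_def by force
  then show ?thesis by (simp add: zopen_in_def)
qed

text \<open>The points of \<open>E \<times> E\<close> that are at infinity or satisfy \<open>g = 0\<close> form a closed set \<open>B\<close> that is stable under
  negation, so its image is closed in the quotient. As the image is not everything and the quotient is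
  irreducible, a form that vanishes off the image of \<open>B\<close> vanishes.\<close>

lemma quotient_density:
  assumes quot: "involution_quotient K (EE t) (EE_neg t) Q q"
    and g: "g \<in> polyfuns UNIV triple_coords"
    and ex: "b1^2 = cubic t a1" "b2^2 = cubic t a2" "g (a1, a2, b1 * b2) \<noteq> 0"
    and \<psi>: "form_fun UNIV (amb Q) e \<psi>"
    and van: "\<And>x1 y1 x2 y2 u. y1^2 = cubic t x1 \<Longrightarrow> y2^2 = cubic t x2 \<Longrightarrow> g (x1, x2, y1 * y2) \<noteq> 0 \<Longrightarrow>
      q (proj (EE_vec x1 y1 x2 y2)) = proj u \<Longrightarrow> \<psi> u = 0"
    and u: "proj u \<in> pts Q"
  shows "\<psi> u = 0"
proof -
  let ?A = "pts (EE t)"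
  from quot have vQ: "variety K Q" and mor: "morphism K (EE t) Q q" and surj: "q ` ?A = pts Q"
    and fib: "\<forall>a\<in>?A. \<forall>b\<in>?A. q a = q b \<longleftrightarrow> b = a \<or> b = EE_neg t a"
    and top: "\<And>U. U \<subseteq> pts Q \<Longrightarrow> zopen_in Q U \<longleftrightarrow> zopen_in (EE t) (?A \<inter> q -` U)"
    by (auto simp: involution_quotient_def)
  note Q = varietyD[OF vQ]
  have closedA: "zclosed 8 ?A"
    using involution_quotient_closed[OF quot] by simp
  have A_sub: "?A \<subseteq> pspace 8" by (rule zclosed_subset[OF closedA])
  \<comment> \<open>In Segre coordinates, \<open>x1\<close>, \<open>y1\<close>, \<open>x2\<close>, \<open>y2\<close>, \<open>1\<close> have the indices 2, 5, 6, 7, 8.\<close>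
  let ?h = "\<lambda>v. (v 2 / v 8, v 6 / v 8, v 5 / v 8 * (v 7 / v 8))"
  have "(\<lambda>v. g (?h v)) \<in> ratfuns UNIV 8 (\<lambda>v. v 8 \<noteq> 0)"
    using g function_algebra_ratfuns[OF coeff_ring_UNIV]
  proof (rule polyfuns_subst)
    fix b :: "'a \<times> 'a \<times> 'a \<Rightarrow> 'a" assume b: "b \<in> triple_coords"
    have c: "(\<lambda>v. v i / v 8) \<in> ratfuns (UNIV :: 'a set) 8 (\<lambda>v. v 8 \<noteq> 0)" if "i \<le> 8" for i
      using that by (intro ratfuns_coord) auto
    from b show "(\<lambda>v. b (?h v)) \<in> ratfuns UNIV 8 (\<lambda>v. v 8 \<noteq> 0)"
      using c[of 2] c[of 6] function_algebraD(3)[OF function_algebra_ratfuns[OF coeff_ring_UNIV] c[of 5] c[of 7]]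
      by auto
  qed
  then obtain d N D where ND: "form_fun UNIV 8 d N" "form_fun UNIV 8 d D" "\<And>v. v 8 \<noteq> 0 \<Longrightarrow> D v \<noteq> 0"
    "\<And>v. v 8 \<noteq> 0 \<Longrightarrow> g (?h v) = N v / D v" by (rule ratfunsE) (rule that)
  define \<beta> where "\<beta> v = v 8 * N v" for v
  have \<beta>: "form_fun UNIV 8 (1 + d) \<beta>"
    unfolding \<beta>_def by (intro form_fun_mult form_fun_coord coeff_ring_UNIV ND) simp
  have \<beta>_affine: "\<beta> (EE_vec x1 y1 x2 y2) = 0 \<longleftrightarrow> g (x1, x2, y1 * y2) = 0" for x1 y1 x2 y2
    using ND(3,4)[of "EE_vec x1 y1 x2 y2"] by (auto simp: \<beta>_def)
  have \<beta>_scale: "\<beta> v = 0 \<longleftrightarrow> \<beta> v' = 0" if "proj v = proj v'" for v v'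
    using that form_fun_scale[OF \<beta>] by (auto simp: proj_eq_iff)
  define B where "B = {p \<in> ?A. \<forall>x. p = proj x \<longrightarrow> \<beta> x = 0}"
  have B_iff: "proj v \<in> B \<longleftrightarrow> proj v \<in> ?A \<and> \<beta> v = 0" for v
    unfolding B_def using \<beta>_scale by blast
  have closedB: "zclosed 8 B" unfolding B_def by (rule zclosed_zeros[OF \<beta> closedA])
  have good: "\<exists>x1 y1 x2 y2. a = proj (EE_vec x1 y1 x2 y2) \<and> y1^2 = cubic t x1 \<and> y2^2 = cubic t x2 \<and>
      g (x1, x2, y1 * y2) \<noteq> 0" if a: "a \<in> ?A" "a \<notin> B" for a
  proof -
    obtain v where v: "a = proj v" using A_sub a pspaceE by blast
    then have nz: "\<beta> v \<noteq> 0" using a B_iff by blast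
    then have "v 8 \<noteq> 0" by (auto simp: \<beta>_def)
    with a v obtain s x1 y1 x2 y2 where s: "s \<noteq> 0" "v = (\<lambda>k. s * EE_vec x1 y1 x2 y2 k)"
      "y1^2 = cubic t x1" "y2^2 = cubic t x2"
      using EE_affine_part by blast
    then have "a = proj (EE_vec x1 y1 x2 y2)" by (simp add: v proj_scale)
    moreover have "g (x1, x2, y1 * y2) \<noteq> 0"
      using nz \<beta>_scale[of v "EE_vec x1 y1 x2 y2"] calculation v \<beta>_affine by metis
    ultimately show ?thesis using s by blast
  qed
  have sat: "b \<notin> B" if a: "a \<in> ?A" "a \<notin> B" and b: "b \<in> ?A" "q a = q b" for a b
  proof -
    from good[OF a] obtain x1 y1 x2 y2 where *: "a = proj (EE_vec x1 y1 x2 y2)"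
      "y1^2 = cubic t x1" "y2^2 = cubic t x2" "g (x1, x2, y1 * y2) \<noteq> 0" by blast
    have "b = a \<or> b = EE_neg t a" using fib a b by blast
    then show ?thesis
      using a * EE_neg_affine[OF *(2,3)] \<beta>_affine[of x1 "- y1" x2 "- y2"] by (auto simp: B_iff)
  qed
  define Z where "Z = q ` B"
  have BA: "B \<subseteq> ?A" by (auto simp: B_def)
  have "?A \<inter> q -` (pts Q - Z) = ?A - B"
  proof (intro equalityI subsetI)
    fix a assume "a \<in> ?A \<inter> q -` (pts Q - Z)"
    then show "a \<in> ?A - B" by (auto simp: Z_def)
  next
    fix a assume a: "a \<in> ?A - B"
    then have "q a \<notin> Z" unfolding Z_def using sat[of a] BA by blast
    then show "a \<in> ?A \<inter> q -` (pts Q - Z)" using a morphism_in[OF mor] by blast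
  qed
  moreover have "zopen_in (EE t) (?A - B)"
  proof -
    have "?A - (?A - B) = B" using BA by blast
    then show ?thesis using closedB by (auto simp: zopen_in_def)
  qed
  ultimately have "zopen_in Q (pts Q - Z)" using top[of "pts Q - Z"] by auto
  moreover have "pts Q - (pts Q - Z) = Z" using morphism_in[OF mor] BA unfolding Z_def by blast
  ultimately have closedZ: "zclosed (amb Q) Z" by (simp add: zopen_in_def)
  define Y where "Y = {p \<in> pts Q. \<forall>x. p = proj x \<longrightarrow> \<psi> x = 0}"
  have closedY: "zclosed (amb Q) Y" unfolding Y_def by (rule zclosed_zeros[OF \<psi> Q(1)])
  have "pts Q \<subseteq> Z \<union> Y"
  proof
    fix p assume p: "p \<in> pts Q"
    then obtain a where a: "a \<in> ?A" "p = q a" using surj by blast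
    show "p \<in> Z \<union> Y"
    proof (cases "a \<in> B")
      case False
      from good[OF a(1) False] van have "p \<in> Y" using a p unfolding Y_def by blast
      then show ?thesis by simp
    qed (use a in \<open>auto simp: Z_def\<close>)
  qed
  then have "pts Q \<subseteq> Z \<or> pts Q \<subseteq> Y"
    using Q(3) closedZ closedY unfolding zirreducible_def by blast
  moreover have "\<not> pts Q \<subseteq> Z"
  proof
    let ?a = "proj (EE_vec a1 b1 a2 b2)"
    have a: "?a \<in> ?A" using ex affine_in_EE by blast
    have a': "?a \<notin> B" using ex(3) \<beta>_affine unfolding B_iff by blast
    assume "pts Q \<subseteq> Z"
    then have "q ?a \<in> Z" using morphism_in[OF mor a] by blast
    then obtain b where "b \<in> B" "q ?a = q b" by (auto simp: Z_def)
    then show False using sat[OF a a'] BA by blast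
  qed
  ultimately show ?thesis using u by (auto simp: Y_def)
qed

text \<open>As \<open>y1^2\<close> and \<open>y2^2\<close> are polynomials in \<open>x1\<close> and \<open>x2\<close>, a polynomial function on the affine part of \<open>E \<times> E\<close>
  is linear in each of \<open>y1\<close> and \<open>y2\<close>; negation changes the sign of the terms \<open>B\<close> and \<open>C\<close>.\<close>

abbreviation pair_coords :: "('a \<times> 'a \<Rightarrow> 'a) set" where "pair_coords \<equiv> {fst, snd}"

definition parity_split :: "'a::field set \<Rightarrow> 'a \<Rightarrow> ('a \<times> 'a \<times> 'a \<times> 'a \<Rightarrow> 'a) \<Rightarrow>
    ('a \<times> 'a \<Rightarrow> 'a) \<Rightarrow> ('a \<times> 'a \<Rightarrow> 'a) \<Rightarrow> ('a \<times> 'a \<Rightarrow> 'a) \<Rightarrow> ('a \<times> 'a \<Rightarrow> 'a) \<Rightarrow> bool" where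
  "parity_split K t f A B C D \<longleftrightarrow>
     A \<in> polyfuns K pair_coords \<and> B \<in> polyfuns K pair_coords \<and>
     C \<in> polyfuns K pair_coords \<and> D \<in> polyfuns K pair_coords \<and>
     (\<forall>x1 y1 x2 y2. y1^2 = cubic t x1 \<longrightarrow> y2^2 = cubic t x2 \<longrightarrow>
       f (x1, y1, x2, y2) = A (x1, x2) + B (x1, x2) * y1 + C (x1, x2) * y2 + D (x1, x2) * (y1 * y2))"

lemma cubic_polyfun:
  assumes K: "coeff_ring K" "1 / (t + 1) \<in> K" and x: "x \<in> polyfuns K S"
  shows "(\<lambda>v. cubic t (x v)) \<in> polyfuns K S"
  unfolding cubic_def power2_eq_square
  by (intro polyfuns.mult polyfuns_diff polyfuns.const K x) (use K(1) in \<open>auto simp: coeff_ring_def\<close>)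

lemma parity_split_algebra:
  assumes K: "coeff_ring K" "1 / (t + 1) \<in> K"
  shows "function_algebra K {f. \<exists>A B C D. parity_split K t f A B C D}"
  unfolding function_algebra_def
proof (intro conjI ballI)
  have 0: "0 \<in> K" using K(1) by (simp add: coeff_ring_def)
  fix c assume "c \<in> K"
  then have "parity_split K t (\<lambda>_. c) (\<lambda>_. c) (\<lambda>_. 0) (\<lambda>_. 0) (\<lambda>_. 0)"
    using 0 by (auto simp: parity_split_def intro: polyfuns.const)
  then show "(\<lambda>_. c) \<in> {f. \<exists>A B C D. parity_split K t f A B C D}" by blast
next
  fix f g assume "f \<in> {f. \<exists>A B C D. parity_split K t f A B C D}" "g \<in> {f. \<exists>A B C D. parity_split K t f A B C D}"
  then obtain A B C D A' B' C' D' where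
    f: "parity_split K t f A B C D" and g: "parity_split K t g A' B' C' D'" by blast
  have f1: "(\<lambda>v. cubic t (fst v)) \<in> polyfuns K pair_coords" "(\<lambda>v. cubic t (snd v)) \<in> polyfuns K pair_coords"
    by (rule cubic_polyfun[OF K polyfuns.base]; simp)+
  have "parity_split K t (\<lambda>v. f v + g v) (\<lambda>v. A v + A' v) (\<lambda>v. B v + B' v) (\<lambda>v. C v + C' v) (\<lambda>v. D v + D' v)"
    using f g by (auto simp: parity_split_def algebra_simps intro!: polyfuns.add)
  then show "(\<lambda>v. f v + g v) \<in> {f. \<exists>A B C D. parity_split K t f A B C D}" by blast
  let ?F = "\<lambda>v. cubic t (fst v)" and ?G = "\<lambda>v. cubic t (snd v)"
  have "parity_split K t (\<lambda>v. f v * g v)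
     (\<lambda>v. (A v * A' v + (B v * B' v) * ?F v) + ((C v * C' v) * ?G v + (D v * D' v) * (?F v * ?G v)))
     (\<lambda>v. (A v * B' v + B v * A' v) + (C v * D' v + D v * C' v) * ?G v)
     (\<lambda>v. (A v * C' v + C v * A' v) + (B v * D' v + D v * B' v) * ?F v)
     (\<lambda>v. (A v * D' v + D v * A' v) + (B v * C' v + C v * B' v))"
    unfolding parity_split_def
  proof (intro conjI allI impI)
    fix x1 y1 x2 y2 assume y: "y1^2 = cubic t x1" "y2^2 = cubic t x2"
    have id: "(a + b * y1 + c * y2 + d * (y1 * y2)) * (a' + b' * y1 + c' * y2 + d' * (y1 * y2)) =
      ((a * a' + (b * b') * F) + ((c * c') * G + (d * d') * (F * G)))
      + ((a * b' + b * a') + (c * d' + d * c') * G) * y1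
      + ((a * c' + c * a') + (b * d' + d * b') * F) * y2
      + ((a * d' + d * a') + (b * c' + c * b')) * (y1 * y2)"
      if "y1^2 = F" "y2^2 = G" for a b c d a' b' c' d' F G :: 'a
      unfolding that[symmetric] by (simp add: power2_eq_square algebra_simps)
    show "f (x1, y1, x2, y2) * g (x1, y1, x2, y2) =
       (A (x1, x2) * A' (x1, x2) + (B (x1, x2) * B' (x1, x2)) * ?F (x1, x2)) +
         ((C (x1, x2) * C' (x1, x2)) * ?G (x1, x2) + (D (x1, x2) * D' (x1, x2)) * (?F (x1, x2) * ?G (x1, x2))) +
       ((A (x1, x2) * B' (x1, x2) + B (x1, x2) * A' (x1, x2)) +
         (C (x1, x2) * D' (x1, x2) + D (x1, x2) * C' (x1, x2)) * ?G (x1, x2)) * y1 +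
       ((A (x1, x2) * C' (x1, x2) + C (x1, x2) * A' (x1, x2)) +
         (B (x1, x2) * D' (x1, x2) + D (x1, x2) * B' (x1, x2)) * ?F (x1, x2)) * y2 +
       ((A (x1, x2) * D' (x1, x2) + D (x1, x2) * A' (x1, x2)) +
         (B (x1, x2) * C' (x1, x2) + C (x1, x2) * B' (x1, x2))) * (y1 * y2)"
      using f g y id[OF y] unfolding parity_split_def by simp
  qed (use f g in \<open>auto simp: parity_split_def intro!: polyfuns.add polyfuns.mult f1\<close>)
  then show "(\<lambda>v. f v * g v) \<in> {f. \<exists>A B C D. parity_split K t f A B C D}" by blast
qed

lemma parity_split_form:
  assumes K: "coeff_ring K" "1 / (t + 1) \<in> K" and T: "form_fun K 8 d T"
  shows "\<exists>A B C D. parity_split K t (\<lambda>(x1, y1, x2, y2). T (EE_vec x1 y1 x2 y2)) A B C D"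
proof -
  define S where "S = {f. \<exists>A B C D. parity_split K t f A B C D}"
  note alg = parity_split_algebra[OF K, folded S_def]
  have 01: "0 \<in> K" "1 \<in> K" using K(1) by (auto simp: coeff_ring_def)
  note c = polyfuns.const[OF 01(1)] polyfuns.const[OF 01(2)]
  have coords: "(\<lambda>(x1, y1, x2, y2). x1) \<in> S" "(\<lambda>(x1, y1, x2, y2). y1) \<in> S"
    "(\<lambda>(x1, y1, x2, y2). x2) \<in> S" "(\<lambda>(x1, y1, x2, y2). y2) \<in> S"
  proof -
    have "parity_split K t (\<lambda>(x1, y1, x2, y2). x1) fst (\<lambda>_. 0) (\<lambda>_. 0) (\<lambda>_. 0)"
      "parity_split K t (\<lambda>(x1, y1, x2, y2). y1) (\<lambda>_. 0) (\<lambda>_. 1) (\<lambda>_. 0) (\<lambda>_. 0)"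
      "parity_split K t (\<lambda>(x1, y1, x2, y2). x2) snd (\<lambda>_. 0) (\<lambda>_. 0) (\<lambda>_. 0)"
      "parity_split K t (\<lambda>(x1, y1, x2, y2). y2) (\<lambda>_. 0) (\<lambda>_. 0) (\<lambda>_. 1) (\<lambda>_. 0)"
      by (auto simp: parity_split_def intro: polyfuns.base c)
    then show "(\<lambda>(x1, y1, x2, y2). x1) \<in> S" "(\<lambda>(x1, y1, x2, y2). y1) \<in> S"
      "(\<lambda>(x1, y1, x2, y2). x2) \<in> S" "(\<lambda>(x1, y1, x2, y2). y2) \<in> S" unfolding S_def by blast+
  qed
  have v1: "(\<lambda>(x1, y1, x2, y2). vec3 x1 y1 1 i) \<in> S" if "i \<le> 2" for i :: nat
  proof -
    have "i = 0 \<or> i = 1 \<or> i = 2" using that by auto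
    then show ?thesis using coords function_algebraD(1)[OF alg 01(2)] by (auto simp: case_prod_unfold)
  qed
  have v2: "(\<lambda>(x1, y1, x2, y2). vec3 x2 y2 1 i) \<in> S" if "i \<le> 2" for i :: nat
  proof -
    have "i = 0 \<or> i = 1 \<or> i = 2" using that by auto
    then show ?thesis using coords function_algebraD(1)[OF alg 01(2)] by (auto simp: case_prod_unfold)
  qed
  have EEc: "(\<lambda>(x1, y1, x2, y2). EE_vec x1 y1 x2 y2 k) \<in> S" if "k \<le> 8" for k
  proof -
    have "k div 3 < 3" using that by (intro less_mult_imp_div_less) simp
    then have "k div 3 \<le> 2" "k mod 3 \<le> 2" by (auto simp: less_Suc_eq_le[symmetric])
    from function_algebraD(3)[OF alg v1[OF this(1)] v2[OF this(2)]] show ?thesis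
      using that by (simp add: EE_vec_def tensor_def case_prod_unfold)
  qed
  from T obtain F where F: "F \<in> forms K 8 d" "T = meval F" by (auto simp: form_fun_def)
  have "(\<lambda>v. meval F (\<lambda>k. case v of (x1, y1, x2, y2) \<Rightarrow> EE_vec x1 y1 x2 y2 k)) \<in> S"
    by (rule function_algebra_meval[OF K(1) alg F(1) EEc])
  then show ?thesis by (simp add: F S_def case_prod_unfold)
qed

lemma polyfuns_on_triples:
  assumes "A \<in> polyfuns K pair_coords"
  shows "(\<lambda>(x1, x2, w). A (x1, x2)) \<in> polyfuns K triple_coords"
proof -
  have "(\<lambda>v. A ((\<lambda>(x1, x2, w). (x1, x2)) v)) \<in> polyfuns K triple_coords"
    by (rule polyfuns_subst[OF assms function_algebra_polyfuns])
       (auto simp: case_prod_unfold intro: polyfuns.base)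
  then show ?thesis by (simp add: case_prod_unfold)
qed

text \<open>Let \<open>T\<close> be a chart of the quotient map at a given point \<open>a\<close>. The vectors \<open>T a\<close> and \<open>T (- a)\<close> represent the same
  point or vanish, so \<open>T a + T (- a)\<close> and \<open>y1 * (T a - T (- a))\<close> represent it too where they do not vanish.
  Both are invariant under negation, hence polynomials in \<open>x1\<close>, \<open>x2\<close> and \<open>y1 * y2\<close>. They do not both
  vanish at \<open>a\<close>, since \<open>T a \<noteq> 0\<close>, \<open>y1 \<noteq> 0\<close> there and the characteristic is not 2.\<close>

lemma quotient_chart:
  fixes t :: "'a::field"
  assumes K: "coeff_ring K" "1 / (t + 1) \<in> K" and two: "(2::'a) \<noteq> 0"
    and quot: "involution_quotient K (EE t) (EE_neg t) Q q"
    and pt: "b1^2 = cubic t a1" "b2^2 = cubic t a2" "b1 \<noteq> 0"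
  obtains R where "\<And>i. i \<le> amb Q \<Longrightarrow> R i \<in> polyfuns K triple_coords"
    "\<exists>i\<le>amb Q. R i (a1, a2, b1 * b2) \<noteq> 0"
    "\<And>x1 y1 x2 y2. y1^2 = cubic t x1 \<Longrightarrow> y2^2 = cubic t x2 \<Longrightarrow> \<exists>i\<le>amb Q. R i (x1, x2, y1 * y2) \<noteq> 0 \<Longrightarrow>
      q (proj (EE_vec x1 y1 x2 y2)) = proj (cut (amb Q) (\<lambda>i. R i (x1, x2, y1 * y2)))"
proof -
  let ?A = "pts (EE t)" and ?n = "amb Q"
  from quot have vQ: "variety K Q" and mor: "morphism K (EE t) Q q"
    and fib: "\<forall>a\<in>?A. \<forall>b\<in>?A. q a = q b \<longleftrightarrow> b = a \<or> b = EE_neg t a"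
    by (auto simp: involution_quotient_def)
  note Q = varietyD[OF vQ]
  have A_sub: "?A \<subseteq> pspace (amb (EE t))"
    by (rule zclosed_subset[OF involution_quotient_closed[OF quot]])
  from morphismE[OF mor affine_in_EE[OF pt(1,2)] A_sub] obtain d T where
    T: "\<And>i. i \<le> ?n \<Longrightarrow> form_fun K 8 d (T i)" "\<exists>i\<le>?n. T i (EE_vec a1 b1 a2 b2) \<noteq> 0"
    and qT: "\<And>u. proj u \<in> ?A \<Longrightarrow> \<exists>i\<le>?n. T i u \<noteq> 0 \<Longrightarrow> q (proj u) = proj (cut ?n (\<lambda>i. T i u))"
    unfolding amb_EE by blast
  have "\<forall>i\<in>{..?n}. \<exists>A B C D. parity_split K t (\<lambda>(x1, y1, x2, y2). T i (EE_vec x1 y1 x2 y2)) A B C D"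
    using parity_split_form[OF K T(1)] by auto
  then obtain A B C D where "\<forall>i\<in>{..?n}.
      parity_split K t (\<lambda>(x1, y1, x2, y2). T i (EE_vec x1 y1 x2 y2)) (A i) (B i) (C i) (D i)"
    unfolding bchoice_iff by blast
  then have split: "parity_split K t (\<lambda>(x1, y1, x2, y2). T i (EE_vec x1 y1 x2 y2)) (A i) (B i) (C i) (D i)"
    if "i \<le> ?n" for i using that by blast
  have T_eq: "T i (EE_vec x1 y1 x2 y2) =
      A i (x1, x2) + B i (x1, x2) * y1 + C i (x1, x2) * y2 + D i (x1, x2) * (y1 * y2)"
    if "i \<le> ?n" "y1^2 = cubic t x1" "y2^2 = cubic t x2" for i x1 y1 x2 y2
    using split[OF that(1)] that(2,3) by (auto simp: parity_split_def)
  define Re where "Re i = (\<lambda>(x1, x2, w). A i (x1, x2) + D i (x1, x2) * w)" for i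
  define Ro where "Ro i = (\<lambda>(x1, x2, w). B i (x1, x2) * cubic t x1 + C i (x1, x2) * w)" for i
  have base: "(\<lambda>(x1, x2, w). x1) \<in> polyfuns K triple_coords" "(\<lambda>(x1, x2, w). w) \<in> polyfuns K triple_coords"
    by (auto intro: polyfuns.base)
  have R_poly: "Re i \<in> polyfuns K triple_coords" "Ro i \<in> polyfuns K triple_coords" if "i \<le> ?n" for i
  proof -
    from split[OF that] have "A i \<in> polyfuns K pair_coords" "B i \<in> polyfuns K pair_coords"
      "C i \<in> polyfuns K pair_coords" "D i \<in> polyfuns K pair_coords" by (auto simp: parity_split_def)
    note p = this[THEN polyfuns_on_triples]
    show "Re i \<in> polyfuns K triple_coords"
      using polyfuns.add[OF p(1) polyfuns.mult[OF p(4) base(2)]] by (simp add: Re_def case_prod_unfold)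
    show "Ro i \<in> polyfuns K triple_coords"
      using polyfuns.add[OF polyfuns.mult[OF p(2) cubic_polyfun[OF K base(1)]] polyfuns.mult[OF p(3) base(2)]]
      by (simp add: Ro_def case_prod_unfold)
  qed
  \<comment> \<open>Both \<open>T a\<close> and \<open>T (-a)\<close> are multiples of a vector for \<open>q a\<close>, hence so are their combinations.\<close>
  have R_rep: "q (proj (EE_vec x1 y1 x2 y2)) = proj (cut ?n (\<lambda>i. R i (x1, x2, y1 * y2)))"
    if y: "y1^2 = cubic t x1" "y2^2 = cubic t x2" and R: "R = Re \<or> R = Ro"
      and nz: "\<exists>i\<le>?n. R i (x1, x2, y1 * y2) \<noteq> 0" for x1 y1 x2 y2 R
  proof -
    let ?a = "EE_vec x1 y1 x2 y2" and ?b = "EE_vec x1 (- y1) x2 (- y2)"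
    have y': "(- y1)^2 = cubic t x1" "(- y2)^2 = cubic t x2" using y by auto
    have ab: "proj ?a \<in> ?A" "proj ?b \<in> ?A" using affine_in_EE[OF y] affine_in_EE[OF y'] by auto
    then have "q (proj ?a) \<in> pts Q" using morphism_in[OF mor] by blast
    then obtain u where u: "q (proj ?a) = proj u" using Q(2) pspaceE by blast
    have qb: "q (proj ?b) = proj u"
      using fib ab u EE_neg_affine[OF y] by metis
    have mult: "\<exists>\<alpha>. \<forall>i\<le>?n. T i v = \<alpha> * u i" if v: "proj v \<in> ?A" "q (proj v) = proj u" for v
    proof (cases "\<exists>i\<le>?n. T i v \<noteq> 0")
      case True
      then have "proj u = proj (cut ?n (\<lambda>i. T i v))" using qT[OF v(1)] v(2) by simp
      then obtain c where "cut ?n (\<lambda>i. T i v) = (\<lambda>i. c * u i)" by (auto simp: proj_eq_iff)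
      then show ?thesis by (metis cut_def)
    next
      case False
      then show ?thesis by (intro exI[of _ 0]) auto
    qed
    obtain \<alpha> where \<alpha>: "\<And>i. i \<le> ?n \<Longrightarrow> T i ?a = \<alpha> * u i" using mult[OF ab(1) u] by blast
    obtain \<beta> where \<beta>: "\<And>i. i \<le> ?n \<Longrightarrow> T i ?b = \<beta> * u i" using mult[OF ab(2) qb] by blast
    have "2 * Re i (x1, x2, y1 * y2) = T i ?a + T i ?b"
      "2 * Ro i (x1, x2, y1 * y2) = y1 * (T i ?a - T i ?b)" if "i \<le> ?n" for i
      unfolding T_eq[OF that y] T_eq[OF that y'] Re_def Ro_def prod.case y(1)[symmetric]
      by (simp_all add: algebra_simps power2_eq_square)
    then have "2 * Re i (x1, x2, y1 * y2) = (\<alpha> + \<beta>) * u i"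
      "2 * Ro i (x1, x2, y1 * y2) = (y1 * (\<alpha> - \<beta>)) * u i" if "i \<le> ?n" for i
      using \<alpha> \<beta> that by (simp_all add: algebra_simps)
    then have "\<exists>\<gamma>. \<forall>i\<le>?n. 2 * R i (x1, x2, y1 * y2) = \<gamma> * u i" using R by blast
    then obtain \<gamma> where \<gamma>: "\<And>i. i \<le> ?n \<Longrightarrow> 2 * R i (x1, x2, y1 * y2) = \<gamma> * u i" by blast
    then have \<gamma>': "R i (x1, x2, y1 * y2) = \<gamma> / 2 * u i" if "i \<le> ?n" for i
      using that two by (simp add: field_simps)
    then have "\<gamma> / 2 \<noteq> 0" using nz by (metis mult_zero_left)
    have u0: "u i = 0" if "i > ?n" for i
      using that Q(2) \<open>q (proj ?a) \<in> pts Q\<close> u by (auto simp: proj_in_pspace dest!: subsetD)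
    have "cut ?n (\<lambda>i. R i (x1, x2, y1 * y2)) = (\<lambda>i. \<gamma> / 2 * u i)"
      using \<gamma>' u0 by (auto simp: cut_def fun_eq_iff)
    then show ?thesis using proj_scale[OF \<open>\<gamma> / 2 \<noteq> 0\<close>, of u] u by simp
  qed
  show ?thesis
  proof (cases "\<exists>i\<le>?n. Re i (a1, a2, b1 * b2) \<noteq> 0")
    case True
    then show ?thesis using that[of Re] R_poly(1) R_rep by blast
  next
    case False
    obtain i where i: "i \<le> ?n" "T i (EE_vec a1 b1 a2 b2) \<noteq> 0" using T(2) by blast
    have "A i (a1, a2) + D i (a1, a2) * (b1 * b2) = 0" using False i by (auto simp: Re_def)
    then have "T i (EE_vec a1 b1 a2 b2) = B i (a1, a2) * b1 + C i (a1, a2) * b2"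
      using T_eq[OF i(1) pt(1,2)] by (simp add: algebra_simps)
    moreover have "Ro i (a1, a2, b1 * b2) = b1 * (B i (a1, a2) * b1 + C i (a1, a2) * b2)"
      unfolding Ro_def prod.case pt(1)[symmetric] by (simp add: algebra_simps power2_eq_square)
    ultimately have "Ro i (a1, a2, b1 * b2) \<noteq> 0" using i pt(3) by simp
    then show ?thesis using that[of Ro] R_poly(2) R_rep i by blast
  qed
qed

section \<open>The double plane is irreducible\<close>

text \<open>If the field were finite, the product of all \<open>X - a\<close>, increased by 1, would have no root.\<close>

lemma infinite_alg_closed: "infinite (UNIV :: 'a::alg_closed_field set)"
proof
  assume fin: "finite (UNIV :: 'a set)"
  define p :: "'a poly" where "p = (\<Prod>a\<in>UNIV. [:- a, 1:])"
  have "degree p = (\<Sum>a\<in>(UNIV::'a set). 1)"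
    unfolding p_def by (subst degree_prod_eq_sum_degree) auto
  then have deg: "degree (p + 1) > 0"
    using fin by (simp add: degree_add_eq_left finite_UNIV_card_ge_0)
  then obtain x where "poly (p + 1) x = 0" using alg_closed_imp_poly_has_root by blast
  moreover have "poly p x = 0" using fin by (auto simp: p_def poly_prod)
  ultimately show False by simp
qed

lemma polyfun_on_line:
  assumes "f \<in> polyfuns UNIV triple_coords"
  shows "\<exists>p. \<forall>s. f (a0 + s * a1, b0 + s * b1, c0 + s * c1) = poly p (s::'a::comm_ring_1)"
proof -
  let ?S = "{g :: 'a \<Rightarrow> 'a. \<exists>p. \<forall>s. g s = poly p s}"
  have "function_algebra UNIV ?S"
    unfolding function_algebra_def
  proof (intro conjI ballI)
    fix c :: 'a show "(\<lambda>_. c) \<in> ?S" by (auto intro!: exI[of _ "[:c:]"])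
    fix f g assume "f \<in> ?S" "g \<in> ?S"
    then obtain p q where "\<forall>s. f s = poly p s" "\<forall>s. g s = poly q s" by auto
    then show "(\<lambda>v. f v + g v) \<in> ?S" "(\<lambda>v. f v * g v) \<in> ?S"
      by (auto intro: exI[of _ "p + q"] exI[of _ "p * q"])
  qed
  then have "(\<lambda>s. f (a0 + s * a1, b0 + s * b1, c0 + s * c1)) \<in> ?S"
  proof (rule polyfuns_subst[OF assms])
    fix b :: "'a \<times> 'a \<times> 'a \<Rightarrow> 'a" assume "b \<in> triple_coords"
    moreover have "(\<lambda>s. u + s * v) \<in> ?S" for u v :: 'a by (auto intro!: exI[of _ "[:u, v:]"])
    ultimately show "(\<lambda>s. b (a0 + s * a1, b0 + s * b1, c0 + s * c1)) \<in> ?S" by auto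
  qed
  then show ?thesis by simp
qed

lemma polyfuns_domain:
  fixes f g :: "'a::alg_closed_field \<times> 'a \<times> 'a \<Rightarrow> 'a"
  assumes f: "f \<in> polyfuns UNIV triple_coords" and g: "g \<in> polyfuns UNIV triple_coords"
    and fg: "\<And>v. f v = 0 \<or> g v = 0"
  shows "(\<forall>v. f v = 0) \<or> (\<forall>v. g v = 0)"
proof (rule ccontr)
  assume "\<not> ?thesis"
  then obtain a b c a' b' c' where nz: "f (a, b, c) \<noteq> 0" "g (a', b', c') \<noteq> 0" by auto
  \<comment> \<open>Restrict to the line through a point with \<open>f \<noteq> 0\<close> and a point with \<open>g \<noteq> 0\<close>.\<close>
  obtain p where p: "\<And>s. f (a + s * (a' - a), b + s * (b' - b), c + s * (c' - c)) = poly p s"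
    using polyfun_on_line[OF f] by blast
  obtain q where q: "\<And>s. g (a + s * (a' - a), b + s * (b' - b), c + s * (c' - c)) = poly q s"
    using polyfun_on_line[OF g] by blast
  have "poly (p * q) s = 0" for s using fg by (auto simp flip: p q)
  then have "p * q = 0" using poly_roots_finite[of "p * q"] infinite_alg_closed by auto
  moreover have "poly p 0 \<noteq> 0" "poly q 1 \<noteq> 0" using nz by (simp_all flip: p q)
  ultimately show False by auto
qed

definition sextic :: "'a::field \<Rightarrow> 'a \<times> 'a \<times> 'a \<Rightarrow> 'a" where
  "sextic t = (\<lambda>(x, z, u). u * x * z * (x + u) * (z + u) * (x + z * t))"

definition plane_vec :: "'a::field \<Rightarrow> 'a \<Rightarrow> 'a \<Rightarrow> 'a \<Rightarrow> nat \<Rightarrow> 'a" where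
  "plane_vec x z u y = (\<lambda>i. if i \<le> 10 then
     [x^3, x^2 * z, x^2 * u, x * z^2, x * z * u, x * u^2, z^3, z^2 * u, z * u^2, u^3, y] ! i else 0)"

lemma pts_double_plane:
  "pts (double_plane t) = {proj (plane_vec x z u y) | x z u y.
     (x, z, u) \<noteq> (0, 0, 0) \<and> y^2 = sextic t (x, z, u)}"
  by (simp add: double_plane_def wproj_point_def plane_vec_def sextic_def)

lemma amb_double_plane [simp]: "amb (double_plane t) = 10"
  by (simp add: double_plane_def)

lemma double_plane_sub: "pts (double_plane t) \<subseteq> pspace 10"
proof
  fix p assume "p \<in> pts (double_plane t)"
  then obtain x z u y where p: "p = proj (plane_vec x z u y)" "(x, z, u) \<noteq> (0, 0, 0)"
    by (auto simp: pts_double_plane)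
  have "plane_vec x z u y 0 = x^3" "plane_vec x z u y 6 = z^3" "plane_vec x z u y 9 = u^3"
    by (simp_all add: plane_vec_def)
  then have "\<exists>i\<le>10. plane_vec x z u y i \<noteq> 0"
    using p(2) by (metis prod.inject power_not_zero numeral_le_iff zero_le semiring_norm(68-79))
  then show "p \<in> pspace 10" unfolding p(1) proj_in_pspace by (auto simp: plane_vec_def)
qed

text \<open>The order of \<open>sextic\<close> along the line \<open>x = 0\<close> is 1, while \<open>A^2\<close> and \<open>B^2\<close> have even orders. The orders are
  compared on the lines where \<open>z\<close> and \<open>u\<close> are constant and general.\<close>

lemma sextic_not_square:
  fixes t :: "'a::alg_closed_field"
  assumes t: "t \<noteq> 0" and A: "A \<in> polyfuns UNIV triple_coords" and B: "B \<in> polyfuns UNIV triple_coords"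
    and eq: "\<And>v. (A v)^2 = (B v)^2 * sextic t v"
  shows "A v = 0" "B v = 0"
proof -
  let ?c = "\<lambda>(x :: 'a, z :: 'a, u :: 'a). z * u * (z + u)"
  have c: "?c \<in> polyfuns UNIV triple_coords"
  proof -
    have "(\<lambda>v. (\<lambda>(x, z, u). z) v * (\<lambda>(x, z, u). u) v * ((\<lambda>(x, z, u). z) v + (\<lambda>(x, z, u). u) v))
        \<in> polyfuns UNIV (triple_coords :: ('a \<times> 'a \<times> 'a \<Rightarrow> 'a) set)"
      by (intro polyfuns.mult polyfuns.add polyfuns.base) auto
    then show ?thesis by (simp add: case_prod_unfold)
  qed
  have c_nz: "\<exists>v. ?c v \<noteq> 0"
  proof -
    have "infinite (UNIV - {0, -1 :: 'a})" using infinite_alg_closed by simp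
    then obtain z :: 'a where "z \<in> UNIV - {0, -1}" by (metis ex_in_conv finite.emptyI)
    then have "?c (0, z, 1) \<noteq> 0" by (simp add: add_eq_0_iff2)
    then show ?thesis by (rule exI)
  qed
  have line: "A (x, z, u) = 0 \<and> B (x, z, u) = 0" if zu: "z * u * (z + u) \<noteq> 0" for x z u
  proof -
    obtain a where a: "\<And>s. A (0 + s * 1, z + s * 0, u + s * 0) = poly a s"
      using polyfun_on_line[OF A] by blast
    obtain b where b: "\<And>s. B (0 + s * 1, z + s * 0, u + s * 0) = poly b s"
      using polyfun_on_line[OF B] by blast
    define d where "d = [:u * z * (z + u):] * [:u, 1:] * [:z * t, 1:]"
    have "poly (a^2 - b^2 * ([:- 0, 1:] * d)) s = 0" for s
      using eq[of "(s, z, u)"] by (simp add: a[symmetric, simplified] b[symmetric, simplified] d_def sextic_def algebra_simps)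
    then have ab: "a^2 = b^2 * ([:- 0, 1:] * d)"
      using poly_roots_finite[of "a^2 - b^2 * ([:- 0, 1:] * d)"] infinite_alg_closed by auto
    have d0: "poly d 0 \<noteq> 0" using zu t by (simp add: d_def)
    have "b = 0"
    proof (rule ccontr)
      assume b0: "b \<noteq> 0"
      have d: "d \<noteq> 0" using d0 by auto
      then have "b^2 * ([:- 0, 1:] * d) \<noteq> 0" using b0 by simp
      then have "a^2 \<noteq> 0" using ab by simp
      then have a0: "a \<noteq> 0" by auto
      have "order 0 (a^2) = 2 * order 0 a"
        using a0 by (simp add: power2_eq_square order_mult)
      moreover have "order 0 (b^2 * ([:- 0, 1:] * d)) = 2 * order 0 b + 1"
        using b0 d order_0I[OF d0] order_power_n_n[of "0::'a" 1]
        by (simp add: power2_eq_square order_mult del: mult_pCons_left)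
      ultimately have "2 * order 0 a = 2 * order 0 b + 1" using ab by simp
      then show False by presburger
    qed
    moreover have "a = 0" using ab \<open>b = 0\<close> by simp
    ultimately show ?thesis using a[of x] b[of x] by simp
  qed
  have "\<And>v. A v = 0 \<or> ?c v = 0" "\<And>v. B v = 0 \<or> ?c v = 0"
    using line by auto
  from polyfuns_domain[OF A c this(1)] polyfuns_domain[OF B c this(2)] c_nz
  show "A v = 0" "B v = 0" by blast+
qed

lemma sextic_polyfun: "sextic t \<in> polyfuns UNIV triple_coords"
proof -
  let ?x = "\<lambda>(x, z, u). x" and ?z = "\<lambda>(x, z, u). z" and ?u = "\<lambda>(x, z, u). u"
  have "(\<lambda>v. ?u v * ?x v * ?z v * (?x v + ?u v) * (?z v + ?u v) * (?x v + ?z v * t)) \<in> polyfuns UNIV triple_coords"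
    by (intro polyfuns.mult polyfuns.add polyfuns.base polyfuns.const) auto
  then show ?thesis by (simp add: sextic_def case_prod_unfold)
qed

lemma form_on_double_plane:
  assumes "form_fun UNIV 10 d \<phi>"
  shows "\<exists>A B. A \<in> polyfuns UNIV triple_coords \<and> B \<in> polyfuns UNIV triple_coords \<and>
    (\<forall>x z u y. y^2 = sextic t (x, z, u) \<longrightarrow> \<phi> (plane_vec x z u y) = A (x, z, u) + B (x, z, u) * y)"
proof -
  define S where "S = {f :: 'a \<times> 'a \<times> 'a \<times> 'a \<Rightarrow> 'a. \<exists>A B. A \<in> polyfuns UNIV triple_coords \<and>
    B \<in> polyfuns UNIV triple_coords \<and>
    (\<forall>x z u y. y^2 = sextic t (x, z, u) \<longrightarrow> f (x, z, u, y) = A (x, z, u) + B (x, z, u) * y)}"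
  have SI: "f \<in> S" if "A \<in> polyfuns UNIV triple_coords" "B \<in> polyfuns UNIV triple_coords"
    "\<And>x z u y. y^2 = sextic t (x, z, u) \<Longrightarrow> f (x, z, u, y) = A (x, z, u) + B (x, z, u) * y" for f A B
    unfolding S_def using that by blast
  have alg: "function_algebra UNIV S"
    unfolding function_algebra_def
  proof (intro conjI ballI)
    fix c show "(\<lambda>_. c) \<in> S" by (rule SI[of "\<lambda>_. c" "\<lambda>_. 0"]) (auto intro: polyfuns.const)
    fix f g assume "f \<in> S" "g \<in> S"
    then obtain A B A' B' where p: "A \<in> polyfuns UNIV triple_coords" "B \<in> polyfuns UNIV triple_coords"
      "A' \<in> polyfuns UNIV triple_coords" "B' \<in> polyfuns UNIV triple_coords"
      and f: "\<And>x z u y. y^2 = sextic t (x, z, u) \<Longrightarrow> f (x, z, u, y) = A (x, z, u) + B (x, z, u) * y"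
      and g: "\<And>x z u y. y^2 = sextic t (x, z, u) \<Longrightarrow> g (x, z, u, y) = A' (x, z, u) + B' (x, z, u) * y"
      unfolding S_def by blast
    show "(\<lambda>v. f v + g v) \<in> S"
      by (rule SI[of "\<lambda>v. A v + A' v" "\<lambda>v. B v + B' v"])
         (auto simp: f g algebra_simps intro!: polyfuns.add p)
    show "(\<lambda>v. f v * g v) \<in> S"
    proof (rule SI[of "\<lambda>v. A v * A' v + (B v * B' v) * sextic t v" "\<lambda>v. A v * B' v + B v * A' v"])
      fix x z u y assume y: "y^2 = sextic t (x, z, u)"
      show "f (x, z, u, y) * g (x, z, u, y) =
        A (x, z, u) * A' (x, z, u) + B (x, z, u) * B' (x, z, u) * sextic t (x, z, u) +
        (A (x, z, u) * B' (x, z, u) + B (x, z, u) * A' (x, z, u)) * y"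
        unfolding f[OF y] g[OF y] y[symmetric] by (simp add: algebra_simps power2_eq_square)
    qed (intro polyfuns.add polyfuns.mult p sextic_polyfun)+
  qed
  have coords: "(\<lambda>(x, z, u, y). x) \<in> S" "(\<lambda>(x, z, u, y). z) \<in> S"
    "(\<lambda>(x, z, u, y). u) \<in> S" "(\<lambda>(x, z, u, y). y) \<in> S"
    by (rule SI[of "\<lambda>(x, z, u). x" "\<lambda>_. 0"] SI[of "\<lambda>(x, z, u). z" "\<lambda>_. 0"]
        SI[of "\<lambda>(x, z, u). u" "\<lambda>_. 0"] SI[of "\<lambda>_. 0" "\<lambda>_. 1"];
        auto intro: polyfuns.base polyfuns.const)+
  have vec: "(\<lambda>(x, z, u, y). plane_vec x z u y i) \<in> S" if "i \<le> 10" for i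
  proof -
    note c = coords[unfolded case_prod_unfold]
    note m = function_algebraD(3)[OF alg]
    have "i \<in> {0, 1, 2, 3, 4, 5, 6, 7, 8, 9, 10}"
      using that by (simp only: insert_iff empty_iff) presburger
    then show ?thesis
      unfolding case_prod_unfold plane_vec_def
      by (elim insertE emptyE; simp add: numeral_eq_Suc del: mem_Collect_eq; intro m c)
  qed
  obtain F where F: "F \<in> forms UNIV 10 d" "\<phi> = meval F" using assms by (auto simp: form_fun_def)
  have "(\<lambda>v. meval F (\<lambda>i. case v of (x, z, u, y) \<Rightarrow> plane_vec x z u y i)) \<in> S"
    by (rule function_algebra_meval[OF coeff_ring_UNIV alg F(1) vec])
  then show ?thesis unfolding S_def by (auto simp: F(2))
qed

text \<open>Forms on the double plane are \<open>A + B * y\<close>, with norm \<open>A^2 - B^2 * sextic\<close>. If a product vanishes, so does the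
  product of the norms, hence one norm, because polynomials form a domain; and a norm vanishes only if
  \<open>A = B = 0\<close>, because \<open>sextic\<close> is not a square.\<close>

lemma double_plane_irreducible:
  fixes t :: "'a::alg_closed_field"
  assumes t: "t \<noteq> 0"
  shows "form_irreducible 10 (pts (double_plane t))"
  unfolding form_irreducible_def
proof (intro allI impI)
  fix d e and \<phi> \<psi> :: "(nat \<Rightarrow> 'a) \<Rightarrow> 'a"
  assume \<phi>: "form_fun UNIV 10 d \<phi>" and \<psi>: "form_fun UNIV 10 e \<psi>"
    and prod: "\<forall>v. proj v \<in> pts (double_plane t) \<longrightarrow> \<phi> v = 0 \<or> \<psi> v = 0"
  obtain A B where AB: "A \<in> polyfuns UNIV triple_coords" "B \<in> polyfuns UNIV triple_coords"
    "\<And>x z u y. y^2 = sextic t (x, z, u) \<Longrightarrow> \<phi> (plane_vec x z u y) = A (x, z, u) + B (x, z, u) * y"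
    using form_on_double_plane[OF \<phi>] by blast
  obtain A' B' where AB': "A' \<in> polyfuns UNIV triple_coords" "B' \<in> polyfuns UNIV triple_coords"
    "\<And>x z u y. y^2 = sextic t (x, z, u) \<Longrightarrow> \<psi> (plane_vec x z u y) = A' (x, z, u) + B' (x, z, u) * y"
    using form_on_double_plane[OF \<psi>] by blast
  define N where "N v = (A v)^2 - (B v)^2 * sextic t v" for v
  define N' where "N' v = (A' v)^2 - (B' v)^2 * sextic t v" for v
  have N: "N \<in> polyfuns UNIV triple_coords" "N' \<in> polyfuns UNIV triple_coords"
    unfolding N_def N'_def power2_eq_square
    by (intro polyfuns_diff polyfuns.mult AB AB' sextic_polyfun coeff_ring_UNIV)+
  let ?x = "\<lambda>(x :: 'a, z :: 'a, u :: 'a). x"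
  have x: "?x \<in> polyfuns UNIV triple_coords" by (auto intro: polyfuns.base)
  \<comment> \<open>The factor \<open>x\<close> avoids the origin, which is not a point of the plane.\<close>
  have NN: "N v = 0 \<or> N' v * ?x v = 0" for v
  proof -
    obtain x z u where v: "v = (x, z, u)" by (cases v)
    obtain y where y: "y^2 = sextic t (x, z, u)" using nth_root_exists[of 2] by auto
    have "(N v = 0 \<or> N' v = 0)" if "x \<noteq> 0"
    proof -
      have fac: "N v = (A v + B v * y) * (A v + B v * (- y))" "N' v = (A' v + B' v * y) * (A' v + B' v * (- y))"
        unfolding N_def N'_def v y[symmetric] by (simp_all add: algebra_simps power2_eq_square)
      have "proj (plane_vec x z u y) \<in> pts (double_plane t)"
        using that y unfolding pts_double_plane by blast
      then have "\<phi> (plane_vec x z u y) = 0 \<or> \<psi> (plane_vec x z u y) = 0" using prod by blast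
      then show ?thesis using fac AB(3)[OF y] AB'(3)[OF y] by (auto simp: v)
    qed
    then show ?thesis by (auto simp: v)
  qed
  have N'x: "(\<lambda>v. N' v * ?x v) \<in> polyfuns UNIV triple_coords" by (intro polyfuns.mult N x)
  have "(\<forall>v. N v = 0) \<or> (\<forall>v. N' v = 0)"
  proof (cases "\<forall>v. N v = 0")
    case False
    then have "N' v * ?x v = 0" for v using polyfuns_domain[OF N(1) N'x NN] by blast
    then have "N' v = 0 \<or> ?x v = 0" for v by (metis mult_eq_0_iff)
    from polyfuns_domain[OF N(2) x this] have "(\<forall>v. N' v = 0) \<or> (\<forall>v. ?x v = 0)" .
    moreover have "?x (1, 0, 0) \<noteq> 0" by simp
    ultimately show ?thesis by blast
  qed simp
  then have "(\<forall>v. A v = 0 \<and> B v = 0) \<or> (\<forall>v. A' v = 0 \<and> B' v = 0)"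
  proof
    assume *: "\<forall>v. N v = 0"
    have "(A v)^2 = (B v)^2 * sextic t v" for v
      using spec[OF *, of v] unfolding N_def by simp
    then show ?thesis using sextic_not_square[OF t AB(1,2)] by blast
  next
    assume *: "\<forall>v. N' v = 0"
    have "(A' v)^2 = (B' v)^2 * sextic t v" for v
      using spec[OF *, of v] unfolding N'_def by simp
    then show ?thesis using sextic_not_square[OF t AB'(1,2)] by blast
  qed
  moreover have van: "\<chi> v = 0" if "form_fun UNIV 10 c \<chi>" "proj v \<in> pts (double_plane t)"
    "\<And>x z u y. y^2 = sextic t (x, z, u) \<Longrightarrow> \<chi> (plane_vec x z u y) = 0" for c \<chi> v
  proof -
    from that(2) obtain x z u y where "proj (plane_vec x z u y) = proj v" "y^2 = sextic t (x, z, u)"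
      by (auto simp: pts_double_plane)
    then show ?thesis using that(3) form_fun_scale[OF that(1)] by (auto simp: proj_eq_iff)
  qed
  ultimately show "(\<forall>v. proj v \<in> pts (double_plane t) \<longrightarrow> \<phi> v = 0) \<or>
      (\<forall>v. proj v \<in> pts (double_plane t) \<longrightarrow> \<psi> v = 0)"
  proof (elim disjE)
    assume "\<forall>v. A v = 0 \<and> B v = 0"
    then have "\<And>x z u y. y^2 = sextic t (x, z, u) \<Longrightarrow> \<phi> (plane_vec x z u y) = 0" using AB(3) by simp
    then show ?thesis using van[OF \<phi>] by blast
  next
    assume "\<forall>v. A' v = 0 \<and> B' v = 0"
    then have "\<And>x z u y. y^2 = sextic t (x, z, u) \<Longrightarrow> \<psi> (plane_vec x z u y) = 0" using AB'(3) by simp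
    then show ?thesis using van[OF \<psi>] by blast
  qed
qed

section \<open>The correspondence between the double plane and \<open>E \<times> E\<close>\<close>

locale square_root_parameter =
  fixes t r :: "'a::alg_closed_field"
  assumes two: "(2::'a) \<noteq> 0" and t0: "t \<noteq> 0" and t1: "t + 1 \<noteq> 0" and r: "r^2 = 1 / (t + 1)"
begin

text \<open>The Moebius transformation \<open>m \<mapsto> r * (m + \<rho>) / (m - \<rho>)\<close> maps \<open>0\<close>, \<open>\<infinity>\<close>, \<open>1\<close> to \<open>-r\<close>, \<open>r\<close>, \<open>1\<close>.\<close>

definition "\<rho> = (1 - r) / (1 + r)"

lemma r_eq: "(t + 1) * r^2 = 1" using t1 by (simp add: r)

lemma r0: "r \<noteq> 0" using r_eq by auto

lemma r_pm: "1 - r \<noteq> 0" "1 + r \<noteq> 0"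
proof -
  have "(1 - r) * (1 + r) = t * r^2" using r_eq by (simp add: algebra_simps power2_eq_square)
  moreover have "t * r^2 \<noteq> 0" using t0 r0 by simp
  ultimately show "1 - r \<noteq> 0" "1 + r \<noteq> 0" by auto
qed

lemma rho0: "\<rho> \<noteq> 0" using r_pm by (simp add: \<rho>_def)

lemma rho_eq: "(1 + r) * \<rho> = 1 - r" using r_pm by (simp add: \<rho>_def)

lemma cubic_r: "cubic t x = (x - 1) * (x^2 - r^2)"
  by (simp add: cubic_def r)

text \<open>An open part of the surface \<open>p^2 = (k - 1)^2 / (k^2 - r^2) + 1 / (e^2 - 1)\<close>, which lies between the double
  plane and \<open>w^2 = cubic x1 * cubic x2\<close>: birational to the former, a double cover of the latter.\<close>

definition mid :: "'a \<Rightarrow> 'a \<Rightarrow> 'a \<Rightarrow> bool" where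
  "mid k e p \<longleftrightarrow> k \<noteq> 1 \<and> k^2 \<noteq> r^2 \<and> e^2 \<noteq> 1 \<and>
     p^2 * (k^2 - r^2) * (e^2 - 1) = (k - 1)^2 * (e^2 - 1) + (k^2 - r^2)"

text \<open>The coordinates \<open>x1\<close> and \<open>x2\<close> solve \<open>p^2 = (k - 1) * (x1 - 1) / (k^2 - r^2)\<close> and
  \<open>e^2 = (x2 - 1) / (k - 1)\<close>.\<close>

definition "prod1 k p = 1 + p^2 * (k^2 - r^2) / (k - 1)"
definition "prod2 k e = 1 + (k - 1) * e^2"
definition "prodw k e p = ((prod1 k p)^2 - r^2) * (prod2 k e - k) * p * e"

text \<open>The relation between \<open>k\<close>, \<open>e\<close>, \<open>p\<close> amounts to \<open>x1 * (x2 - k) = k * x2 - r^2\<close>, and this Moebius transformation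
  exchanges \<open>r\<close> and \<open>-r\<close>; so \<open>x1^2 - r^2\<close> and \<open>(k^2 - r^2) * (x2^2 - r^2)\<close> agree up to a square.\<close>

lemma mid_to_product:
  assumes "mid k e p"
  shows "(prodw k e p)^2 = cubic t (prod1 k p) * cubic t (prod2 k e)"
proof -
  define x1 x2 where "x1 = prod1 k p" and "x2 = prod2 k e"
  have k: "k - 1 \<noteq> 0" and rel: "p^2 * (k^2 - r^2) * (e^2 - 1) = (k - 1)^2 * (e^2 - 1) + (k^2 - r^2)"
    using assms by (auto simp: mid_def)
  have 1: "(x1 - 1) * (k - 1) = p^2 * (k^2 - r^2)" using k by (simp add: x1_def prod1_def)
  have 2: "x2 - 1 = (k - 1) * e^2" by (simp add: x2_def prod2_def)
  have "x2 - k = (k - 1) * (e^2 - 1)" using 2 by (simp add: algebra_simps)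
  then have "(x1 - 1) * (x2 - k) = ((x1 - 1) * (k - 1)) * (e^2 - 1)" by (simp only: mult.assoc)
  also have "\<dots> = (k - 1) * ((k - 1) * e^2) + (2 * k - 1 - r^2)"
    unfolding 1 rel by (simp add: algebra_simps power2_eq_square)
  also have "\<dots> = (k - 1) * (x2 - 1) + (2 * k - 1 - r^2)" by (simp add: 2)
  finally have 3: "x1 * (x2 - k) = k * x2 - r^2" by (simp add: algebra_simps)
  have "(x1^2 - r^2) * (x2 - k)^2 = (x1 * (x2 - k))^2 - r^2 * (x2 - k)^2"
    by (simp add: algebra_simps power2_eq_square)
  also have "\<dots> = (k^2 - r^2) * (x2^2 - r^2)"
    unfolding 3 by (simp add: algebra_simps power2_eq_square)
  finally have 4: "(x1^2 - r^2) * (x2 - k)^2 = (k^2 - r^2) * (x2^2 - r^2)" .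
  have "((x1^2 - r^2) * (x2 - k) * p * e)^2 = (x1^2 - r^2) * ((x1^2 - r^2) * (x2 - k)^2) * p^2 * e^2"
    by (simp add: power2_eq_square algebra_simps)
  also have "\<dots> = (x1^2 - r^2) * (x2^2 - r^2) * (p^2 * (k^2 - r^2)) * e^2"
    unfolding 4 by (simp add: algebra_simps)
  also have "\<dots> = ((x1 - 1) * (x1^2 - r^2)) * (((k - 1) * e^2) * (x2^2 - r^2))"
    unfolding 1[symmetric] by (simp add: algebra_simps)
  finally show ?thesis
    unfolding 2[symmetric] by (simp add: prodw_def cubic_r flip: x1_def x2_def)
qed

text \<open>The last factor rules out \<open>(e^2 - 1) * (k - 1)^2 = t * (k^2 - r^2)\<close>, which contains the points with \<open>m * n = 1\<close>.
  These would have to come from \<open>x + 1 = z + 1 = 0\<close>, where \<open>m\<close> and \<open>n\<close> have no meaning.\<close>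

definition "good x1 x2 = (x1 + x2) * (x1 - 1) * (x1^2 - r^2) * (x2^2 - r^2) *
  (x1 * x2 + r^2 - x1 - x2) * (x1 * x2 + r^2 - x1 - x2 - t * (x1^2 - r^2))"

text \<open>Only one square root has to be chosen: for \<open>p^2 = (k - 1) * (x1 - 1) / (k^2 - r^2)\<close>. Then \<open>e\<close> is determined
  by \<open>w\<close>, and the equation for \<open>w\<close> yields \<open>(k - 1) * e^2 = x2 - 1\<close>.\<close>

lemma product_to_mid:
  assumes w: "w^2 = cubic t x1 * cubic t x2" and good: "good x1 x2 \<noteq> 0"
  shows "\<exists>k e p. mid k e p \<and> (e^2 - 1) * (k - 1)^2 \<noteq> t * (k^2 - r^2) \<and>
    prod1 k p = x1 \<and> prod2 k e = x2 \<and> prodw k e p = w"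
proof -
  from good have nz: "x1 + x2 \<noteq> 0" "x1 - 1 \<noteq> 0" "x1^2 - r^2 \<noteq> 0" "x2^2 - r^2 \<noteq> 0"
    "x1 * x2 + r^2 - x1 - x2 \<noteq> 0" "x1 * x2 + r^2 - x1 - x2 - t * (x1^2 - r^2) \<noteq> 0"
    by (auto simp: good_def)
  define s where "s = x1 + x2"
  have s: "s \<noteq> 0" using nz(1) by (simp add: s_def)
  define k where "k = (x1 * x2 + r^2) / s"
  have ks: "k * s = x1 * x2 + r^2" using s by (simp add: k_def)
  have A: "(k - 1) * s = x1 * x2 + r^2 - x1 - x2" using ks by (simp add: algebra_simps s_def)
  have B: "(k^2 - r^2) * s^2 = (x1^2 - r^2) * (x2^2 - r^2)"
  proof -
    have "(k^2 - r^2) * s^2 = (k * s)^2 - r^2 * s^2" by (simp add: algebra_simps power2_eq_square)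
    then show ?thesis unfolding ks by (simp add: s_def algebra_simps power2_eq_square)
  qed
  have C: "(x2 - k) * s = x2^2 - r^2" using ks by (simp add: algebra_simps s_def power2_eq_square)
  have k1: "k - 1 \<noteq> 0" and kr: "k^2 - r^2 \<noteq> 0" and x2k: "x2 - k \<noteq> 0"
    using A B C nz by auto
  obtain p where p: "p^2 = (k - 1) * (x1 - 1) / (k^2 - r^2)" using nth_root_exists[of 2] by auto
  have p0: "p \<noteq> 0" using p k1 kr nz by auto
  have pk: "p^2 * (k^2 - r^2) = (k - 1) * (x1 - 1)" using p kr by simp
  define e where "e = w / ((x1^2 - r^2) * p * (x2 - k))"
  have w_e: "w = (x1^2 - r^2) * (x2 - k) * p * e" using nz p0 x2k by (simp add: e_def)
  have D: "(x1^2 - r^2) * (x2 - k)^2 = (k^2 - r^2) * (x2^2 - r^2)"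
  proof -
    have "((x1^2 - r^2) * (x2 - k)^2) * s^2 = (x1^2 - r^2) * ((x2 - k) * s)^2" by (simp add: power_mult_distrib)
    also have "\<dots> = ((k^2 - r^2) * s^2) * (x2^2 - r^2)" unfolding C B by (simp add: power2_eq_square)
    also have "\<dots> = ((k^2 - r^2) * (x2^2 - r^2)) * s^2" by (simp only: ac_simps)
    finally show ?thesis using s by simp
  qed
  have "(x1^2 - r^2) * (x2^2 - r^2) * (x1 - 1) * ((k - 1) * e^2) =
      (x1^2 - r^2) * (x2^2 - r^2) * (p^2 * (k^2 - r^2)) * e^2"
    unfolding pk by (simp add: algebra_simps)
  also have "\<dots> = (x1^2 - r^2) * ((x1^2 - r^2) * (x2 - k)^2) * p^2 * e^2"
    unfolding D by (simp add: algebra_simps)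
  also have "\<dots> = w^2" unfolding w_e by (simp add: power2_eq_square algebra_simps)
  also have "\<dots> = (x1^2 - r^2) * (x2^2 - r^2) * (x1 - 1) * (x2 - 1)"
    unfolding w cubic_r by (simp add: algebra_simps)
  finally have E: "(k - 1) * e^2 = x2 - 1" using nz by simp
  have F: "(k - 1) * (e^2 - 1) = x2 - k" using E by (simp add: algebra_simps)
  then have e1: "e^2 - 1 \<noteq> 0" using x2k by auto
  have "p^2 * (k^2 - r^2) * (e^2 - 1) = (x1 - 1) * (x2 - k)"
    unfolding pk F[symmetric] by (simp add: algebra_simps)
  also have "\<dots> = (k - 1) * (x2 - k) + (k^2 - r^2)"
  proof -
    have "((x1 - 1) * (x2 - k) - ((k - 1) * (x2 - k) + (k^2 - r^2))) = x1 * x2 + r^2 - k * (x1 + x2)"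
      by (simp add: algebra_simps power2_eq_square)
    also have "\<dots> = 0" using ks by (simp add: s_def)
    finally show ?thesis by simp
  qed
  also have "\<dots> = (k - 1)^2 * (e^2 - 1) + (k^2 - r^2)"
    unfolding F[symmetric] by (simp add: power2_eq_square)
  finally have "mid k e p" using k1 kr e1 by (simp add: mid_def)
  moreover have "(e^2 - 1) * (k - 1)^2 \<noteq> t * (k^2 - r^2)"
  proof
    assume "(e^2 - 1) * (k - 1)^2 = t * (k^2 - r^2)"
    then have "(x2 - k) * (k - 1) = t * (k^2 - r^2)"
      unfolding F[symmetric] by (simp add: power2_eq_square algebra_simps)
    then have "((x2 - k) * (k - 1)) * s^2 = (t * (k^2 - r^2)) * s^2" by (rule arg_cong)
    then have "((x2 - k) * s) * ((k - 1) * s) = t * ((k^2 - r^2) * s^2)"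
      by (simp only: power2_eq_square[of s] ac_simps)
    then show False unfolding A B C using nz by simp
  qed
  moreover have "prod1 k p = x1" "prod2 k e = x2" using pk E k1 by (simp_all add: prod1_def prod2_def)
  moreover have "prodw k e p = w" using w_e calculation by (simp add: prodw_def)
  ultimately show ?thesis by blast
qed

text \<open>With \<open>n = z * (x + 1) / (z + 1)\<close>, \<open>plane_e\<close> is \<open>(n + 1) / (n - 1)\<close>; note \<open>m * n = x * z\<close>,
  \<open>m - 1 = (x * z - 1) / (x + 1)\<close> and \<open>n - 1 = (x * z - 1) / (z + 1)\<close>.\<close>

definition "plane_m x z = x * (z + 1) / (x + 1)"
definition "plane_k x z = r * (plane_m x z + \<rho>) / (plane_m x z - \<rho>)"
definition "plane_e x z = (x * z + 2 * z + 1) / (x * z - 1)"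
definition "plane_p x z y = y * (x * z - 1) / (2 * ((x + 1) * (z + 1) * x * z))"

definition plane_ok :: "'a \<Rightarrow> 'a \<Rightarrow> bool" where
  "plane_ok x z \<longleftrightarrow> x \<noteq> 0 \<and> z \<noteq> 0 \<and> x + 1 \<noteq> 0 \<and> z + 1 \<noteq> 0 \<and> x * z - 1 \<noteq> 0 \<and> plane_m x z - \<rho> \<noteq> 0"

text \<open>The last equation is \<open>(k - 1)^2 / (k^2 - r^2) = t * (m - 1)^2 / (4 * m)\<close>: both sides have a double zero at
  \<open>m = 1\<close> and simple poles at \<open>0\<close> and \<open>\<infinity>\<close>, and the constants agree because \<open>1 - r^2 = t * r^2\<close>.\<close>

lemma k_of_m:
  assumes "m - \<rho> \<noteq> 0" "k = r * (m + \<rho>) / (m - \<rho>)"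
  shows "(k - 1) * (m - \<rho>) = (r - 1) * (m - 1)" "(k^2 - r^2) * (m - \<rho>)^2 = 4 * r^2 * m * \<rho>"
    "t * (k^2 - r^2) * (m - 1)^2 = 4 * m * (k - 1)^2"
proof -
  have k: "k * (m - \<rho>) = r * (m + \<rho>)" using assms by simp
  have "(k - 1) * (m - \<rho>) = (r - 1) * m + (1 + r) * \<rho>"
    using k by (simp add: algebra_simps)
  then show 1: "(k - 1) * (m - \<rho>) = (r - 1) * (m - 1)" unfolding rho_eq by (simp add: algebra_simps)
  have "(k^2 - r^2) * (m - \<rho>)^2 = (k * (m - \<rho>))^2 - r^2 * (m - \<rho>)^2"
    by (simp add: algebra_simps power2_eq_square)
  then show 2: "(k^2 - r^2) * (m - \<rho>)^2 = 4 * r^2 * m * \<rho>"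
    unfolding k by (simp add: algebra_simps power2_eq_square)
  have "t * r^2 * \<rho> = (r - 1)^2"
  proof -
    have "t * r^2 = (1 - r) * (1 + r)" using r_eq by (simp add: algebra_simps power2_eq_square)
    then have "t * r^2 * \<rho> = (1 - r) * ((1 + r) * \<rho>)" by simp
    then show ?thesis unfolding rho_eq by (simp add: power2_eq_square algebra_simps)
  qed
  then have 3: "t * (4 * r^2 * m * \<rho>) * (m - 1)^2 = 4 * m * ((r - 1) * (m - 1))^2"
    by (simp add: power_mult_distrib) (simp add: algebra_simps)
  have "(t * (k^2 - r^2) * (m - 1)^2) * (m - \<rho>)^2 = t * ((k^2 - r^2) * (m - \<rho>)^2) * (m - 1)^2"
    by (simp only: ac_simps)
  also have "\<dots> = 4 * m * ((k - 1) * (m - \<rho>))^2" unfolding 2 3 1 ..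
  also have "\<dots> = (4 * m * (k - 1)^2) * (m - \<rho>)^2" by (simp only: power_mult_distrib ac_simps)
  finally show "t * (k^2 - r^2) * (m - 1)^2 = 4 * m * (k - 1)^2" using assms(1) by simp
qed

lemma four: "(4::'a) \<noteq> 0"
proof -
  have "(4::'a) = 2 * 2" by simp
  then show ?thesis using two by (metis mult_eq_0_iff)
qed

text \<open>\<open>1 / (e^2 - 1) = (x * z - 1)^2 / (4 * z * (z + 1) * (x + 1))\<close> and
  \<open>(k - 1)^2 / (k^2 - r^2) = t * (x * z - 1)^2 / (4 * x * (x + 1) * (z + 1))\<close> add up to \<open>p^2\<close>. The proof clears these
  denominators.\<close>

lemma plane_to_mid:
  assumes ok: "plane_ok x z" and y: "y^2 = x * z * (x + 1) * (z + 1) * (x + z * t)"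
  shows "mid (plane_k x z) (plane_e x z) (plane_p x z y)"
proof -
  define m k e p where "m = plane_m x z" and "k = plane_k x z" and "e = plane_e x z" and "p = plane_p x z y"
  from ok have nz: "x \<noteq> 0" "z \<noteq> 0" "x + 1 \<noteq> 0" "z + 1 \<noteq> 0" "x * z - 1 \<noteq> 0" "m - \<rho> \<noteq> 0"
    by (auto simp: plane_ok_def m_def)
  have m1: "m * (x + 1) = x * (z + 1)" using nz by (simp add: m_def plane_m_def)
  then have "(m - 1) * (x + 1) = x * z - 1" by (simp add: algebra_simps)
  note m = m1 this
  have m0: "m \<noteq> 0" "m - 1 \<noteq> 0" using m nz by auto
  note km = k_of_m[OF nz(6), of k]
  have k: "k = r * (m + \<rho>) / (m - \<rho>)" by (simp add: k_def plane_k_def m_def)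
  have r1: "r - 1 \<noteq> 0" using r_pm(1) by auto
  have k1: "k - 1 \<noteq> 0" using km(1)[OF k] r1 m0 by auto
  have kr: "k^2 - r^2 \<noteq> 0" using km(2)[OF k] four r0 m0 rho0 by auto
  have ez: "e * (x * z - 1) = x * z + 2 * z + 1" using nz by (simp add: e_def plane_e_def)
  have E: "(e^2 - 1) * (x * z - 1)^2 = 4 * (z * (z + 1) * (x + 1))"
  proof -
    have "(e^2 - 1) * (x * z - 1)^2 = (e * (x * z - 1))^2 - (x * z - 1)^2"
      by (simp add: algebra_simps power2_eq_square)
    then show ?thesis unfolding ez by (simp add: algebra_simps power2_eq_square)
  qed
  have e1: "e^2 - 1 \<noteq> 0" using E four nz by auto
  define S where "S = (x + 1) * (z + 1) * x * z"
  have S: "S \<noteq> 0" using nz by (simp add: S_def)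
  have "p * (2 * S) = y * (x * z - 1)" using two S by (simp add: p_def plane_p_def flip: S_def)
  then have "(p * (2 * S))^2 = y^2 * (x * z - 1)^2" by (simp add: power_mult_distrib)
  also have "y^2 = S * (x + z * t)" unfolding y S_def by (simp add: algebra_simps)
  finally have "S * (4 * (p^2 * S)) = S * ((x + z * t) * (x * z - 1)^2)"
    by (simp add: power2_eq_square ac_simps)
  \<comment> \<open>This is \<open>4 * p^2 = (x * z - 1)^2 / ((x + 1) * (z + 1)) * (1 / z + t / x)\<close>.\<close>
  then have P: "4 * (p^2 * S) = (x + z * t) * (x * z - 1)^2" using S by simp
  have K: "t * (k^2 - r^2) * (x * z - 1)^2 = 4 * (k - 1)^2 * (x * (x + 1) * (z + 1))"
  proof -
    have "t * (k^2 - r^2) * (x * z - 1)^2 = (t * (k^2 - r^2) * (m - 1)^2) * (x + 1)^2"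
      unfolding m(2)[symmetric] by (simp add: power_mult_distrib)
    also have "\<dots> = 4 * (m * (x + 1)) * (k - 1)^2 * (x + 1)"
      unfolding km(3)[OF k] by (simp add: power2_eq_square algebra_simps)
    finally show ?thesis unfolding m(1) by (simp add: algebra_simps)
  qed
  have "(4 * S * (x * z - 1)^2) * (p^2 * (k^2 - r^2) * (e^2 - 1))
      = (4 * (p^2 * S)) * (k^2 - r^2) * ((e^2 - 1) * (x * z - 1)^2)"
    by (simp add: algebra_simps)
  also have "\<dots> = 4 * (z * (z + 1) * (x + 1)) * ((k^2 - r^2) * x * (x * z - 1)^2
      + z * (t * (k^2 - r^2) * (x * z - 1)^2))"
    unfolding P E by (simp add: algebra_simps)
  also have "\<dots> = 4 * S * (x * z - 1)^2 * (k^2 - r^2)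
      + 4 * S * (k - 1)^2 * (4 * (z * (z + 1) * (x + 1)))"
    unfolding K by (simp add: S_def algebra_simps power2_eq_square)
  also have "\<dots> = (4 * S * (x * z - 1)^2) * ((k - 1)^2 * (e^2 - 1) + (k^2 - r^2))"
    unfolding E[symmetric] by (simp add: algebra_simps)
  finally have "p^2 * (k^2 - r^2) * (e^2 - 1) = (k - 1)^2 * (e^2 - 1) + (k^2 - r^2)"
    using four S nz by simp
  then show ?thesis using k1 kr e1 by (simp add: mid_def flip: k_def e_def p_def)
qed

text \<open>Invert the Moebius transformations to get \<open>m\<close> and \<open>n\<close>; then \<open>x = m * (n - 1) / (m - 1)\<close> and
  \<open>z = n * (m - 1) / (n - 1)\<close>.\<close>

lemma mid_to_plane:
  assumes mid: "mid k e p" and ne: "(e^2 - 1) * (k - 1)^2 \<noteq> t * (k^2 - r^2)"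
  shows "\<exists>x z y. plane_ok x z \<and> y^2 = x * z * (x + 1) * (z + 1) * (x + z * t) \<and>
    plane_k x z = k \<and> plane_e x z = e \<and> plane_p x z y = p"
proof -
  from mid have k1: "k - 1 \<noteq> 0" and kr: "k^2 - r^2 \<noteq> 0" and e1: "e^2 - 1 \<noteq> 0"
    and rel: "p^2 * (k^2 - r^2) * (e^2 - 1) = (k - 1)^2 * (e^2 - 1) + (k^2 - r^2)"
    by (auto simp: mid_def)
  have "k^2 - r^2 = (k - r) * (k + r)" "e^2 - 1 = (e - 1) * (e + 1)"
    by (simp_all add: algebra_simps power2_eq_square)
  then have nz: "k - r \<noteq> 0" "k + r \<noteq> 0" "e - 1 \<noteq> 0" "e + 1 \<noteq> 0" using kr e1 by auto
  define m where "m = \<rho> * (k + r) / (k - r)"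
  define n where "n = (e + 1) / (e - 1)"
  have mk: "m * (k - r) = \<rho> * (k + r)" using nz by (simp add: m_def)
  have m0: "m \<noteq> 0" and n0: "n \<noteq> 0" using nz rho0 by (simp_all add: m_def n_def)
  have "(m - \<rho>) * (k - r) = 2 * r * \<rho>" using mk by (simp add: algebra_simps)
  then have mr: "m - \<rho> \<noteq> 0" using two r0 rho0 by auto
  have "k * (m - \<rho>) = r * (m + \<rho>)" using mk by (simp add: algebra_simps)
  then have k: "k = r * (m + \<rho>) / (m - \<rho>)" using mr by (simp add: field_simps)
  note km = k_of_m[OF mr k]
  have m1: "m - 1 \<noteq> 0" using km(1) k1 mr by auto
  have ne': "n * (e - 1) = e + 1" using nz by (simp add: n_def)
  then have "(n - 1) * (e - 1) = 2" by (simp add: algebra_simps)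
  then have n1: "n - 1 \<noteq> 0" using two by auto
  from ne' have en: "e * (n - 1) = n + 1" by (simp add: algebra_simps)
  have e2: "(e^2 - 1) * (n - 1)^2 = 4 * n"
  proof -
    have "(e^2 - 1) * (n - 1)^2 = (e * (n - 1))^2 - (n - 1)^2" by (simp add: algebra_simps power2_eq_square)
    then show ?thesis unfolding en by (simp add: algebra_simps power2_eq_square)
  qed
  \<comment> \<open>If \<open>n = 1 / m\<close>, then \<open>n / (n - 1)^2 = m / (m - 1)^2\<close>, which is the excluded relation between \<open>e\<close> and \<open>k\<close>.\<close>
  have mn: "m * n - 1 \<noteq> 0"
  proof
    assume "m * n - 1 = 0"
    then have mn: "m * n = 1" by simp
    then have "m * (n - 1) = - (m - 1)" by (simp add: algebra_simps)
    then have "m^2 * (n - 1)^2 = (m - 1)^2" by (metis power_mult_distrib power2_minus)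
    then have "(e^2 - 1) * (m - 1)^2 = m^2 * ((e^2 - 1) * (n - 1)^2)" by (simp add: algebra_simps)
    also have "\<dots> = 4 * m * (m * n)" unfolding e2 by (simp add: power2_eq_square algebra_simps)
    finally have *: "(e^2 - 1) * (m - 1)^2 = 4 * m" by (simp add: mn)
    have "(m - 1)^2 * ((e^2 - 1) * (k - 1)^2) = ((e^2 - 1) * (m - 1)^2) * (k - 1)^2"
      by (simp only: ac_simps)
    also have "\<dots> = (m - 1)^2 * (t * (k^2 - r^2))" unfolding * km(3)[symmetric] by (simp only: ac_simps)
    finally show False using ne m1 by simp
  qed
  define a b where "a = m - 1" and "b = n - 1"
  have ab: "a \<noteq> 0" "b \<noteq> 0" using m1 n1 by (simp_all add: a_def b_def)
  define x z where "x = m * b / a" and "z = n * a / b"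
  define y where "y = 2 * p * (m * n) * (m * n - 1) / (a * b)"
  have xz: "x * z = m * n" using ab by (simp add: x_def z_def)
  have x1: "x + 1 = (m * n - 1) / a" and z1: "z + 1 = (m * n - 1) / b"
    using ab by (simp_all add: x_def z_def field_simps) (simp_all add: a_def b_def algebra_simps)
  have pm: "plane_m x z = m"
    unfolding plane_m_def x1 z1 using ab mn by (simp add: x_def)
  have ok: "plane_ok x z"
    unfolding plane_ok_def pm xz x1 z1 using m0 n0 ab mn mr by (simp add: x_def z_def)
  moreover have "plane_k x z = k" unfolding plane_k_def pm by (rule k[symmetric])
  moreover have "plane_e x z = e"
  proof -
    have "x * z + 2 * z + 1 = (m * n - 1) + 2 * (z + 1)" by (simp add: xz)
    also have "\<dots> = (m * n - 1) * ((n + 1) / b)"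
      unfolding z1 using ab by (simp add: field_simps) (simp add: b_def algebra_simps)
    also have "(n + 1) / b = e" using en ab by (simp add: b_def field_simps)
    finally show ?thesis unfolding plane_e_def xz using mn by simp
  qed
  moreover have S: "(x + 1) * (z + 1) * x * z = (m * n - 1)^2 * (m * n) / (a * b)"
    unfolding mult.assoc[of _ x z] xz x1 z1 by (simp add: power2_eq_square)
  have "plane_p x z y = p"
    unfolding plane_p_def S xz y_def using ab mn m0 n0 two by (simp add: power2_eq_square)
  moreover have "y^2 = x * z * (x + 1) * (z + 1) * (x + z * t)"
  proof -
    have "(4 * p^2 * (m * n)) * ((k^2 - r^2) * (e^2 - 1)) * b^2 =
        4 * m * n * b^2 * (p^2 * (k^2 - r^2) * (e^2 - 1))"
      by (simp add: algebra_simps)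
    also have "\<dots> = n * (4 * m * (k - 1)^2) * ((e^2 - 1) * b^2) + 4 * m * n * b^2 * (k^2 - r^2)"
      unfolding rel by (simp add: algebra_simps)
    also have "\<dots> = n * (t * (k^2 - r^2) * a^2) * ((e^2 - 1) * b^2) + m * b^2 * (k^2 - r^2) * (4 * n)"
      unfolding km(3)[symmetric] a_def[symmetric] by (simp only: ac_simps)
    also have "\<dots> = (k^2 - r^2) * (e^2 - 1) * b^2 * (n * t * a^2 + m * b^2)"
      unfolding e2[folded b_def, symmetric] by (simp add: algebra_simps)
    finally have *: "4 * p^2 * (m * n) = n * t * a^2 + m * b^2"
      using kr e1 ab by (simp add: mult.assoc)
    have "y^2 = (4 * p^2 * (m * n)) * (m * n) * (m * n - 1)^2 / (a * b)^2"
      unfolding y_def by (simp add: power_divide power_mult_distrib) (simp add: power2_eq_square)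
    also have "\<dots> = ((x + 1) * (z + 1) * x * z) * ((n * t * a^2 + m * b^2) / (a * b))"
      unfolding * S using ab by (simp add: power2_eq_square)
    also have "(n * t * a^2 + m * b^2) / (a * b) = x + z * t"
      using ab by (simp add: x_def z_def field_simps power2_eq_square)
    finally show ?thesis by (simp add: algebra_simps)
  qed
  ultimately show ?thesis by blast
qed

end

context square_root_parameter
begin

definition plane_to_triple :: "'a \<Rightarrow> 'a \<Rightarrow> 'a \<Rightarrow> 'a \<times> 'a \<times> 'a" where
  "plane_to_triple x z y =
     (let k = plane_k x z; e = plane_e x z; p = plane_p x z y in (prod1 k p, prod2 k e, prodw k e p))"

text \<open>Once \<open>y1\<close> is chosen, \<open>w\<close> determines \<open>y2\<close> unless \<open>y1 = 0\<close>; in that case \<open>w = 0\<close>, and any square root serves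
  as \<open>y2\<close>.\<close>

lemma plane_to_triple_on_EE:
  assumes "plane_ok x z" "y^2 = x * z * (x + 1) * (z + 1) * (x + z * t)"
  obtains x1 y1 x2 y2 where "plane_to_triple x z y = (x1, x2, y1 * y2)"
    "y1^2 = cubic t x1" "y2^2 = cubic t x2"
proof -
  obtain x1 x2 w where tr: "plane_to_triple x z y = (x1, x2, w)" by (cases "plane_to_triple x z y")
  then have w: "w^2 = cubic t x1 * cubic t x2"
    using mid_to_product[OF plane_to_mid[OF assms]] by (auto simp: plane_to_triple_def Let_def)
  obtain y1 where y1: "y1^2 = cubic t x1" using nth_root_exists[of 2] by auto
  show ?thesis
  proof (cases "y1 = 0")
    case True
    obtain y2 where "y2^2 = cubic t x2" using nth_root_exists[of 2] by auto
    moreover have "w = y1 * y2" using w y1 True by simp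
    ultimately show ?thesis using that tr y1 by blast
  next
    case False
    have "(w / y1)^2 = cubic t x2" using w False unfolding y1[symmetric] by (simp add: power_divide)
    moreover have "w = y1 * (w / y1)" using False by simp
    ultimately show ?thesis using that[of x1 x2 y1 "w / y1"] tr y1 by simp
  qed
qed

lemma plane_to_triple_surj:
  assumes "y1^2 = cubic t x1" "y2^2 = cubic t x2" "good x1 x2 \<noteq> 0"
  obtains x z y where "plane_ok x z" "y^2 = x * z * (x + 1) * (z + 1) * (x + z * t)"
    "plane_to_triple x z y = (x1, x2, y1 * y2)"
proof -
  have "(y1 * y2)^2 = cubic t x1 * cubic t x2" using assms by (simp add: power_mult_distrib)
  then obtain k e p where mid: "mid k e p" "(e^2 - 1) * (k - 1)^2 \<noteq> t * (k^2 - r^2)"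
    and "prod1 k p = x1" "prod2 k e = x2" "prodw k e p = y1 * y2"
    using product_to_mid assms(3) by blast
  moreover from mid_to_plane[OF mid] obtain x z y where
    "plane_ok x z" "y^2 = x * z * (x + 1) * (z + 1) * (x + z * t)"
    "plane_k x z = k" "plane_e x z = e" "plane_p x z y = p" by blast
  ultimately show ?thesis using that by (simp add: plane_to_triple_def Let_def)
qed

text \<open>For \<open>x1 = 0\<close> all factors of \<open>good\<close> are nonzero constants or nonzero polynomials in \<open>x2\<close>.\<close>

lemma good_point:
  obtains x1 y1 x2 y2 where "y1^2 = cubic t x1" "y2^2 = cubic t x2" "y1 \<noteq> 0" "good x1 x2 \<noteq> 0"
proof -
  have "infinite (UNIV - {0, r, - r, r^2, 1 :: 'a})" using infinite_alg_closed by simp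
  then obtain x2 :: 'a where "x2 \<in> UNIV - {0, r, - r, r^2, 1}" by (metis ex_in_conv finite.emptyI)
  then have x2: "x2 \<noteq> 0" "x2 - r \<noteq> 0" "x2 + r \<noteq> 0" "r^2 - x2 \<noteq> 0" "1 - x2 \<noteq> 0"
    by (auto simp: add_eq_0_iff2)
  have "x2^2 - r^2 = (x2 - r) * (x2 + r)" by (simp add: algebra_simps power2_eq_square)
  moreover have "good 0 x2 = x2 * r^2 * (x2^2 - r^2) * (r^2 - x2) * (r^2 - x2 + t * r^2)"
    by (simp add: good_def)
  moreover have "r^2 - x2 + t * r^2 = 1 - x2" using r_eq by (simp add: algebra_simps)
  ultimately have good: "good 0 x2 \<noteq> 0" using x2 r0 by simp
  obtain y1 where y1: "y1^2 = cubic t 0" using nth_root_exists[of 2] by auto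
  obtain y2 where y2: "y2^2 = cubic t x2" using nth_root_exists[of 2] by auto
  have "cubic t 0 \<noteq> 0" using r0 by (simp add: cubic_r)
  then have "y1 \<noteq> 0" using y1 by auto
  then show ?thesis using that y1 y2 good by blast
qed

lemma good_polyfun: "(\<lambda>(x1, x2, w). good x1 x2) \<in> polyfuns UNIV triple_coords"
proof -
  let ?x1 = "\<lambda>(x1 :: 'a, x2 :: 'a, w :: 'a). x1" and ?x2 = "\<lambda>(x1 :: 'a, x2 :: 'a, w :: 'a). x2"
  have x: "?x1 \<in> polyfuns UNIV triple_coords" "?x2 \<in> polyfuns UNIV triple_coords" by (auto intro: polyfuns.base)
  have "(\<lambda>v. good (?x1 v) (?x2 v)) \<in> polyfuns UNIV triple_coords"
    unfolding good_def power2_eq_square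
    by (intro polyfuns.mult polyfuns_diff polyfuns.add x polyfuns.const coeff_ring_UNIV UNIV_I)
  then show ?thesis by (simp add: case_prod_unfold)
qed

text \<open>The coordinates with indices 5, 8, 9, 10 are \<open>x * u^2\<close>, \<open>z * u^2\<close>, \<open>u^3\<close>, \<open>y\<close>, whose ratios give the affine
  coordinates. The form vanishes at infinity and where \<open>plane_ok\<close> fails.\<close>

definition ok_form :: "(nat \<Rightarrow> 'a) \<Rightarrow> 'a" where
  "ok_form v = v 9 * (v 5 * (v 8 * ((v 5 + v 9) * ((v 8 + v 9) * ((v 5 * v 8 - v 9 * v 9) *
     (v 5 * (v 8 + v 9) - \<rho> * ((v 5 + v 9) * v 9)))))))"

lemma ok_form_iff:
  assumes "v 9 \<noteq> 0"
  shows "ok_form v \<noteq> 0 \<longleftrightarrow> plane_ok (v 5 / v 9) (v 8 / v 9)"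
proof -
  define x z s where "x = v 5 / v 9" and "z = v 8 / v 9" and "s = v 9"
  have v: "v 5 = s * x" "v 8 = s * z" "v 9 = s" and s: "s \<noteq> 0" using assms by (auto simp: x_def z_def s_def)
  have "ok_form v = s * (s * x * (s * z * (s * (x + 1) * (s * (z + 1) * (s^2 * (x * z - 1) *
      (s^2 * (x * (z + 1) - \<rho> * (x + 1))))))))"
    unfolding ok_form_def v by (simp add: algebra_simps power2_eq_square)
  moreover have "x * (z + 1) - \<rho> * (x + 1) \<noteq> 0 \<longleftrightarrow> plane_m x z - \<rho> \<noteq> 0" if "x + 1 \<noteq> 0"
    using that by (simp add: plane_m_def field_simps)
  ultimately show ?thesis using s by (auto simp: plane_ok_def simp flip: x_def z_def)
qed

lemma double_plane_affine:
  assumes "proj v \<in> pts (double_plane t)" "v 9 \<noteq> 0"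
  defines "x \<equiv> v 5 / v 9" and "z \<equiv> v 8 / v 9" and "y \<equiv> v 10 / v 9"
  shows "y^2 = x * z * (x + 1) * (z + 1) * (x + z * t)"
proof -
  from assms(1) obtain a b u q where "proj (plane_vec a b u q) = proj v" and q: "q^2 = sextic t (a, b, u)"
    by (auto simp: pts_double_plane)
  then obtain s where s: "s \<noteq> 0" "v = (\<lambda>i. s * plane_vec a b u q i)" by (auto simp: proj_eq_iff)
  have v: "v 5 = s * (a * u^2)" "v 8 = s * (b * u^2)" "v 9 = s * u^3" "v 10 = s * q"
    unfolding s(2) by (simp_all add: plane_vec_def)
  have u: "u \<noteq> 0" using assms(2) v by auto
  define x' z' y' where "x' = a / u" and "z' = b / u" and "y' = q / u^3"
  have ab: "a = u * x'" "b = u * z'" "q = u^3 * y'" using u by (simp_all add: x'_def z'_def y'_def)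
  have xyz: "x = x'" "z = z'" "y = y'"
    unfolding x_def z_def y_def v ab using s u by (simp_all add: power2_eq_square power3_eq_cube)
  have "u^6 * y'^2 = u^6 * (x' * z' * (x' + 1) * (z' + 1) * (x' + z' * t))"
    using q unfolding sextic_def prod.case ab
    by (simp add: power_mult_distrib) (simp add: algebra_simps power2_eq_square eval_nat_numeral)
  then show ?thesis unfolding xyz using u by simp
qed

lemma affine_in_double_plane:
  assumes "y^2 = x * z * (x + 1) * (z + 1) * (x + z * t)"
  shows "proj (plane_vec x z 1 y) \<in> pts (double_plane t)"
proof -
  have "y^2 = sextic t (x, z, 1)" using assms by (simp add: sextic_def algebra_simps)
  then show ?thesis unfolding pts_double_plane by (intro CollectI exI[of _ x] exI[of _ z] exI[of _ 1] exI[of _ y]) auto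
qed

lemma plane_vec_affine [simp]:
  "plane_vec x z 1 y 5 = x" "plane_vec x z 1 y 8 = z" "plane_vec x z 1 y 9 = 1" "plane_vec x z 1 y 10 = y"
  by (simp_all add: plane_vec_def)

lemma triple_ratfuns:
  assumes K: "coeff_ring K" and r: "r \<in> K" and rho: "\<rho> \<in> K"
    and b: "b \<in> triple_coords"
  shows "(\<lambda>v. b (plane_to_triple (v 5 / v 9) (v 8 / v 9) (v 10 / v 9))) \<in> ratfuns K 10 (\<lambda>v. ok_form v \<noteq> 0)"
proof -
  let ?S = "ratfuns K 10 (\<lambda>v. ok_form v \<noteq> 0)"
  have v9: "v 9 \<noteq> 0" if "ok_form v \<noteq> 0" for v using that by (auto simp: ok_form_def)
  have okI: "plane_ok (v 5 / v 9) (v 8 / v 9)" if "ok_form v \<noteq> 0" for v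
    using that ok_form_iff[of v, OF v9[OF that]] by simp
  note alg = function_algebra_ratfuns[OF K]
  note S = function_algebraD(2,3)[OF alg]
  have K1: "1 \<in> K" "-1 \<in> K" "2 \<in> K"
  proof -
    show "1 \<in> K" "-1 \<in> K" using K by (auto simp: coeff_ring_def)
    then have "1 + 1 \<in> K" using K unfolding coeff_ring_def by blast
    then show "2 \<in> K" by simp
  qed
  note c = function_algebraD(1)[OF alg]
  have diff: "(\<lambda>v. f v - g v) \<in> ?S" if "f \<in> ?S" "g \<in> ?S" for f g
    using S(1)[OF that(1) S(2)[OF c[OF K1(2)] that(2)]] by simp
  have div: "(\<lambda>v. f v / g v) \<in> ?S" if "f \<in> ?S" "g \<in> ?S" "\<And>v. ok_form v \<noteq> 0 \<Longrightarrow> g v \<noteq> 0" for f g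
    using S(2)[OF that(1) ratfuns_inverse[OF that(2,3)]] by (simp add: divide_inverse)
  define x z y :: "(nat \<Rightarrow> 'a) \<Rightarrow> 'a"
    where "x = (\<lambda>v. v 5 / v 9)" and "z = (\<lambda>v. v 8 / v 9)" and "y = (\<lambda>v. v 10 / v 9)"
  have xyz: "x \<in> ?S" "z \<in> ?S" "y \<in> ?S"
    unfolding x_def z_def y_def by (rule ratfuns_coord[OF K _ _ v9]; simp)+
  have ok: "x v \<noteq> 0" "z v \<noteq> 0" "x v + 1 \<noteq> 0" "z v + 1 \<noteq> 0" "x v * z v - 1 \<noteq> 0"
    "plane_m (x v) (z v) - \<rho> \<noteq> 0" if "ok_form v \<noteq> 0" for v
    using okI[OF that] by (auto simp: plane_ok_def x_def z_def)
  have m: "(\<lambda>v. plane_m (x v) (z v)) \<in> ?S"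
    unfolding plane_m_def by (intro div S xyz c K1 ok)
  have k: "(\<lambda>v. plane_k (x v) (z v)) \<in> ?S"
    unfolding plane_k_def by (intro div diff S c r rho m ok)
  have e: "(\<lambda>v. plane_e (x v) (z v)) \<in> ?S"
    unfolding plane_e_def by (intro div diff S xyz c K1 ok)
  have p: "(\<lambda>v. plane_p (x v) (z v) (y v)) \<in> ?S"
    unfolding plane_p_def
    by (intro div diff S xyz c K1) (use two ok in auto)
  have k1: "plane_k (x v) (z v) - 1 \<noteq> 0" if "ok_form v \<noteq> 0" for v
  proof -
    note ok = ok[OF that]
    have "(plane_m (x v) (z v) - 1) * (x v + 1) = x v * z v - 1"
      using ok(3) by (simp add: plane_m_def left_diff_distrib) (simp add: algebra_simps)
    then have "plane_m (x v) (z v) - 1 \<noteq> 0" using ok(5) by auto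
    moreover have "r - 1 \<noteq> 0" using r_pm(1) by auto
    ultimately show ?thesis using k_of_m(1)[OF ok(6) plane_k_def] by auto
  qed
  have 1: "(\<lambda>v. prod1 (plane_k (x v) (z v)) (plane_p (x v) (z v) (y v))) \<in> ?S"
    unfolding prod1_def power2_eq_square by (intro div diff S c K1 r k p k1)
  have 2: "(\<lambda>v. prod2 (plane_k (x v) (z v)) (plane_e (x v) (z v))) \<in> ?S"
    unfolding prod2_def power2_eq_square by (intro diff S c K1 k e)
  have 3: "(\<lambda>v. prodw (plane_k (x v) (z v)) (plane_e (x v) (z v)) (plane_p (x v) (z v) (y v))) \<in> ?S"
    unfolding prodw_def power2_eq_square by (intro diff S c r 1 2 k e p)
  from b 1 2 3 have "(\<lambda>v. b (plane_to_triple (x v) (z v) (y v))) \<in> ?S"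
    by (auto simp: plane_to_triple_def Let_def)
  then show ?thesis by (simp add: x_def z_def y_def)
qed

text \<open>The composition of \<open>plane_to_triple\<close> with a chart \<open>R\<close> of the quotient, written with a common denominator and
  multiplied by \<open>ok_form\<close> in order to be undefined where the explicit formulas are meaningless. The image
  contains the classes of all points of \<open>E \<times> E\<close> with \<open>good \<noteq> 0\<close> at which \<open>R\<close> does not vanish.\<close>

lemma double_plane_dominates_quotient:
  assumes K0: "coeff_ring K0" "1 / (t + 1) \<in> K0" and K: "coeff_ring K" "K0 \<subseteq> K" "r \<in> K" "\<rho> \<in> K"
    and quot: "involution_quotient K0 (EE t) (EE_neg t) Q q"
  shows "\<exists>\<phi>. dominates K 10 (pts (double_plane t)) (amb Q) (pts Q) \<phi>"
proof -
  let ?n = "amb Q" and ?D = "pts (double_plane t)"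
  have mor: "morphism K0 (EE t) Q q" using quot by (simp add: involution_quotient_def)
  obtain a1 b1 a2 b2 where pt: "b1^2 = cubic t a1" "b2^2 = cubic t a2" "b1 \<noteq> 0" "good a1 a2 \<noteq> 0"
    by (rule good_point)
  obtain R where R_poly: "\<And>i. i \<le> ?n \<Longrightarrow> R i \<in> polyfuns K0 triple_coords"
    and R_pt: "\<exists>i\<le>?n. R i (a1, a2, b1 * b2) \<noteq> 0"
    and R_rep: "\<And>x1 y1 x2 y2. y1^2 = cubic t x1 \<Longrightarrow> y2^2 = cubic t x2 \<Longrightarrow> \<exists>i\<le>?n. R i (x1, x2, y1 * y2) \<noteq> 0 \<Longrightarrow>
      q (proj (EE_vec x1 y1 x2 y2)) = proj (cut ?n (\<lambda>i. R i (x1, x2, y1 * y2)))"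
    by (rule quotient_chart[OF K0 two quot pt(1,2,3)]) (rule that)
  define h where "h v = plane_to_triple (v 5 / v 9) (v 8 / v 9) (v 10 / v 9)" for v :: "nat \<Rightarrow> 'a"
  have ratR: "(\<lambda>v. R i (h v)) \<in> ratfuns K 10 (\<lambda>v. ok_form v \<noteq> 0)" if "i \<le> ?n" for i
    by (rule polyfuns_subst[OF polyfuns_mono[OF R_poly[OF that] K(2)] function_algebra_ratfuns[OF K(1)]])
       (use triple_ratfuns[OF K(1,3,4)] in \<open>simp only: h_def\<close>)
  obtain d N D where N: "\<And>i. i \<le> ?n \<Longrightarrow> form_fun K 10 d (N i)" "\<And>v. ok_form v \<noteq> 0 \<Longrightarrow> D v \<noteq> 0"
    "\<And>i v. i \<le> ?n \<Longrightarrow> ok_form v \<noteq> 0 \<Longrightarrow> R i (h v) = N i v / D v"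
    by (rule ratfuns_common_denominator[where m = ?n and g = "\<lambda>i v. R i (h v)", OF K(1) ratR])
      (auto intro: that)
  have ok_form: "form_fun K 10 (1 + (1 + (1 + (1 + (1 + ((1 + 1) + (1 + 1))))))) ok_form"
  proof -
    have c: "form_fun K 10 1 (\<lambda>v. v i)" if "i \<le> 10" for i using that by (intro form_fun_coord K)
    show ?thesis
      unfolding ok_form_def
      by (intro form_fun_mult form_fun_diff form_fun_add form_fun_cmult K c; simp)
  qed
  define \<phi> where "\<phi> i v = ok_form v * N i v" for i v
  have \<phi>_eq: "\<phi> i v = (ok_form v * D v) * R i (h v)" if "ok_form v \<noteq> 0" "i \<le> ?n" for i v
    using N(2,3) that by (simp add: \<phi>_def)
  have from_EE: "\<exists>v. proj v \<in> ?D \<and> ok_form v \<noteq> 0 \<and> h v = (x1, x2, y1 * y2)"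
    if E: "y1^2 = cubic t x1" "y2^2 = cubic t x2" "good x1 x2 \<noteq> 0" for x1 y1 x2 y2
  proof -
    obtain x z y where *: "plane_ok x z" "y^2 = x * z * (x + 1) * (z + 1) * (x + z * t)"
      "plane_to_triple x z y = (x1, x2, y1 * y2)" by (rule plane_to_triple_surj[OF E]) (rule that)
    show ?thesis
      using affine_in_double_plane[OF *(2)] ok_form_iff[of "plane_vec x z 1 y"] *
      by (intro exI[of _ "plane_vec x z 1 y"]) (simp add: h_def)
  qed
  have R_pos: "proj (cut ?n (\<lambda>i. R i (h v))) \<in> pts Q"
    if v: "proj v \<in> ?D" "ok_form v \<noteq> 0" and nz: "\<exists>i\<le>?n. R i (h v) \<noteq> 0" for v
  proof -
    have v9: "v 9 \<noteq> 0" using v by (auto simp: ok_form_def)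
    have "plane_ok (v 5 / v 9) (v 8 / v 9)" using ok_form_iff[of v, OF v9] v by simp
    then obtain x1 y1 x2 y2 where y: "h v = (x1, x2, y1 * y2)" "y1^2 = cubic t x1" "y2^2 = cubic t x2"
      unfolding h_def using double_plane_affine[OF v(1) v9] by (rule plane_to_triple_on_EE)
    then have "q (proj (EE_vec x1 y1 x2 y2)) = proj (cut ?n (\<lambda>i. R i (h v)))"
      using R_rep[OF y(2,3)] nz by simp
    moreover have "q (proj (EE_vec x1 y1 x2 y2)) \<in> pts Q"
      using morphism_in[OF mor affine_in_EE[OF y(2,3)]] .
    ultimately show ?thesis by simp
  qed
  have "dominates K 10 ?D ?n (pts Q) \<phi>"
    unfolding dominates_def
  proof (intro conjI allI impI)
    show "\<exists>d. \<forall>j\<le>?n. form_fun K 10 d (\<phi> j)"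
      unfolding \<phi>_def using form_fun_mult[OF K(1) ok_form N(1)] by blast
    obtain v where v: "proj v \<in> ?D" "ok_form v \<noteq> 0" "h v = (a1, a2, b1 * b2)"
      using from_EE[OF pt(1,2,4)] by blast
    then show "\<exists>v. proj v \<in> ?D \<and> (\<exists>j\<le>?n. \<phi> j v \<noteq> 0)"
      using R_pt \<phi>_eq[OF v(2)] N(2)[OF v(2)] by (intro exI[of _ v]) auto
  next
    fix v assume v: "proj v \<in> ?D" and nz: "\<exists>j\<le>?n. \<phi> j v \<noteq> 0"
    then have ok: "ok_form v \<noteq> 0" by (auto simp: \<phi>_def)
    have "cut ?n (\<lambda>j. \<phi> j v) = (\<lambda>i. (ok_form v * D v) * cut ?n (\<lambda>i. R i (h v)) i)"
      using \<phi>_eq[OF ok] by (auto simp: cut_def fun_eq_iff)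
    moreover have "\<exists>i\<le>?n. R i (h v) \<noteq> 0" using nz \<phi>_eq[OF ok] by auto
    ultimately show "proj (cut ?n (\<lambda>j. \<phi> j v)) \<in> pts Q"
      using R_pos[OF v ok] proj_scale[of "ok_form v * D v"] ok N(2)[OF ok] by simp
  next
    fix e \<psi> u assume \<psi>: "form_fun UNIV ?n e \<psi>" and u: "proj u \<in> pts Q"
      and van: "\<forall>v. proj v \<in> ?D \<longrightarrow> (\<exists>j\<le>?n. \<phi> j v \<noteq> 0) \<longrightarrow> \<psi> (\<lambda>j. \<phi> j v) = 0"
    obtain i where i: "i \<le> ?n" "R i (a1, a2, b1 * b2) \<noteq> 0" using R_pt by blast
    let ?g = "\<lambda>v. (\<lambda>(x1, x2, w). good x1 x2) v * R i v"
    have g: "?g \<in> polyfuns UNIV triple_coords"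
      by (intro polyfuns.mult good_polyfun polyfuns_mono[OF R_poly[OF i(1)]]) simp
    show "\<psi> u = 0"
    proof (rule quotient_density[OF quot g pt(1,2) _ \<psi> _ u])
      show "?g (a1, a2, b1 * b2) \<noteq> 0" using pt(4) i by simp
      fix x1 y1 x2 y2 u'
      assume y: "y1^2 = cubic t x1" "y2^2 = cubic t x2" and nz: "?g (x1, x2, y1 * y2) \<noteq> 0"
        and u': "q (proj (EE_vec x1 y1 x2 y2)) = proj u'"
      from nz have "good x1 x2 \<noteq> 0" and Ri: "R i (x1, x2, y1 * y2) \<noteq> 0" by auto
      then obtain v where v: "proj v \<in> ?D" "ok_form v \<noteq> 0" "h v = (x1, x2, y1 * y2)"
        using from_EE[OF y] by blast
      let ?s = "ok_form v * D v"
      have s: "?s \<noteq> 0" using v(2) N(2) by simp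
      have "\<phi> i v \<noteq> 0" using \<phi>_eq[OF v(2) i(1)] s Ri v(3) by simp
      then have "\<psi> (\<lambda>j. \<phi> j v) = 0" using van v(1) i(1) by blast
      moreover have "\<psi> (\<lambda>j. \<phi> j v) = \<psi> (\<lambda>j. ?s * R j (h v))"
        by (rule form_fun_cong[OF \<psi>]) (rule \<phi>_eq[OF v(2)])
      ultimately have R0: "\<psi> (\<lambda>j. R j (h v)) = 0"
        using form_fun_scale[OF \<psi>, of ?s] s by simp
      have "proj u' = proj (cut ?n (\<lambda>j. R j (h v)))"
        using R_rep[OF y] Ri i(1) u' v(3) by auto
      then obtain c where "c \<noteq> 0" and c: "cut ?n (\<lambda>j. R j (h v)) = (\<lambda>j. c * u' j)" by (auto simp: proj_eq_iff)
      have "c ^ e * \<psi> u' = \<psi> (cut ?n (\<lambda>j. R j (h v)))" unfolding c form_fun_scale[OF \<psi>] ..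
      also have "\<dots> = 0" using R0 by (simp add: form_fun_cut[OF \<psi>])
      finally show "\<psi> u' = 0" using \<open>c \<noteq> 0\<close> by simp
    qed
  qed
  then show ?thesis by blast
qed

end

section \<open>The quadratic extension\<close>

lemma ring_of_type_algebra_simps [simp]:
  "carrier ring_of_type_algebra = UNIV" "x \<otimes>\<^bsub>ring_of_type_algebra\<^esub> y = x * y"
  "x \<oplus>\<^bsub>ring_of_type_algebra\<^esub> y = x + y" "\<one>\<^bsub>ring_of_type_algebra\<^esub> = 1"
  "\<zero>\<^bsub>ring_of_type_algebra\<^esub> = 0"
  by (simp_all add: ring_of_type_algebra_def)

lemma field_ops:
  fixes x :: "'a::field"
  shows "\<ominus>\<^bsub>ring_of_type_algebra\<^esub> x = - x" "x \<noteq> 0 \<Longrightarrow> inv\<^bsub>ring_of_type_algebra\<^esub> x = inverse x"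
proof -
  interpret F: field "ring_of_type_algebra :: 'a ring" by (rule field_from_type_algebra)
  show "\<ominus>\<^bsub>ring_of_type_algebra\<^esub> x = - x" by (rule F.minus_equality) simp_all
  show "inv\<^bsub>ring_of_type_algebra\<^esub> x = inverse x" if "x \<noteq> 0"
    by (rule F.comm_inv_char) (use that in simp_all)
qed

lemma subfield_coeff_ring:
  fixes L :: "'a::field set"
  assumes "subfield L ring_of_type_algebra"
  shows "coeff_ring L" "a \<in> L \<Longrightarrow> inverse a \<in> L"
proof -
  interpret F: field "ring_of_type_algebra :: 'a ring" by (rule field_from_type_algebra)
  have sub: "subring L ring_of_type_algebra" by (rule subfieldE(1)[OF assms])
  show "coeff_ring L"
    using subringE[OF sub] by (auto simp: coeff_ring_def field_ops)
  show "inverse a \<in> L" if "a \<in> L"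
  proof (cases "a = 0")
    case False
    then show ?thesis using F.subfield_m_inv(1)[OF assms, of a] that by (simp add: field_ops)
  qed (use that in simp)
qed

lemma base_field_subfield: "subfield (base_field :: 'k::field alg_closure set) ring_of_type_algebra"
proof -
  interpret F: field "ring_of_type_algebra :: 'k alg_closure ring" by (rule field_from_type_algebra)
  show ?thesis
  proof (rule F.subfieldI'[OF F.subringI])
    fix h :: "'k alg_closure" assume "h \<in> base_field"
    then obtain a where "h = to_ac a" by auto
    then have "\<ominus>\<^bsub>ring_of_type_algebra\<^esub> h = to_ac (- a)" by (simp add: field_ops)
    then show "\<ominus>\<^bsub>ring_of_type_algebra\<^esub> h \<in> base_field" by blast
  next
    fix h h' :: "'k alg_closure" assume "h \<in> base_field" "h' \<in> base_field"
    then obtain a b where "h = to_ac a" "h' = to_ac b" by auto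
    then have "h * h' = to_ac (a * b)" "h + h' = to_ac (a + b)" by simp_all
    then show "h \<otimes>\<^bsub>ring_of_type_algebra\<^esub> h' \<in> base_field" "h \<oplus>\<^bsub>ring_of_type_algebra\<^esub> h' \<in> base_field"
      by (metis ring_of_type_algebra_simps(2) rangeI) (metis \<open>h + h' = _\<close> ring_of_type_algebra_simps(3) rangeI)
  next
    fix k :: "'k alg_closure" assume k: "k \<in> base_field - {\<zero>\<^bsub>ring_of_type_algebra\<^esub>}"
    then obtain a where "k = to_ac a" by auto
    then have "inv\<^bsub>ring_of_type_algebra\<^esub> k = to_ac (inverse a)" using k by (simp add: field_ops)
    then show "inv\<^bsub>ring_of_type_algebra\<^esub> k \<in> base_field" by blast
  qed (use to_ac_1 in \<open>auto intro: rangeI[of to_ac 1, simplified]\<close>)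
qed

text \<open>The extension generated by \<open>r\<close> is finite since \<open>r\<close> is a root of \<open>X^2 - r^2\<close>.\<close>

lemma adjoin_square_root:
  fixes r :: "'k::field alg_closure"
  assumes "r^2 \<in> base_field"
  shows "\<exists>L. finite_extension_of_base L \<and> r \<in> L"
proof -
  let ?R = "ring_of_type_algebra :: 'k alg_closure ring"
  interpret F: field ?R by (rule field_from_type_algebra)
  note sf = base_field_subfield[where 'k = 'k]
  note sr = subfieldE(1)[OF sf]
  have r: "r \<in> carrier ?R" by simp
  have one: "(1 :: 'k alg_closure) \<in> base_field" using subringE(3)[OF sr] by simp
  have m: "- (r^2) \<in> base_field" "(0 :: 'k alg_closure) \<in> base_field"
    using subfield_coeff_ring(1)[OF sf] assms by (auto simp: coeff_ring_def)
  have "(F.algebraic over base_field) r"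
  proof (rule F.algebraicI)
    show "[1, 0, - (r^2)] \<in> carrier (univ_poly ?R base_field)"
      unfolding univ_poly_carrier[symmetric] polynomial_def using one m by simp
    show "F.eval [1, 0, - (r^2)] r = \<zero>\<^bsub>?R\<^esub>"
      by (simp add: power2_eq_square)
  qed simp
  then have "subfield (F.simple_extension base_field r) ?R" "F.finite_dimension base_field (F.simple_extension base_field r)"
    using F.simple_extension_is_subfield[OF sf r] F.finite_dimension_simple_extension[OF sf r] by auto
  moreover have "base_field \<subseteq> F.simple_extension base_field r" "r \<in> F.simple_extension base_field r"
    using F.simple_extension_incl[of base_field r] F.simple_extension_mem[OF sr r] by auto
  ultimately show ?thesis unfolding finite_extension_of_base_def by blast
qed

theorem proposition1p3:
  fixes t :: "'k::field"
    and Xt Km :: "'k alg_closure pset"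
    and \<pi> :: "'k alg_closure ppoint \<Rightarrow> 'k alg_closure ppoint"
  assumes "CHAR('k) \<noteq> 2"
    and "t \<noteq> 0" and "t \<noteq> -1"
    and "minimal_resolution base_field (double_plane (to_ac t)) Xt \<pi>"
    and "kummer_surface base_field (EE (to_ac t)) (EE_neg (to_ac t)) Km"
  shows "\<exists>L F. finite_extension_of_base L \<and> dominant_rational_map L Xt Km F"
proof -
  let ?t = "to_ac t" and ?K = "base_field :: 'k alg_closure set"
  have t1: "t + 1 \<noteq> 0" using assms(3) by (simp add: add_eq_0_iff2)
  have "(2::'k) \<noteq> 0"
  proof
    assume "(2::'k) = 0"
    then have "of_nat 2 = (0::'k)" by simp
    then have "CHAR('k) dvd 2" by (simp only: of_nat_eq_0_iff_char_dvd)
    then have "CHAR('k) \<le> 2" "CHAR('k) \<noteq> 0" by (auto dest: dvd_imp_le intro!: Nat.gr0I)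
    moreover have "CHAR('k) \<noteq> 1" by simp
    ultimately show False using assms(1) by linarith
  qed
  then have two: "(2::'k alg_closure) \<noteq> 0"
    by (metis to_ac_eq_0_iff to_ac_numeral)
  obtain r where r: "r^2 = 1 / (?t + 1)" using nth_root_exists[of 2 "1 / (?t + 1)"] by auto
  have cK: "1 / (?t + 1) \<in> ?K"
  proof -
    have "1 / (?t + 1) = to_ac (1 / (t + 1))" by simp
    then show ?thesis by blast
  qed
  interpret square_root_parameter ?t r
  proof
    show "?t + 1 \<noteq> 0" using t1 by (metis to_ac_1 to_ac_add to_ac_eq_0_iff)
  qed (use two assms(2) r in simp_all)
  obtain L where L: "finite_extension_of_base L" "r \<in> L"
    using adjoin_square_root[of r] cK r by auto
  then have sL: "subfield L ring_of_type_algebra" and KL: "?K \<subseteq> L"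
    by (auto simp: finite_extension_of_base_def)
  note K = subfield_coeff_ring(1)[OF base_field_subfield[where 'k = 'k]]
  note L' = subfield_coeff_ring[OF sL]
  have "\<rho> \<in> L"
  proof -
    have one: "1 \<in> L" "- r \<in> L" using L'(1) L(2) by (auto simp: coeff_ring_def)
    then have "1 + - r \<in> L" "1 + r \<in> L" using L'(1) L(2) unfolding coeff_ring_def by blast+
    then have "(1 + - r) * inverse (1 + r) \<in> L" using L' unfolding coeff_ring_def by blast
    then show ?thesis by (simp add: \<rho>_def divide_inverse)
  qed
  from assms(5) obtain Q q \<beta> where quot: "involution_quotient ?K (EE ?t) (EE_neg ?t) Q q"
    and blow: "blowup ?K Q (sing_points Q) Km \<beta>" by (auto simp: kummer_surface_def)
  have vX: "variety ?K Xt" and bir: "birational_morphism ?K Xt (double_plane ?t) \<pi>"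
    using assms(4) by (auto simp: minimal_resolution_def resolution_def)
  have vQ: "variety ?K Q" using quot by (simp add: involution_quotient_def)
  have vKm: "variety ?K Km" using blow by (simp add: blowup_def)
  note X = varietyD[OF vX] and Q = varietyD[OF vQ]
  have irr: "form_irreducible (amb (double_plane ?t)) (pts (double_plane ?t))"
    using double_plane_irreducible[OF t0] by simp
  have sub: "pts (double_plane ?t) \<subseteq> pspace (amb (double_plane ?t))" using double_plane_sub by simp
  obtain \<phi>1 where 1: "dominates ?K (amb Xt) (pts Xt) 10 (pts (double_plane ?t)) \<phi>1"
    using birational_morphism_dominates[OF K bir X(2) sub irr] by auto
  obtain \<phi>2 where 2: "dominates L 10 (pts (double_plane ?t)) (amb Q) (pts Q) \<phi>2"
    using double_plane_dominates_quotient[OF K cK L'(1) KL L(2) \<open>\<rho> \<in> L\<close> quot] by blast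
  obtain \<phi>3 where 3: "dominates ?K (amb Q) (pts Q) (amb Km) (pts Km) \<phi>3"
    using blowup_dominates[OF K Q(2) blow] by blast
  obtain \<phi>12 where "dominates L (amb Xt) (pts Xt) (amb Q) (pts Q) \<phi>12"
    using dominates_trans[OF L'(1) X(4) dominates_mono[OF 1 KL] 2] by blast
  then obtain \<phi> where "dominates L (amb Xt) (pts Xt) (amb Km) (pts Km) \<phi>"
    using dominates_trans[OF L'(1) X(4) _ dominates_mono[OF 3 KL]] by blast
  then obtain F where "dominant_rational_map L Xt Km F"
    using dominates_imp_dominant_rational_map[OF _ X(2) varietyD(1)[OF vKm]] by blast
  then show ?thesis using L(1) by blast
qed

end
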